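(* Let $n\ge 1$, let $M\in L^{1}(\mathbb{R}^{n})$ be a probability density function whose support $V$ is compact, and assume that $0$ belongs to the interior of $\mathrm{Conv}(V)$, the convex hull of $V$. Let $\varphi_0\in W^{1,\infty}(\mathbb{R}^n)$ and, for $\varepsilon>0$, let $\varphi^{\varepsilon}$ be the solution of $$\partial_{t}\varphi^{\varepsilon}(t,x,v)+v\cdot\nabla_{x}\varphi^{\varepsilon}(t,x,v)=\int_{V}M(v')\left(1-e^{\frac{\varphi^{\varepsilon}(t,x,v)-\varphi^{\varepsilon}(t,x,v')}{\varepsilon}}\right)dv',\quad (t,x,v)\in\mathbb{R}_{+}\times\mathbb{R}^{n}\times V,$$ with initial condition $\varphi^{\varepsilon}(0,x,v)=\varphi_{0}(x)$. Then, as $\varepsilon\to 0$, $\varphi^{\varepsilon}$ converges locally uniformly on $\mathbb{R}_{+}\times\mathbb{R}^{n}\times V$ toward a function $\varphi$ which does not depend on $v$. Moreover, $\varphi=\varphi(t,x)$ is the viscosity solution of the Hamilton-Jacobi equation $$\partial_{t}\varphi(t,x)+H(\nabla_{x}\varphi(t,x))=0,\quad (t,x)\in\mathbb{R}_{+}\times\mathbb{R}^{n},$$ with initial condition $\varphi(0,\cdot)=\varphi_0$, where the Hamiltonian $H:\mathbb{R}^n\to\mathbb{R}$ is given as follows: if $p\in\mathrm{Sing}(M)$, then $H(p)=\mu(p)-1$; otherwise, $H(p)$ is the uniquely determined real number with $H(p)\geq\mu(p)-1$ satisfying $$\int_{V}\frac{M(v)}{1+H(p)-v\cdot p}\,dv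=1.$$
   Context: Here $\cdot$ is the canonical scalar product on $\mathbb{R}^n$. For $p\in\mathbb{R}^n$, $\mu(p):=\max\{v\cdot p\mid v\in\mathrm{Conv}(V)\}$. The singular set of $M$ is $$\mathrm{Sing}(M):=\left\{p\in\mathbb{R}^{n}\ \Big|\ \int_{V}\frac{M(v)}{\mu(p)-v\cdot p}\,dv\leq 1\right\},$$ where the integrand is nonnegative, the integral may equal $+\infty$, and the convention $1/0=+\infty$ is used (in particular $0\notin\mathrm{Sing}(M)$). The solution $\varphi^{\varepsilon}$ of the kinetic Cauchy problem is its unique solution in $W^{1,\infty}$ (locally in $t$, i.e. in $W^{1,\infty}([0,T]\times\mathbb{R}^n\times V)$ for every $T>0$). *)

theory Defs
  imports "HOL-Analysis.Analysis"
begin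

section \<open>The space of bounded functions with bounded weak gradient\<close>

text \<open>\<^term>\<open>D\<close> is the gradient of \<^term>\<open>\<psi>\<close>. On a product such as
  \<^typ>\<open>real \<times> 'a\<close> it is the pair (time derivative, spatial gradient).\<close>

definition C1_on ::
  "'b::euclidean_space set \<Rightarrow> ('b \<Rightarrow> real) \<Rightarrow> ('b \<Rightarrow> 'b) \<Rightarrow> bool" where
  "C1_on U \<psi> D \<longleftrightarrow> (\<forall>z\<in>U. GDERIV \<psi> z :> D z) \<and> continuous_on U D"

definition ess_bounded :: "('b::euclidean_space \<Rightarrow> 'c::euclidean_space) \<Rightarrow> bool" where
  "ess_bounded f \<longleftrightarrow>
     f \<in> borel_measurable lborel \<and> (\<exists>C. AE z in lborel. norm (f z) \<le> C)"

definition weak_gradient :: "('b::euclidean_space \<Rightarrow> real) \<Rightarrow> ('b \<Rightarrow> 'b) \<Rightarrow> bool" where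
  "weak_gradient f G \<longleftrightarrow>
     (\<forall>\<psi> D. C1_on UNIV \<psi> D \<and> compact (closure {z. \<psi> z \<noteq> 0}) \<longrightarrow>
        (LINT z|lborel. f z *\<^sub>R D z) = - (LINT z|lborel. \<psi> z *\<^sub>R G z))"

definition W1inf :: "('b::euclidean_space \<Rightarrow> real) \<Rightarrow> bool" where
  "W1inf f \<longleftrightarrow> ess_bounded f \<and> (\<exists>G. ess_bounded G \<and> weak_gradient f G)"

text \<open>The Sobolev class on an arbitrary set \<^term>\<open>S\<close> is the space of restrictions of elements of the
  Sobolev class on the whole space, always represented by their continuous representative. This
  makes sense also when \<^term>\<open>S\<close> is not open and has no regularity; for \<^term>\<open>S = UNIV\<close>
  it is the usual space.\<close>

definition W1inf_on :: "'b::euclidean_space set \<Rightarrow> ('b \<Rightarrow> real) \<Rightarrow> bool" where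
  "W1inf_on S f \<longleftrightarrow> (\<exists>g. continuous_on UNIV g \<and> W1inf g \<and> (\<forall>z\<in>S. f z = g z))"


section \<open>Velocity distribution and Hamiltonian\<close>

text \<open>Support of an integrable function viewed as an almost-everywhere class: the complement of the
  largest open set on which it vanishes almost everywhere.\<close>

definition ess_support :: "('a::euclidean_space \<Rightarrow> real) \<Rightarrow> 'a set" where
  "ess_support M = {v. \<forall>U. open U \<and> v \<in> U \<longrightarrow> \<not> (AE w in lborel. w \<in> U \<longrightarrow> M w = 0)}"

definition prob_density :: "('a::euclidean_space \<Rightarrow> real) \<Rightarrow> bool" where
  "prob_density M \<longleftrightarrow>
     integrable lborel M \<and> (AE v in lborel. 0 \<le> M v) \<and> (LINT v|lborel. M v) = 1"

text \<open>When the support is compact so is its convex hull, and the supremum is attained.\<close>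

definition mu :: "('a::euclidean_space \<Rightarrow> real) \<Rightarrow> 'a \<Rightarrow> real" where
  "mu M p = (SUP v \<in> convex hull (ess_support M). v \<bullet> p)"

text \<open>The integral over the support of \<open>M v / (s - v \<bullet> p)\<close>, used only for
  \<open>s \<ge> mu M p\<close>, where the denominator is nonnegative. It may be infinite: division on
  \<^typ>\<open>ennreal\<close> satisfies \<open>a / 0 = \<infinity>\<close> for \<open>a \<noteq> 0\<close> (and \<open>0 / 0 = 0\<close>).\<close>

definition resolvent_integral :: "('a::euclidean_space \<Rightarrow> real) \<Rightarrow> 'a \<Rightarrow> real \<Rightarrow> ennreal" where
  "resolvent_integral M p s =
     (\<integral>\<^sup>+ v\<in>ess_support M. (ennreal (M v) / ennreal (s - v \<bullet> p)) \<partial>lborel)"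

definition Sing :: "('a::euclidean_space \<Rightarrow> real) \<Rightarrow> 'a set" where
  "Sing M = {p. resolvent_integral M p (mu M p) \<le> 1}"

definition hamiltonian :: "('a::euclidean_space \<Rightarrow> real) \<Rightarrow> 'a \<Rightarrow> real" where
  "hamiltonian M p =
     (if p \<in> Sing M then mu M p - 1
      else (THE h. h \<ge> mu M p - 1 \<and> resolvent_integral M p (1 + h) = 1))"


section \<open>The kinetic Cauchy problem\<close>

text \<open>The equation is required at almost every \<open>(t, x, v)\<close>, with classical derivatives in
  \<open>(t, x)\<close> for fixed \<open>v\<close>; functions of the class considered are differentiable almost everywhere.\<close>

definition kinetic_solution ::
  "('a::euclidean_space \<Rightarrow> real) \<Rightarrow> real \<Rightarrow> ('a \<Rightarrow> real) \<Rightarrow> (real \<Rightarrow> 'a \<Rightarrow> 'a \<Rightarrow> real) \<Rightarrow> bool" where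
  "kinetic_solution M \<epsilon> \<phi>0 \<phi> \<longleftrightarrow>
     (\<forall>T>0. W1inf_on ({0..T} \<times> UNIV \<times> ess_support M) (\<lambda>(t, x, v). \<phi> t x v)) \<and>
     (AE (t, x, v) in lborel. 0 < t \<and> v \<in> ess_support M \<longrightarrow>
        (\<exists>a q. (GDERIV (\<lambda>(s, y). \<phi> s y v) (t, x) :> (a, q)) \<and>
           a + v \<bullet> q =
             (LINT v':ess_support M|lborel. M v' * (1 - exp ((\<phi> t x v - \<phi> t x v') / \<epsilon>))))) \<and>
     (\<forall>x. \<forall>v\<in>ess_support M. \<phi> 0 x v = \<phi>0 x)"


section \<open>Viscosity solutions of the Hamilton-Jacobi Cauchy problem\<close>

definition viscosity_subsolution ::
  "('a::euclidean_space \<Rightarrow> real) \<Rightarrow> (real \<Rightarrow> 'a \<Rightarrow> real) \<Rightarrow> bool" where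
  "viscosity_subsolution H u \<longleftrightarrow>
     (\<forall>\<psi> D t x. C1_on ({0<..} \<times> UNIV) \<psi> D \<and> 0 < t \<and>
        (\<forall>\<^sub>F (s, y) in nhds (t, x). u s y - \<psi> (s, y) \<le> u t x - \<psi> (t, x)) \<longrightarrow>
        fst (D (t, x)) + H (snd (D (t, x))) \<le> 0)"

definition viscosity_supersolution ::
  "('a::euclidean_space \<Rightarrow> real) \<Rightarrow> (real \<Rightarrow> 'a \<Rightarrow> real) \<Rightarrow> bool" where
  "viscosity_supersolution H u \<longleftrightarrow>
     (\<forall>\<psi> D t x. C1_on ({0<..} \<times> UNIV) \<psi> D \<and> 0 < t \<and>
        (\<forall>\<^sub>F (s, y) in nhds (t, x). u s y - \<psi> (s, y) \<ge> u t x - \<psi> (t, x)) \<longrightarrow>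
        fst (D (t, x)) + H (snd (D (t, x))) \<ge> 0)"

text \<open>For bounded initial data, solutions are sought among the continuous functions that are bounded
  on every strip \<open>[0, T] \<times> \<real>\<^sup>n\<close>.\<close>

definition viscosity_solution ::
  "('a::euclidean_space \<Rightarrow> real) \<Rightarrow> ('a \<Rightarrow> real) \<Rightarrow> (real \<Rightarrow> 'a \<Rightarrow> real) \<Rightarrow> bool" where
  "viscosity_solution H u0 u \<longleftrightarrow>
     continuous_on ({0..} \<times> UNIV) (\<lambda>(t, x). u t x) \<and>
     (\<forall>T>0. bounded ((\<lambda>(t, x). u t x) ` ({0..T} \<times> UNIV))) \<and>
     viscosity_subsolution H u \<and> viscosity_supersolution H u \<and>
     (\<forall>x. u 0 x = u0 x)"

end

theory Submission
  imports Defs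
begin

text \<open>
  The substitution \<open>f = exp (- \<phi> / \<epsilon>)\<close> turns the kinetic equation into the linear equation
  \<open>\<epsilon> (\<partial>\<^sub>t f + v \<bullet> \<nabla> f) = avg f - f\<close>, where \<open>avg\<close> averages over the velocities with weight \<open>M\<close>. A plane
  wave \<open>exp (- (p \<bullet> x - h t) / \<epsilon>) Q v\<close> is a supersolution of it when
  \<open>(1 + h - v \<bullet> p) Q v \<ge> avg Q\<close> for all \<open>v\<close>, and a subsolution when the opposite inequality holds. The
  Hamiltonian is the threshold between the two cases. If \<open>h > H p\<close> then \<open>Q v = 1 / (1 + h - v \<bullet> p)\<close> is
  positive and bounded with \<open>avg Q \<le> 1\<close> (\<open>above_hamiltonian\<close>). If \<open>h < H p\<close> then, for some
  \<open>\<delta> > 0\<close>, the truncation \<open>Q v = 1 / max (1 + h - v \<bullet> p) \<delta>\<close> has \<open>avg Q \<ge> 1\<close>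
  (\<open>below_hamiltonian\<close>). The truncation is what makes the singular set harmless: there the
  exact profile at \<open>h = H p\<close> is unbounded and its average may be smaller than 1, but only values of \<open>h\<close>
  off the threshold are ever used, and their profiles are bounded and bounded away from 0. The two
  properties also show that the Hamiltonian is Lipschitz, with the largest speed as constant.

  Convergence is proved with relaxed limits. Let \<open>u\<close> be the upper limit of \<open>\<phi>\<^sup>\<epsilon> s y v\<close>
  as \<open>\<epsilon> \<rightarrow> 0\<close> and \<open>(s, y) \<rightarrow> (t, x)\<close>, with \<open>v\<close> free in the support, and let \<open>l\<close> be the lower limit.
  If a smooth \<open>\<psi>\<close> touches \<open>u\<close> from above at \<open>z\<close>, then for small \<open>\<epsilon>\<close> the function
  \<open>\<phi>\<^sup>\<epsilon> - \<psi> - \<epsilon> ln (1 / Q)\<close> has a maximum over \<open>(t, x, v)\<close> near \<open>z\<close>. There the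
  derivative along the characteristic vanishes, and maximality in \<open>v\<close> bounds the right-hand side of the
  kinetic equation by \<open>1 - avg Q / Q v\<close>; hence \<open>u\<close> is a viscosity subsolution
  (\<open>upper_limit_subsolution\<close>), and symmetrically \<open>l\<close> is a supersolution
  (\<open>lower_limit_supersolution\<close>). By construction \<open>l \<le> u\<close>. Both limits take the initial value
  \<open>\<phi>\<^sub>0\<close> because \<open>\<bar>\<phi>\<^sup>\<epsilon> t x v - \<phi>\<^sub>0 x\<bar> \<le> C t\<close> with \<open>C\<close> independent of \<open>\<epsilon>\<close> (\<open>kinetic_bounds\<close>). The comparison
  principle \<open>HJ_comparison\<close>, for semicontinuous functions and a Lipschitz Hamiltonian, gives \<open>u \<le> l\<close>. So
  \<open>u = l\<close> is continuous, it does not see \<open>v\<close>, it is a viscosity solution, and equality of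
  the two relaxed limits is locally uniform convergence. The same principle gives uniqueness.

  These arguments need the kinetic equation pointwise, at the maximum points, whereas a solution satisfies
  it almost everywhere only. A continuous function of class \<open>W1inf\<close> is
  Lipschitz, so it can be integrated along almost every characteristic; the resulting
  integral equation is continuous in all variables, hence holds on every characteristic
  (\<open>kinetic_mild\<close>).
\<close>

section \<open>Bounded functions with bounded weak gradient are Lipschitz\<close>

lemma positive_part_square_expansion:
  fixes r d :: real
  shows "\<bar>(max 0 (r + d))\<^sup>2 - (max 0 r)\<^sup>2 - 2 * max 0 r * d\<bar> \<le> d\<^sup>2"
proof (cases "r \<ge> 0")
  case True
  show ?thesis
  proof (cases "r + d \<ge> 0")
    case True
    then show ?thesis using \<open>r \<ge> 0\<close> by (simp add: max_def power2_eq_square algebra_simps)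
  next
    case False
    have a: "0 \<le> r * (- 2 * d - r)" using False \<open>r \<ge> 0\<close> by (intro mult_nonneg_nonneg) auto
    have b: "0 \<le> (r + d)\<^sup>2" by simp
    have e: "(max 0 (r + d))\<^sup>2 - (max 0 r)\<^sup>2 - 2 * max 0 r * d = r * (- 2 * d - r)"
      using False \<open>r \<ge> 0\<close> by (simp add: max_def power2_eq_square algebra_simps)
    have "r * (- 2 * d - r) \<le> d\<^sup>2" using b by (simp add: power2_eq_square algebra_simps)
    then show ?thesis unfolding e using a by simp
  qed
next
  case False
  show ?thesis
  proof (cases "r + d \<ge> 0")
    case True
    then have "(r + d)\<^sup>2 \<le> d\<^sup>2" using False by (intro power_mono) auto
    then show ?thesis using False True by (simp add: max_def)
  next
    case False
    then show ?thesis using \<open>\<not> r \<ge> 0\<close> by (simp add: max_def)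
  qed
qed

lemma DERIV_positive_part_square: "((\<lambda>r. (max 0 r)\<^sup>2) has_real_derivative 2 * max 0 r) (at r)"
proof -
  have "((\<lambda>d. ((max 0 (r + d))\<^sup>2 - (max 0 r)\<^sup>2) / d - 2 * max 0 r) \<longlongrightarrow> 0) (at 0)"
  proof (rule Lim_null_comparison)
    show "\<forall>\<^sub>F d in at 0. norm (((max 0 (r + d))\<^sup>2 - (max 0 r)\<^sup>2) / d - 2 * max 0 r) \<le> \<bar>d\<bar>"
    proof (rule eventually_mono[OF eventually_neq_at_within[of 0]])
      fix d :: real assume d: "d \<noteq> 0"
      have "((max 0 (r + d))\<^sup>2 - (max 0 r)\<^sup>2) / d - 2 * max 0 r
          = ((max 0 (r + d))\<^sup>2 - (max 0 r)\<^sup>2 - 2 * max 0 r * d) / d"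
        using d by (simp add: field_simps)
      then have "norm (((max 0 (r + d))\<^sup>2 - (max 0 r)\<^sup>2) / d - 2 * max 0 r) \<le> d\<^sup>2 / \<bar>d\<bar>"
        using positive_part_square_expansion[of r d] by (simp add: abs_divide divide_right_mono)
      also have "\<dots> = \<bar>d\<bar>" using d by (simp add: power2_eq_square abs_if)
      finally show "norm (((max 0 (r + d))\<^sup>2 - (max 0 r)\<^sup>2) / d - 2 * max 0 r) \<le> \<bar>d\<bar>" .
    qed
    show "((\<lambda>d::real. \<bar>d\<bar>) \<longlongrightarrow> 0) (at 0)" by (rule tendsto_eq_intros refl | simp)+
  qed
  then show ?thesis unfolding DERIV_def by (rule LIM_zero_cancel)
qed

text \<open>Nonempty open sets are not negligible. This upgrades almost-everywhere statements about continuous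
  functions to pointwise ones.\<close>

lemma closed_full_measure_UNIV:
  fixes S :: "'b::euclidean_space set"
  assumes "closed S" "AE x in lborel. x \<in> S"
  shows "S = UNIV"
proof (rule ccontr)
  assume "S \<noteq> UNIV"
  then have "- S \<noteq> {}" "open (- S)" using assms(1) by auto
  then have n: "\<not> negligible (- S)" by (simp add: open_not_negligible)
  have "- S \<in> sets lborel" using assms(1) by simp
  then have "- S \<in> null_sets lborel"
    using assms(2) by (simp add: AE_iff_null_sets)
  then have "negligible (- S)"
    by (simp add: negligible_iff_null_sets null_sets_completionI)
  with n show False by simp
qed

text \<open>An unnormalised mollifier supported in the ball of radius \<open>sqrt a\<close>. The square of the positive part is the
  simplest choice that is continuously differentiable and has a quadratic Taylor remainder.\<close>

definition bump :: "real \<Rightarrow> 'b::euclidean_space \<Rightarrow> real" where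
  "bump a z = (max 0 (a - z \<bullet> z))\<^sup>2"

lemma bump_expansion:
  "\<bar>bump a (z + h) - bump a z + 4 * max 0 (a - z \<bullet> z) * (z \<bullet> h)\<bar>
     \<le> (2 * (z \<bullet> h) + h \<bullet> h)\<^sup>2 + 2 * max 0 (a - z \<bullet> z) * (h \<bullet> h)"
proof -
  let ?r = "a - z \<bullet> z" and ?d = "- (2 * (z \<bullet> h) + h \<bullet> h)"
  have "a - (z + h) \<bullet> (z + h) = ?r + ?d" by (simp add: inner_add_left inner_add_right inner_commute)
  then have e: "bump a (z + h) - bump a z + 4 * max 0 ?r * (z \<bullet> h)
     = ((max 0 (?r + ?d))\<^sup>2 - (max 0 ?r)\<^sup>2 - 2 * max 0 ?r * ?d) - 2 * max 0 ?r * (h \<bullet> h)"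
    unfolding bump_def by (simp add: algebra_simps)
  have "0 \<le> 2 * max 0 ?r * (h \<bullet> h)" by simp
  moreover have "?d\<^sup>2 = (2 * (z \<bullet> h) + h \<bullet> h)\<^sup>2" by (simp only: power2_minus)
  ultimately show ?thesis unfolding e using positive_part_square_expansion[of ?r ?d] by linarith
qed

lemma GDERIV_bump: "GDERIV (\<lambda>z. bump a (x - z)) z :> (4 * max 0 (a - (x - z) \<bullet> (x - z))) *\<^sub>R (x - z)"
proof -
  have g: "GDERIV (\<lambda>z. a - (x - z) \<bullet> (x - z)) z :> 2 *\<^sub>R (x - z)"
    unfolding gderiv_def by (auto intro!: derivative_eq_intros simp: inner_commute algebra_simps)
  show ?thesis unfolding bump_def
    by (rule GDERIV_subst[OF GDERIV_DERIV_compose[OF g DERIV_positive_part_square]]) simp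
qed

lemma bump_zero: "a \<le> r\<^sup>2 \<Longrightarrow> 0 \<le> r \<Longrightarrow> r \<le> norm z \<Longrightarrow> bump a z = 0"
proof -
  assume "a \<le> r\<^sup>2" "0 \<le> r" "r \<le> norm z"
  then have "r\<^sup>2 \<le> (norm z)\<^sup>2" by (intro power_mono) auto
  with \<open>a \<le> r\<^sup>2\<close> have "a - z \<bullet> z \<le> 0" by (simp add: power2_norm_eq_inner)
  then show ?thesis by (simp add: bump_def)
qed

lemma continuous_bump [continuous_intros]:
  "continuous_on S f \<Longrightarrow> continuous_on S (\<lambda>z. bump a (f z))"
  unfolding bump_def by (intro continuous_intros)

lemma integrable_continuous_compact_support:
  fixes f :: "'b::euclidean_space \<Rightarrow> 'c::euclidean_space"
  assumes "continuous_on UNIV f" "\<And>z. z \<notin> cball x r \<Longrightarrow> f z = 0"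
  shows "integrable lborel f"
proof -
  have "integrable lborel (\<lambda>z. indicator (cball x r) z *\<^sub>R f z)"
    by (rule borel_integrable_compact) (auto intro: continuous_on_subset[OF assms(1)])
  moreover have "(\<lambda>z. indicator (cball x r) z *\<^sub>R f z) = f"
    using assms(2) by (auto simp: indicator_def fun_eq_iff)
  ultimately show ?thesis by simp
qed

lemma bump_test_function:
  "C1_on UNIV (\<lambda>z. bump a (x - z)) (\<lambda>z. (4 * max 0 (a - (x - z) \<bullet> (x - z))) *\<^sub>R (x - z))"
  "a \<le> 1 \<Longrightarrow> compact (closure {z. bump a (x - z) \<noteq> 0})"
proof -
  show "C1_on UNIV (\<lambda>z. bump a (x - z)) (\<lambda>z. (4 * max 0 (a - (x - z) \<bullet> (x - z))) *\<^sub>R (x - z))"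
    unfolding C1_on_def by (auto intro!: GDERIV_bump continuous_intros)
  assume "a \<le> 1"
  have "{z. bump a (x - z) \<noteq> 0} \<subseteq> cball x 1"
    using bump_zero[of a 1] \<open>a \<le> 1\<close> by (force simp: dist_norm not_le)
  then show "compact (closure {z. bump a (x - z) \<noteq> 0})"
    using bounded_subset bounded_cball by (metis compact_closure)
qed

lemma norm_integral_le:
  fixes f :: "'b \<Rightarrow> 'c::{banach, second_countable_topology}"
  assumes "integrable N g" "AE x in N. norm (f x) \<le> g x"
  shows "norm (LINT x|N. f x) \<le> (LINT x|N. g x)"
proof -
  have "AE x in N. 0 \<le> g x" using assms(2) by (auto elim!: eventually_mono intro: order_trans[OF norm_ge_zero])
  then show ?thesis
    by (intro order_trans[OF integral_norm_bound] integral_mono_AE' assms) auto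
qed

text \<open>Let \<open>g a x\<close> be the integral of \<open>f\<close> against the bump centred at \<open>x\<close>. The
  definition of the weak gradient, tested with that bump, shows that \<open>g a\<close> has gradient
  \<open>\<integral> bump a (x - z) G z dz\<close>, of norm at most \<open>C\<close> times the mass of the bump. So \<open>g a\<close> divided by this mass
  is \<open>C\<close>-Lipschitz, and it tends to \<open>f\<close> pointwise as \<open>a \<rightarrow> 0\<close>.\<close>

lemma continuous_weakly_differentiable_lipschitz:
  fixes f :: "'b::euclidean_space \<Rightarrow> real"
  assumes cont: "continuous_on UNIV f" and B: "\<And>z. \<bar>f z\<bar> \<le> B"
    and wg: "weak_gradient f G" and Gm: "G \<in> borel_measurable lborel"
    and C: "AE z in lborel. norm (G z) \<le> C"
  shows "\<bar>f x - f y\<bar> \<le> C * norm (x - y)"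
proof -
  have B0: "0 \<le> B" using B[of 0] by linarith
  have fm: "f \<in> borel_measurable lborel" using cont by (simp add: borel_measurable_continuous_onI)
  have C0: "0 \<le> C"
  proof (rule ccontr)
    assume "\<not> 0 \<le> C"
    then have "AE z::'b in lborel. z \<in> {}"
      using C by (auto elim!: eventually_mono dest: order_trans[OF norm_ge_zero])
    then show False using closed_full_measure_UNIV[of "{}::'b set"] by simp
  qed
  let ?E = "\<lambda>a x z::'b. (4 * max 0 (a - (x - z) \<bullet> (x - z))) *\<^sub>R (x - z)"
  have int_bump: "integrable lborel (\<lambda>z. bump a (x - z))" if "a \<le> 1" for a and x :: 'b
    by (rule integrable_continuous_compact_support[of _ x 1])
       (use bump_zero[of a 1] that in \<open>force intro!: continuous_intros simp: dist_norm not_le\<close>)+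
  have int_fbump: "integrable lborel (\<lambda>z. f z * bump a (x - z))" if "a \<le> 1" for a and x :: 'b
    by (rule integrable_continuous_compact_support[of _ x 1])
       (use bump_zero[of a 1] that cont in \<open>force intro!: continuous_intros simp: dist_norm not_le\<close>)+
  have int_fE: "integrable lborel (\<lambda>z. f z *\<^sub>R ?E a x z)" if "a \<le> 1" for a x
  proof (rule integrable_continuous_compact_support[of _ x 1])
    show "continuous_on UNIV (\<lambda>z. f z *\<^sub>R ?E a x z)" using cont by (intro continuous_intros)
    fix z assume "z \<notin> cball x 1"
    then have "1 \<le> (norm (x - z))\<^sup>2" by (simp add: dist_norm power2_eq_square) (smt (verit) mult_le_one mult_less_cancel_left1)
    then have "max 0 (a - (x - z) \<bullet> (x - z)) = 0" using that by (simp add: power2_norm_eq_inner)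
    then show "f z *\<^sub>R ?E a x z = 0" by simp
  qed
  define m where "m a = (LINT z|lborel. bump a (- z::'b))" for a
  have m_eq: "(LINT z|lborel. bump a (x - z)) = m a" for a and x :: 'b
  proof -
    have "m a = (LINT z|distr lborel borel ((+) (-x)). bump a (- z::'b))"
      unfolding m_def by (simp add: lborel_distr_plus)
    also have "\<dots> = (LINT z|lborel. bump a (x - z))"
      by (subst integral_distr) (auto intro!: borel_measurable_continuous_onI continuous_intros)
    finally show ?thesis by simp
  qed
  define g where "g a x = (LINT z|lborel. f z * bump a (x - z))" for a x
  have step: "norm (g a x - g a y) \<le> C * m a * norm (x - y)" if a: "a \<le> 1" for a x y
  proof (rule differentiable_bound[where S = UNIV])
    fix x :: 'b
    let ?w = "- (LINT z|lborel. f z *\<^sub>R ?E a x z)"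
    have w_eq: "?w = (LINT z|lborel. bump a (x - z) *\<^sub>R G z)"
      using wg bump_test_function[where x=x and a=a] a unfolding weak_gradient_def by force
    have "norm ?w \<le> (LINT z|lborel. C * bump a (x - z))"
      unfolding w_eq
      by (rule norm_integral_le) (use int_bump[OF a] C in
        \<open>auto simp: bump_def mult.commute elim!: eventually_mono intro: mult_right_mono\<close>)
    also have "\<dots> = C * m a" by (simp add: m_eq)
    finally have w: "norm ?w \<le> C * m a" .
    \<comment> \<open>For \<open>norm h \<le> 1\<close> the Taylor remainder of the bump is at most \<open>(5 * norm h)\<^sup>2 + 2 * (norm h)\<^sup>2\<close>
      and vanishes outside a ball of radius 2.\<close>
    define K where "K = 27 * B * measure lborel (cball x 2)"
    have rem: "\<bar>g a (x + h) - g a x - h \<bullet> ?w\<bar> \<le> K * (norm h)\<^sup>2" if h: "norm h \<le> 1" for h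
    proof -
      have "g a (x + h) - g a x - h \<bullet> ?w
        = (LINT z|lborel. f z * bump a (x + h - z) - f z * bump a (x - z) + (f z *\<^sub>R ?E a x z) \<bullet> h)"
        using int_fbump[OF a] int_fE[OF a] unfolding g_def
        by (simp del: scaleR_scaleR inner_scaleR_left add: inner_commute[of h])
      also have "norm \<dots> \<le> (LINT z|lborel. 27 * B * (norm h)\<^sup>2 * indicator (cball x 2) z)"
      proof (rule norm_integral_le, safe intro!: AE_I2)
        show "integrable lborel (\<lambda>z. 27 * B * (norm h)\<^sup>2 * indicator (cball x 2) z)"
          using emeasure_compact_finite[of "cball x 2"] by simp
        fix z
        let ?r = "bump a (x - z + h) - bump a (x - z) + 4 * max 0 (a - (x - z) \<bullet> (x - z)) * ((x - z) \<bullet> h)"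
        have "\<bar>?r\<bar> \<le> 27 * (norm h)\<^sup>2 * indicator (cball x 2) z"
        proof (cases "z \<in> cball x 2")
          case True
          then have n: "norm (x - z) \<le> 2" by (simp add: dist_norm)
          have "h \<bullet> h = norm h * norm h" by (simp add: norm_eq_sqrt_inner)
          then have "\<bar>2 * ((x - z) \<bullet> h) + h \<bullet> h\<bar> \<le> 2 * (norm (x - z) * norm h) + norm h * norm h"
            using Cauchy_Schwarz_ineq2[of "x - z" h] inner_ge_zero[of h] by linarith
          also have "\<dots> \<le> 2 * (2 * norm h) + 1 * norm h"
            using n h by (intro add_mono mult_left_mono mult_right_mono) auto
          finally have "\<bar>2 * ((x - z) \<bullet> h) + h \<bullet> h\<bar> \<le> \<bar>5 * norm h\<bar>" by simp
          then have 1: "(2 * ((x - z) \<bullet> h) + h \<bullet> h)\<^sup>2 \<le> (5 * norm h)\<^sup>2"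
            by (simp only: abs_le_square_iff)
          have "max 0 (a - (x - z) \<bullet> (x - z)) \<le> 1" using a inner_ge_zero[of "x - z"] by linarith
          then have 2: "2 * max 0 (a - (x - z) \<bullet> (x - z)) * (h \<bullet> h) \<le> 2 * (norm h)\<^sup>2"
            by (simp add: power2_norm_eq_inner mult_left_le_one_le)
          show ?thesis using bump_expansion[of a "x - z" h] 1 2 True by (simp add: power_mult_distrib)
        next
          case False
          then have n: "norm (x - z) > 2" by (simp add: dist_norm)
          then have "norm (x - z + h) \<ge> 1" using h norm_triangle_ineq4[of "x - z + h" h] by simp
          then have 1: "bump a (x - z + h) = 0" using bump_zero[of a 1] a by simp
          have 2: "bump a (x - z) = 0" using bump_zero[of a 1 "x - z"] a n by simp
          then have "max 0 (a - (x - z) \<bullet> (x - z)) = 0" by (simp add: bump_def)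
          then show ?thesis using 1 2 by simp
        qed
        then have "\<bar>f z * ?r\<bar> \<le> B * (27 * (norm h)\<^sup>2 * indicator (cball x 2) z)"
          unfolding abs_mult using B B0 by (intro mult_mono) auto
        moreover have "f z * bump a (x + h - z) - f z * bump a (x - z) + (f z *\<^sub>R ?E a x z) \<bullet> h = f z * ?r"
          by (simp add: algebra_simps)
        ultimately show "norm (f z * bump a (x + h - z) - f z * bump a (x - z) + (f z *\<^sub>R ?E a x z) \<bullet> h)
            \<le> 27 * B * (norm h)\<^sup>2 * indicator (cball x 2) z"
          by (simp add: algebra_simps)
      qed
      also have "\<dots> = K * (norm h)\<^sup>2"
        using emeasure_compact_finite[of "cball x 2"] by (simp add: K_def)
      finally show ?thesis by simp
    qed
    have "(g a has_derivative (\<lambda>h. h \<bullet> ?w)) (at x)"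
      unfolding has_derivative_at
    proof (intro conjI bounded_linear_inner_left)
      show "(\<lambda>h. norm (g a (x + h) - g a x - h \<bullet> ?w) / norm h) \<midarrow>0\<rightarrow> 0"
      proof (rule Lim_null_comparison)
        have "\<forall>\<^sub>F h::'b in at 0. norm h < 1" by (auto simp: eventually_at intro!: exI[of _ 1])
        then show "\<forall>\<^sub>F h in at 0. norm (norm (g a (x + h) - g a x - h \<bullet> ?w) / norm h) \<le> K * norm h"
        proof (rule eventually_elim2[OF _ eventually_neq_at_within[of 0]])
          fix h :: 'b assume h: "norm h < 1" "h \<noteq> 0"
          have "norm (g a (x + h) - g a x - h \<bullet> ?w) / norm h \<le> K * (norm h)\<^sup>2 / norm h"
            using rem[of h] h by (intro divide_right_mono) auto
          then show "norm (norm (g a (x + h) - g a x - h \<bullet> ?w) / norm h) \<le> K * norm h"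
            using h by (simp add: power2_eq_square)
        qed
        show "((\<lambda>h::'b. K * norm h) \<longlongrightarrow> 0) (at 0)" by (rule tendsto_eq_intros refl | simp)+
      qed
    qed
    then show "(g a has_derivative (\<lambda>h. h \<bullet> ?w)) (at x within UNIV)" by simp
    show "onorm (\<lambda>h. h \<bullet> ?w) \<le> C * m a"
    proof (rule onorm_le)
      fix h :: 'b
      have "norm (h \<bullet> ?w) \<le> norm ?w * norm h"
        using Cauchy_Schwarz_ineq2[of h ?w] by (simp add: mult.commute)
      also have "\<dots> \<le> C * m a * norm h" using w by (intro mult_right_mono) auto
      finally show "norm (h \<bullet> ?w) \<le> C * m a * norm h" .
    qed
  qed auto
  have m_pos: "m a > 0" if a: "0 < a" "a \<le> 1" for a
  proof -
    have "0 < (LINT z|lborel. (3 * a / 4)\<^sup>2 * indicator (ball 0 (sqrt a / 2)) (z::'b))"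
      using a by (simp add: content_ball_pos emeasure_bounded_finite)
    also have "\<dots> \<le> m a" unfolding m_def
    proof (rule integral_mono)
      show "integrable lborel (\<lambda>z. (3 * a / 4)\<^sup>2 * indicator (ball 0 (sqrt a / 2)) (z::'b))"
        using emeasure_bounded_finite[OF bounded_ball[of "0::'b" "sqrt a / 2"]]
        by (intro integrable_mult_right integrable_real_indicator) simp_all
      show "integrable lborel (\<lambda>z. bump a (- z::'b))" using int_bump[of a 0] a by simp
      fix z :: 'b
      show "(3 * a / 4)\<^sup>2 * indicator (ball 0 (sqrt a / 2)) z \<le> bump a (- z)"
      proof (cases "z \<in> ball 0 (sqrt a / 2)")
        case True
        then have "(norm z)\<^sup>2 \<le> (sqrt a / 2)\<^sup>2" by (intro power_mono) auto
        then have "z \<bullet> z \<le> a / 4" using a by (simp add: power2_norm_eq_inner power_divide)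
        then have "3 * a / 4 \<le> max 0 (a - z \<bullet> z)" by linarith
        then have "(3 * a / 4)\<^sup>2 \<le> (max 0 (a - z \<bullet> z))\<^sup>2" using a by (intro power_mono) linarith+
        moreover have "bump a (- z) = (max 0 (a - z \<bullet> z))\<^sup>2" by (simp add: bump_def)
        ultimately show ?thesis by (simp only: indicator_simps(1)[OF True] mult_1_right)
      qed (simp add: bump_def)
    qed
    finally show ?thesis .
  qed
  have near: "\<bar>g (r\<^sup>2) x - m (r\<^sup>2) * f x\<bar> \<le> e * m (r\<^sup>2)"
    if r: "0 < r" "r \<le> 1" and e: "\<And>z. norm (x - z) < r \<Longrightarrow> \<bar>f z - f x\<bar> \<le> e" for r e x
  proof -
    let ?a = "r\<^sup>2"
    have a: "?a \<le> 1" using r by (simp add: power_le_one)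
    have "g ?a x - m ?a * f x = (LINT z|lborel. f z * bump ?a (x - z) - bump ?a (x - z) * f x)"
      unfolding g_def m_eq[of ?a x, symmetric] using int_fbump[OF a] int_bump[OF a] by simp
    also have "norm \<dots> \<le> (LINT z|lborel. e * bump ?a (x - z))"
    proof (rule norm_integral_le, safe intro!: AE_I2)
      fix z
      have "\<bar>f z - f x\<bar> * bump ?a (x - z) \<le> e * bump ?a (x - z)"
      proof (cases "norm (x - z) < r")
        case True
        then show ?thesis using e by (intro mult_right_mono) (auto simp: bump_def)
      next
        case False
        then show ?thesis using bump_zero[of ?a r "x - z"] r by simp
      qed
      then show "norm (f z * bump ?a (x - z) - bump ?a (x - z) * f x) \<le> e * bump ?a (x - z)"
        by (simp add: abs_mult bump_def flip: left_diff_distrib mult.commute[of "f x"])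
    qed (use int_fbump[OF a] int_bump[OF a] in simp_all)
    also have "\<dots> = e * m ?a" by (simp add: m_eq)
    finally show ?thesis by simp
  qed
  show ?thesis
  proof (rule field_le_epsilon)
    fix e :: real assume "0 < e"
    then have e: "0 < e / 2" by simp
    from cont have "isCont f x" "isCont f y" by (auto simp: continuous_on_eq_continuous_at)
    then obtain r1 r2 where r: "r1 > 0" "\<And>z. dist z x < r1 \<Longrightarrow> dist (f z) (f x) < e / 2"
      "r2 > 0" "\<And>z. dist z y < r2 \<Longrightarrow> dist (f z) (f y) < e / 2"
      using e unfolding continuous_at_eps_delta by metis
    define r where "r = min 1 (min r1 r2)"
    have r0: "0 < r" "r \<le> 1" using r by (auto simp: r_def)
    have x: "\<bar>g (r\<^sup>2) x - m (r\<^sup>2) * f x\<bar> \<le> e / 2 * m (r\<^sup>2)"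
      by (rule near[OF r0]) (use r(2) in \<open>auto simp: r_def dist_norm norm_minus_commute less_imp_le\<close>)
    have y: "\<bar>g (r\<^sup>2) y - m (r\<^sup>2) * f y\<bar> \<le> e / 2 * m (r\<^sup>2)"
      by (rule near[OF r0]) (use r(4) in \<open>auto simp: r_def dist_norm norm_minus_commute less_imp_le\<close>)
    have m: "m (r\<^sup>2) > 0" using m_pos r0 by (simp add: power_le_one)
    have "\<bar>m (r\<^sup>2) * f x - m (r\<^sup>2) * f y\<bar> \<le> C * m (r\<^sup>2) * norm (x - y) + e * m (r\<^sup>2)"
    proof -
      have "\<bar>g (r\<^sup>2) x - g (r\<^sup>2) y\<bar> \<le> C * m (r\<^sup>2) * norm (x - y)"
        using step[of "r\<^sup>2" x y] r0 by (simp add: power_le_one)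
      moreover have "e * m (r\<^sup>2) = e / 2 * m (r\<^sup>2) + e / 2 * m (r\<^sup>2)" by simp
      ultimately show ?thesis using x y by linarith
    qed
    moreover have "m (r\<^sup>2) * \<bar>f x - f y\<bar> = \<bar>m (r\<^sup>2) * f x - m (r\<^sup>2) * f y\<bar>"
      using m by (simp add: abs_mult flip: right_diff_distrib)
    ultimately have "m (r\<^sup>2) * \<bar>f x - f y\<bar> \<le> m (r\<^sup>2) * (C * norm (x - y) + e)"
      by (simp add: algebra_simps)
    then show "\<bar>f x - f y\<bar> \<le> C * norm (x - y) + e" using m by simp
  qed
qed

lemma W1inf_bounded_lipschitz:
  fixes f :: "'b::euclidean_space \<Rightarrow> real"
  assumes "continuous_on UNIV f" "W1inf f"
  obtains B L where "\<And>z. \<bar>f z\<bar> \<le> B" "0 \<le> L" "\<And>x y. \<bar>f x - f y\<bar> \<le> L * norm (x - y)"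
proof -
  obtain B where "AE z in lborel. norm (f z) \<le> B"
    using assms(2) unfolding W1inf_def ess_bounded_def by auto
  then have "AE z in lborel. z \<in> {z. \<bar>f z\<bar> \<le> B}" by simp
  moreover have "closed {z. \<bar>f z\<bar> \<le> B}" using assms(1) by (intro closed_Collect_le continuous_intros)
  ultimately have B: "\<bar>f z\<bar> \<le> B" for z using closed_full_measure_UNIV by blast
  obtain G C where "weak_gradient f G" "G \<in> borel_measurable lborel" "AE z in lborel. norm (G z) \<le> C"
    using assms(2) unfolding W1inf_def ess_bounded_def by auto
  from continuous_weakly_differentiable_lipschitz[OF assms(1) B this]
  have "\<bar>f x - f y\<bar> \<le> C * norm (x - y)" for x y .
  then have "\<bar>f x - f y\<bar> \<le> max 0 C * norm (x - y)" for x y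
    by (smt (verit) mult_right_mono norm_ge_zero)
  then show ?thesis using that[of B "max 0 C"] B by auto
qed

section \<open>Averages over the velocity distribution\<close>

lemma closed_ess_support: "closed (ess_support M)"
proof -
  have "- ess_support M = \<Union>{U. open U \<and> (AE w in lborel. w \<in> U \<longrightarrow> M w = 0)}"
    unfolding ess_support_def by auto
  then have "open (- ess_support M)" by (auto intro: open_Union)
  then show ?thesis by (simp add: open_closed)
qed

lemma AE_zero_outside_ess_support:
  fixes M :: "'a::euclidean_space \<Rightarrow> real"
  shows "AE v in lborel. v \<notin> ess_support M \<longrightarrow> M v = 0"
proof -
  let ?F = "{U. open U \<and> (AE w in lborel. w \<in> U \<longrightarrow> M w = 0)}"
  obtain F where F: "F \<subseteq> ?F" "countable F" "\<Union>F = \<Union>?F"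
    using Lindelof[of ?F] by auto
  have "AE w in lborel. \<forall>U\<in>F. w \<in> U \<longrightarrow> M w = 0"
    using F by (subst AE_ball_countable) auto
  then show ?thesis
  proof eventually_elim
    case (elim w)
    show ?case
    proof
      assume "w \<notin> ess_support M"
      then have "w \<in> \<Union>?F" unfolding ess_support_def by auto
      then show "M w = 0" using elim F(3) by blast
    qed
  qed
qed

text \<open>The kinetic equation constrains almost every velocity only, and the support may contain negligible
  pieces. Still, near a point of the support there is always a good velocity, since \<open>M\<close>
  charges every neighbourhood of it; continuity in \<open>v\<close> does the rest.\<close>

lemma ess_support_meets_full_measure:
  fixes M :: "'a::euclidean_space \<Rightarrow> real"
  assumes v: "v \<in> ess_support M" and e: "e > 0" and P: "AE w in lborel. w \<in> ess_support M \<longrightarrow> P w"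
  shows "\<exists>w\<in>ess_support M. dist w v < e \<and> P w"
proof (rule ccontr)
  assume "\<not> ?thesis"
  then have n: "\<And>w. w \<in> ess_support M \<Longrightarrow> dist w v < e \<Longrightarrow> \<not> P w" by auto
  have "AE w in lborel. w \<in> ball v e \<longrightarrow> M w = 0"
    using P AE_zero_outside_ess_support[of M]
  proof eventually_elim
    case (elim w)
    then show ?case using n[of w] by (auto simp: dist_commute)
  qed
  moreover have "v \<in> ball v e" using e by simp
  ultimately show False using v unfolding ess_support_def by blast
qed

lemma divide_ennreal_antimono:
  fixes a :: ennreal
  assumes "0 \<le> y" "y \<le> x"
  shows "a / ennreal x \<le> a / ennreal y"
proof (cases "y = 0")
  case True
  then show ?thesis by (auto simp: divide_ennreal_def intro: mult_left_mono)
next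
  case False
  then have "inverse (ennreal x) \<le> inverse (ennreal y)"
    using assms by (simp add: inverse_ennreal ennreal_leI)
  then show ?thesis by (auto simp: divide_ennreal_def intro: mult_left_mono)
qed

locale velocity_distribution =
  fixes M :: "'a::euclidean_space \<Rightarrow> real"
  assumes density: "prob_density M" and compact_support: "compact (ess_support M)"
begin

abbreviation V :: "'a set" where "V \<equiv> ess_support M"

definition avg :: "('a \<Rightarrow> real) \<Rightarrow> real" where
  "avg g = (LINT v:V|lborel. M v * g v)"

lemma M_nonneg: "AE v in lborel. 0 \<le> M v" and M_integrable: "integrable lborel M"
  and M_integral: "(LINT v|lborel. M v) = 1"
  using density unfolding prob_density_def by auto

lemma V_measurable [measurable]: "V \<in> sets borel"
  by (rule borel_closed[OF closed_ess_support])

lemma avg_integrable: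
  assumes "continuous_on V g"
  shows "set_integrable lborel V (\<lambda>v. M v * g v)"
proof -
  obtain B where B: "\<And>v. v \<in> V \<Longrightarrow> norm (g v) \<le> B"
    using compact_imp_bounded[OF compact_continuous_image[OF assms compact_support]]
    unfolding bounded_iff by auto
  have [measurable]: "M \<in> borel_measurable borel" using M_integrable by auto
  have [measurable]: "(\<lambda>v. indicator V v *\<^sub>R g v) \<in> borel_measurable borel"
    using assms V_measurable by (rule borel_measurable_continuous_on_indicator[rotated])
  show ?thesis unfolding set_integrable_def
  proof (rule Bochner_Integration.integrable_bound)
    show "integrable lborel (\<lambda>v. B * M v)" using M_integrable by simp
    have "(\<lambda>v. indicator V v *\<^sub>R (M v * g v)) = (\<lambda>v. M v * (indicator V v *\<^sub>R g v))"
      by (auto simp: fun_eq_iff)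
    moreover have "(\<lambda>v. M v * (indicator V v *\<^sub>R g v)) \<in> borel_measurable lborel" by measurable
    ultimately show "(\<lambda>v. indicator V v *\<^sub>R (M v * g v)) \<in> borel_measurable lborel" by metis
    show "AE v in lborel. norm (indicator V v *\<^sub>R (M v * g v)) \<le> norm (B * M v)"
    proof (rule AE_I2)
      fix v
      show "norm (indicator V v *\<^sub>R (M v * g v)) \<le> norm (B * M v)"
        using mult_right_mono[OF B[of v], of "\<bar>M v\<bar>"] B[of v]
        by (auto simp: indicator_def abs_mult mult.commute)
    qed
  qed
qed

lemma avg_one: "avg (\<lambda>_. 1) = 1"
proof -
  have "avg (\<lambda>_. 1) = (LINT v|lborel. M v)"
    unfolding avg_def set_lebesgue_integral_def
  proof (rule integral_cong_AE)
    show "AE v in lborel. indicator V v *\<^sub>R (M v * 1) = M v"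
      using AE_zero_outside_ess_support[of M] by eventually_elim (auto simp: indicator_def)
  qed (use M_integrable in auto)
  then show ?thesis by (simp add: M_integral)
qed

lemma V_nonempty: "V \<noteq> {}"
  using avg_one unfolding avg_def set_lebesgue_integral_def by auto

lemma avg_mono:
  assumes "continuous_on V g" "continuous_on V k" "\<And>v. v \<in> V \<Longrightarrow> g v \<le> k v"
  shows "avg g \<le> avg k"
  unfolding avg_def set_lebesgue_integral_def
proof (rule integral_mono_AE)
  show "AE v in lborel. indicator V v *\<^sub>R (M v * g v) \<le> indicator V v *\<^sub>R (M v * k v)"
    using M_nonneg by eventually_elim (auto simp: indicator_def assms(3) intro: mult_left_mono)
qed (use avg_integrable[OF assms(1)] avg_integrable[OF assms(2)] in \<open>auto simp: set_integrable_def\<close>)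

lemma avg_cmult: "avg (\<lambda>v. c * g v) = c * avg g"
proof -
  have "(\<lambda>v. M v * (c * g v)) = (\<lambda>v. c * (M v * g v))" by (simp add: fun_eq_iff)
  then show ?thesis unfolding avg_def by simp
qed

lemma avg_diff:
  assumes "continuous_on V g" "continuous_on V k"
  shows "avg (\<lambda>v. g v - k v) = avg g - avg k"
  using avg_integrable[OF assms(1)] avg_integrable[OF assms(2)]
  unfolding avg_def by (simp add: right_diff_distrib set_integral_diff)

lemma avg_const: "avg (\<lambda>_. c) = c"
  using avg_cmult[of c "\<lambda>_. 1"] avg_one by simp

lemma continuous_on_avg:
  fixes F :: "'z::topological_space \<times> 'a \<Rightarrow> real"
  assumes "continuous_on (S \<times> V) F"
  shows "continuous_on S (\<lambda>z. avg (\<lambda>v. F (z, v)))"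
  unfolding continuous_on_def
proof (intro ballI tendstoI)
  fix z :: 'z and e :: real assume z: "z \<in> S" and e: "0 < e"
  have cont: "continuous_on V (\<lambda>v. F (y, v))" if "y \<in> S" for y
    by (rule continuous_on_compose2[OF assms]) (use that in \<open>auto intro!: continuous_intros\<close>)
  obtain X where X: "z \<in> X" "open X" "\<forall>y\<in>X \<inter> S. \<forall>v\<in>V. dist (F (y, v)) (F (z, v)) \<le> e / 2"
    using continuous_on_prod_compactE[OF assms compact_support z half_gt_zero[OF e]] by metis
  have "\<forall>\<^sub>F y in at z within S. y \<in> X \<inter> S"
    using X(1,2) eventually_at_topological by auto
  then show "\<forall>\<^sub>F y in at z within S. dist (avg (\<lambda>v. F (y, v))) (avg (\<lambda>v. F (z, v))) < e"
  proof eventually_elim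
    case (elim y)
    have d: "F (y, v) - F (z, v) \<le> e / 2" "- (e / 2) \<le> F (y, v) - F (z, v)" if "v \<in> V" for v
    proof -
      have "\<bar>F (y, v) - F (z, v)\<bar> \<le> e / 2" using X(3) elim that by (simp add: dist_real_def)
      then show "F (y, v) - F (z, v) \<le> e / 2" and "- (e / 2) \<le> F (y, v) - F (z, v)"
        unfolding abs_le_iff by auto
    qed
    have "avg (\<lambda>v. F (y, v)) - avg (\<lambda>v. F (z, v)) = avg (\<lambda>v. F (y, v) - F (z, v))"
      using cont z elim by (simp add: avg_diff)
    moreover have "avg (\<lambda>v. F (y, v) - F (z, v)) \<le> avg (\<lambda>_. e / 2)"
      by (rule avg_mono) (use cont z elim d in \<open>auto intro!: continuous_intros\<close>)
    moreover have "avg (\<lambda>_. - (e / 2)) \<le> avg (\<lambda>v. F (y, v) - F (z, v))"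
      by (rule avg_mono) (use cont z elim d in \<open>auto intro!: continuous_intros\<close>)
    ultimately show ?case using e by (simp add: avg_const dist_real_def)
  qed
qed

section \<open>The Hamiltonian as a threshold\<close>

lemma mu_upper: "v \<in> V \<Longrightarrow> v \<bullet> p \<le> mu M p"
  unfolding mu_def
proof (rule cSUP_upper)
  show "v \<in> V \<Longrightarrow> v \<in> convex hull V" by (rule hull_inc)
  have "compact ((\<lambda>v. v \<bullet> p) ` (convex hull V))"
    by (intro compact_continuous_image compact_convex_hull compact_support continuous_intros)
  then show "bdd_above ((\<lambda>v. v \<bullet> p) ` (convex hull V))"
    by (intro bounded_imp_bdd_above compact_imp_bounded)
qed

lemma mu_least: "(\<And>v. v \<in> V \<Longrightarrow> v \<bullet> p \<le> c) \<Longrightarrow> mu M p \<le> c"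
  unfolding mu_def
proof (rule cSUP_least)
  assume *: "\<And>v. v \<in> V \<Longrightarrow> v \<bullet> p \<le> c"
  show "convex hull V \<noteq> {}" using V_nonempty by simp
  have "convex hull V \<subseteq> {v. v \<bullet> p \<le> c}"
    by (rule hull_minimal) (use * in \<open>auto simp: inner_commute[of _ p] convex_halfspace_le\<close>)
  then show "\<And>v. v \<in> convex hull V \<Longrightarrow> v \<bullet> p \<le> c" by auto
qed

lemma continuous_resolvent: "mu M p < s \<Longrightarrow> continuous_on V (\<lambda>v. 1 / (s - v \<bullet> p))"
  by (intro continuous_intros) (use mu_upper[of _ p] in fastforce)

lemma resolvent_integral_eq:
  assumes "mu M p < s"
  shows "resolvent_integral M p s = ennreal (avg (\<lambda>v. 1 / (s - v \<bullet> p)))"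
proof -
  have pos: "s - v \<bullet> p > 0" if "v \<in> V" for v using mu_upper[OF that, of p] assms by linarith
  have i: "integrable lborel (\<lambda>v. indicator V v *\<^sub>R (M v * (1 / (s - v \<bullet> p))))"
    using avg_integrable[OF continuous_resolvent[OF assms]] unfolding set_integrable_def .
  have "resolvent_integral M p s
      = (\<integral>\<^sup>+ v. ennreal (indicator V v *\<^sub>R (M v * (1 / (s - v \<bullet> p)))) \<partial>lborel)"
    unfolding resolvent_integral_def
  proof (rule nn_integral_cong_AE)
    show "AE v in lborel. ennreal (M v) / ennreal (s - v \<bullet> p) * indicator V v =
        ennreal (indicator V v *\<^sub>R (M v * (1 / (s - v \<bullet> p))))"
      using M_nonneg
    proof eventually_elim
      case (elim v)
      then show ?case using pos[of v] by (auto simp: indicator_def divide_ennreal)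
    qed
  qed
  also have "\<dots> = ennreal (avg (\<lambda>v. 1 / (s - v \<bullet> p)))"
    unfolding avg_def set_lebesgue_integral_def
  proof (rule nn_integral_eq_integral[OF i])
    show "AE v in lborel. 0 \<le> indicator V v *\<^sub>R (M v * (1 / (s - v \<bullet> p)))"
      using M_nonneg
    proof eventually_elim
      case (elim v)
      then show ?case using pos[of v] by (auto simp: indicator_def)
    qed
  qed
  finally show ?thesis .
qed

text \<open>Strictness is quantitative: on the compact support the two denominators are at most some \<open>K\<close>, so the integrands
  differ by at least \<open>(t - s) / K\<^sup>2\<close>, and \<open>M\<close> has total mass 1.\<close>

lemma avg_resolvent_strict_decreasing:
  assumes s: "mu M p < s" and st: "s < t"
  shows "avg (\<lambda>v. 1 / (t - v \<bullet> p)) < avg (\<lambda>v. 1 / (s - v \<bullet> p))"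
proof -
  obtain B where B: "\<And>v. v \<in> V \<Longrightarrow> norm v \<le> B"
    using compact_imp_bounded[OF compact_support] unfolding bounded_iff by auto
  define K where "K = \<bar>s\<bar> + \<bar>t\<bar> + \<bar>B\<bar> * norm p + 1"
  have K: "K > 0" unfolding K_def by (smt (verit) mult_nonneg_nonneg norm_ge_zero)
  have Kt: "t - v \<bullet> p \<le> K" "s - v \<bullet> p \<le> K" if "v \<in> V" for v
  proof -
    have "\<bar>v \<bullet> p\<bar> \<le> norm v * norm p" by (rule Cauchy_Schwarz_ineq2)
    also have "\<dots> \<le> \<bar>B\<bar> * norm p" using B[OF that] by (intro mult_right_mono) auto
    finally have "\<bar>v \<bullet> p\<bar> \<le> \<bar>B\<bar> * norm p" .
    then have "t - v \<bullet> p \<le> K \<and> s - v \<bullet> p \<le> K" unfolding K_def by linarith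
    then show "t - v \<bullet> p \<le> K" and "s - v \<bullet> p \<le> K" by auto
  qed
  have c: "continuous_on V (\<lambda>v. 1 / (t - v \<bullet> p))" "continuous_on V (\<lambda>v. 1 / (s - v \<bullet> p))"
    using s st by (auto intro!: continuous_resolvent)
  have "0 < (t - s) / (K * K)" using K st by simp
  also have "(t - s) / (K * K) = avg (\<lambda>_. (t - s) / (K * K))" by (simp add: avg_const)
  also have "\<dots> \<le> avg (\<lambda>v. 1 / (s - v \<bullet> p) - 1 / (t - v \<bullet> p))"
  proof (rule avg_mono)
    fix v assume v: "v \<in> V"
    have pos: "s - v \<bullet> p > 0" "t - v \<bullet> p > 0" using mu_upper[OF v, of p] s st by linarith+
    have "(t - s) / (K * K) \<le> (t - s) / ((s - v \<bullet> p) * (t - v \<bullet> p))"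
      using pos Kt[OF v] st K by (intro divide_left_mono mult_mono mult_pos_pos) auto
    also have "\<dots> = 1 / (s - v \<bullet> p) - 1 / (t - v \<bullet> p)"
      using pos by (simp add: divide_simps)
    finally show "(t - s) / (K * K) \<le> 1 / (s - v \<bullet> p) - 1 / (t - v \<bullet> p)" .
  qed (use c in \<open>auto intro!: continuous_intros\<close>)
  also have "\<dots> = avg (\<lambda>v. 1 / (s - v \<bullet> p)) - avg (\<lambda>v. 1 / (t - v \<bullet> p))"
    by (rule avg_diff[OF c(2,1)])
  finally show ?thesis by simp
qed

lemma continuous_avg_resolvent: "continuous_on {mu M p <..} (\<lambda>s. avg (\<lambda>v. 1 / (s - v \<bullet> p)))"
proof -
  have "continuous_on ({mu M p <..} \<times> V) (\<lambda>(s, v). 1 / (s - v \<bullet> p))"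
    unfolding case_prod_beta by (intro continuous_intros) (use mu_upper[of _ p] in fastforce)
  from continuous_on_avg[OF this] show ?thesis by simp
qed

text \<open>Monotone convergence as \<open>s\<close> decreases to \<open>mu M p\<close>; it covers the case where the limit integral is
  infinite. In the contrapositive it says that, off the singular set, the integral already exceeds 1 for some
  \<open>s > mu M p\<close>, which provides the left end point for the intermediate value theorem.\<close>

lemma resolvent_integral_limit:
  assumes "\<And>s. mu M p < s \<Longrightarrow> resolvent_integral M p s \<le> 1"
  shows "resolvent_integral M p (mu M p) \<le> 1"
proof -
  let ?s = "\<lambda>n. mu M p + 1 / Suc n"
  let ?g = "\<lambda>s v. ennreal (M v) / ennreal (s - v \<bullet> p) * indicator V v"
  have [measurable]: "M \<in> borel_measurable borel" using M_integrable by auto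
  have sup: "(SUP n. ?g (?s n) v) = ?g (mu M p) v" for v
  proof (cases "v \<in> V \<and> 0 < M v")
    case True
    then have d: "0 \<le> mu M p - v \<bullet> p" using mu_upper[of v p] by simp
    have "(\<lambda>n. ennreal (?s n - v \<bullet> p)) \<longlonglongrightarrow> ennreal (mu M p + 0 - v \<bullet> p)"
      by (intro tendsto_ennrealI tendsto_intros LIMSEQ_Suc[OF lim_1_over_n])
    then have "(\<lambda>n. ennreal (M v) / ennreal (?s n - v \<bullet> p)) \<longlonglongrightarrow> ennreal (M v) / ennreal (mu M p - v \<bullet> p)"
      unfolding divide_ennreal_def
      by (intro ennreal_tendsto_cmult
          continuous_on_tendsto_compose[OF continuous_on_inverse_ennreal[OF continuous_on_id[of UNIV]]]) simp_all
    then have "(\<lambda>n. ?g (?s n) v) \<longlonglongrightarrow> ?g (mu M p) v" using True by simp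
    moreover have "incseq (\<lambda>n. ?g (?s n) v)"
      using d by (auto simp: incseq_def add_increasing2 intro!: mult_right_mono divide_ennreal_antimono divide_left_mono)
    ultimately show ?thesis using LIMSEQ_SUP LIMSEQ_unique by blast
  next
    case False
    then have "ennreal (M v) = 0 \<or> v \<notin> V" by (auto simp: ennreal_eq_0_iff)
    then show ?thesis by (auto simp: ennreal_divide_eq_0_iff)
  qed
  have "resolvent_integral M p (mu M p) = (\<integral>\<^sup>+ v. (SUP n. ?g (?s n) v) \<partial>lborel)"
    unfolding resolvent_integral_def sup ..
  also have "\<dots> = (SUP n. \<integral>\<^sup>+ v. ?g (?s n) v \<partial>lborel)"
  proof (rule nn_integral_monotone_convergence_SUP)
    show "incseq (\<lambda>n v. ?g (?s n) v)"
      using mu_upper[of _ p] by (auto simp: incseq_def le_fun_def indicator_def add_increasing2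
          intro!: divide_ennreal_antimono divide_left_mono)
  qed measurable
  also have "\<dots> \<le> 1"
    using assms by (intro SUP_least) (auto simp: resolvent_integral_def)
  finally show ?thesis .
qed

lemma resolvent_root:
  assumes "p \<notin> Sing M"
  shows "\<exists>!h. h \<ge> mu M p - 1 \<and> resolvent_integral M p (1 + h) = 1"
proof -
  let ?j = "\<lambda>s. avg (\<lambda>v. 1 / (s - v \<bullet> p))"
  have nS: "\<not> resolvent_integral M p (mu M p) \<le> 1" using assms by (simp add: Sing_def)
  then obtain a where a: "mu M p < a" "\<not> resolvent_integral M p a \<le> 1"
    using resolvent_integral_limit by blast
  then have ja: "1 < ?j a" by (simp add: resolvent_integral_eq ennreal_le_1)
  \<comment> \<open>At distance 1 above \<open>mu M p\<close> every denominator is at least 1, so the average is at most 1.\<close>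
  define b where "b = max a (mu M p + 1)"
  have b: "a \<le> b" "mu M p + 1 \<le> b" unfolding b_def by auto
  have "?j b \<le> avg (\<lambda>_. 1)"
  proof (rule avg_mono)
    fix v assume "v \<in> V"
    then have "1 \<le> b - v \<bullet> p" using mu_upper[of v p] b by simp
    then show "1 / (b - v \<bullet> p) \<le> 1" by simp
  qed (use b in \<open>auto intro!: continuous_resolvent\<close>)
  then have jb: "?j b \<le> 1" by (simp add: avg_one)
  have "continuous_on {a..b} ?j"
    by (rule continuous_on_subset[OF continuous_avg_resolvent[of p]]) (use a in auto)
  then obtain s where s: "a \<le> s" "s \<le> b" "?j s = 1"
    using IVT2'[of ?j b 1 a] ja jb b by force
  have iff: "h \<ge> mu M p - 1 \<and> resolvent_integral M p (1 + h) = 1 \<longleftrightarrow> mu M p < 1 + h \<and> ?j (1 + h) = 1" for h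
  proof -
    have "resolvent_integral M p (1 + h) \<noteq> 1" if "1 + h = mu M p" using nS that by auto
    moreover have "mu M p < 1 + h" if "h \<ge> mu M p - 1" "1 + h \<noteq> mu M p" using that by linarith
    ultimately show ?thesis by (metis ennreal_eq_1 resolvent_integral_eq diff_le_eq add.commute less_imp_le)
  qed
  show ?thesis unfolding iff
  proof (rule ex1I[of _ "s - 1"])
    show "mu M p < 1 + (s - 1) \<and> ?j (1 + (s - 1)) = 1" using s a by auto
    fix h assume "mu M p < 1 + h \<and> ?j (1 + h) = 1"
    then have "\<not> 1 + h < s \<and> \<not> s < 1 + h"
      using avg_resolvent_strict_decreasing[of p "1 + h" s] avg_resolvent_strict_decreasing[of p s "1 + h"] s a
      by auto
    then show "h = s - 1" by linarith
  qed
qed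

lemma hamiltonian_regular:
  assumes "p \<notin> Sing M"
  shows "mu M p < 1 + hamiltonian M p" "avg (\<lambda>v. 1 / (1 + hamiltonian M p - v \<bullet> p)) = 1"
proof -
  have H: "hamiltonian M p \<ge> mu M p - 1 \<and> resolvent_integral M p (1 + hamiltonian M p) = 1"
    using theI'[OF resolvent_root[OF assms]] assms unfolding hamiltonian_def by simp
  have "resolvent_integral M p (mu M p) \<noteq> 1" using assms unfolding Sing_def by auto
  then show gt: "mu M p < 1 + hamiltonian M p" using H by (metis add.commute diff_le_eq order_le_imp_less_or_eq)
  show "avg (\<lambda>v. 1 / (1 + hamiltonian M p - v \<bullet> p)) = 1"
    using H resolvent_integral_eq[OF gt] by (simp add: ennreal_eq_1)
qed

lemma hamiltonian_ge: "mu M p \<le> 1 + hamiltonian M p"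
  using hamiltonian_regular(1)[of p] by (cases "p \<in> Sing M") (auto simp: hamiltonian_def)

lemma above_hamiltonian:
  assumes "hamiltonian M p < h"
  shows "mu M p < 1 + h" "avg (\<lambda>v. 1 / (1 + h - v \<bullet> p)) \<le> 1"
proof -
  show gt: "mu M p < 1 + h" using hamiltonian_ge[of p] assms by linarith
  show "avg (\<lambda>v. 1 / (1 + h - v \<bullet> p)) \<le> 1"
  proof (cases "p \<in> Sing M")
    case True
    have "ennreal (avg (\<lambda>v. 1 / (1 + h - v \<bullet> p))) \<le> resolvent_integral M p (mu M p)"
      unfolding resolvent_integral_eq[OF gt, symmetric] unfolding resolvent_integral_def
      using gt mu_upper[of _ p]
      by (intro nn_integral_mono) (auto simp: indicator_def intro!: divide_ennreal_antimono)
    also have "\<dots> \<le> 1" using True by (simp add: Sing_def)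
    finally show ?thesis by (simp add: ennreal_le_1)
  next
    case False
    then show ?thesis
      using hamiltonian_regular[OF False] avg_resolvent_strict_decreasing[of p "1 + hamiltonian M p" "1 + h"] assms
      by simp
  qed
qed

text \<open>Off the singular set, truncating at the distance \<open>\<delta> = 1 + H p - mu M p\<close> gives a profile that dominates the
  exact one at \<open>H p\<close>, whose average is 1. On the singular set \<open>1 + h < mu M p\<close>, so the set where
  \<open>1 + h - v \<bullet> p\<close> is negative has positive mass \<open>m\<close>; truncating at \<open>\<delta> = m\<close> makes
  the profile equal to \<open>1 / m\<close> there, which contributes 1 to the average.\<close>

lemma below_hamiltonian:
  assumes "h < hamiltonian M p"
  shows "\<exists>d>0. 1 \<le> avg (\<lambda>v. 1 / max (1 + h - v \<bullet> p) d)"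
proof -
  have cont: "continuous_on V (\<lambda>v. 1 / max (1 + h' - v \<bullet> p) d)" if "d > 0" for h' d
    by (intro continuous_intros) (use that in auto)
  show ?thesis
  proof (cases "p \<in> Sing M")
    case False
    note H = hamiltonian_regular[OF False]
    let ?d = "1 + hamiltonian M p - mu M p"
    have d: "?d > 0" using H(1) by simp
    have "1 = avg (\<lambda>v. 1 / (1 + hamiltonian M p - v \<bullet> p))" using H(2) by simp
    also have "\<dots> \<le> avg (\<lambda>v. 1 / max (1 + h - v \<bullet> p) ?d)"
    proof (rule avg_mono)
      fix v assume v: "v \<in> V"
      then have "max (1 + h - v \<bullet> p) ?d \<le> 1 + hamiltonian M p - v \<bullet> p"
        using mu_upper[OF v, of p] assms by simp
      then show "1 / (1 + hamiltonian M p - v \<bullet> p) \<le> 1 / max (1 + h - v \<bullet> p) ?d"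
        using d by (intro divide_left_mono mult_pos_pos) auto
    qed (use cont[OF d] continuous_resolvent[OF H(1)] in auto)
    finally show ?thesis using d by blast
  next
    case True
    then have "h + 1 < mu M p" using assms by (simp add: hamiltonian_def)
    then obtain v0 where v0: "v0 \<in> V" "h + 1 < v0 \<bullet> p"
      using mu_least[of p "h + 1"] by (meson not_le)
    let ?U = "{v. h + 1 < v \<bullet> p}"
    have U: "open ?U" by (intro open_Collect_less continuous_intros)
    have Um [measurable]: "?U \<in> sets borel" using U by auto
    have [measurable]: "M \<in> borel_measurable borel" using M_integrable by auto
    let ?m = "LINT v|lborel. indicator ?U v * M v"
    have im: "integrable lborel (\<lambda>v. indicator ?U v * M v)"
      using integrable_mult_indicator[OF _ M_integrable, of ?U] by simp
    have nn: "AE v in lborel. 0 \<le> indicator ?U v * M v"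
      using M_nonneg by eventually_elim (auto simp: indicator_def)
    have "?m \<noteq> 0"
    proof
      assume "?m = 0"
      then have "AE v in lborel. indicator ?U v * M v = 0"
        using integral_nonneg_eq_0_iff_AE[OF im nn] by simp
      then have "AE v in lborel. v \<in> ?U \<longrightarrow> M v = 0"
        by eventually_elim (auto simp: indicator_def)
      then show False using v0 U unfolding ess_support_def by blast
    qed
    moreover have "?m \<ge> 0" by (rule integral_nonneg_AE[OF nn])
    ultimately have m: "?m > 0" by simp
    have d: "?m > 0" "1 = 1 / ?m * ?m" using m by auto
    note d(2)
    also have "1 / ?m * ?m = (LINT v|lborel. 1 / ?m * (indicator ?U v * M v))" by simp
    also have "\<dots> \<le> avg (\<lambda>v. 1 / max (1 + h - v \<bullet> p) ?m)"
      unfolding avg_def set_lebesgue_integral_def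
    proof (rule integral_mono_AE)
      show "integrable lborel (\<lambda>v. indicator V v *\<^sub>R (M v * (1 / max (1 + h - v \<bullet> p) ?m)))"
        using avg_integrable[OF cont[OF m]] unfolding set_integrable_def .
      show "integrable lborel (\<lambda>v. 1 / ?m * (indicator ?U v * M v))" using im by simp
      show "AE v in lborel. 1 / ?m * (indicator ?U v * M v)
          \<le> indicator V v *\<^sub>R (M v * (1 / max (1 + h - v \<bullet> p) ?m))"
        using M_nonneg AE_zero_outside_ess_support[of M]
      proof eventually_elim
        case (elim v)
        show ?case
        proof (cases "v \<in> ?U \<and> v \<in> V")
          case True
          then have "max (1 + h - v \<bullet> p) ?m = ?m" using m by (intro max_absorb2) auto
          then show ?thesis using True by simp
        next
          case False
          then show ?thesis using elim m by (auto simp: indicator_def intro!: divide_nonneg_nonneg mult_nonneg_nonneg)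
        qed
      qed
    qed
    finally show ?thesis using d(1) by blast
  qed
qed

definition speed :: real where "speed = (SUP v\<in>V. norm v)"

lemma norm_le_speed: "v \<in> V \<Longrightarrow> norm v \<le> speed"
  unfolding speed_def
  by (rule cSUP_upper) (auto intro!: bounded_imp_bdd_above compact_imp_bounded
      compact_continuous_image compact_support continuous_intros)

lemma speed_nonneg: "0 \<le> speed"
  using norm_le_speed V_nonempty norm_ge_zero order_trans by blast

lemma hamiltonian_le:
  assumes "mu M p < 1 + h" "avg (\<lambda>v. 1 / (1 + h - v \<bullet> p)) \<le> 1"
  shows "hamiltonian M p \<le> h"
proof (cases "p \<in> Sing M")
  case True
  then show ?thesis using assms by (simp add: hamiltonian_def)
next
  case False
  note H = hamiltonian_regular[OF False]
  show ?thesis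
  proof (rule ccontr)
    assume "\<not> hamiltonian M p \<le> h"
    then show False
      using avg_resolvent_strict_decreasing[of p "1 + h" "1 + hamiltonian M p"] assms H by simp
  qed
qed

text \<open>Raising \<open>h\<close> by \<open>speed * norm (p - q)\<close> compensates the change of \<open>v \<bullet> p\<close> into \<open>v \<bullet> q\<close> for every
  velocity at once, so an admissible level for \<open>p\<close> becomes an admissible level for \<open>q\<close>.\<close>

lemma hamiltonian_lipschitz: "hamiltonian M q \<le> hamiltonian M p + speed * norm (p - q)"
proof (rule field_le_epsilon)
  fix e :: real assume "0 < e"
  define h where "h = hamiltonian M p + e"
  define k where "k = h + speed * norm (p - q)"
  have h: "mu M p < 1 + h" "avg (\<lambda>v. 1 / (1 + h - v \<bullet> p)) \<le> 1"
    using above_hamiltonian[of p h] \<open>0 < e\<close> by (auto simp: h_def)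
  have shift: "1 + h - v \<bullet> p \<le> 1 + k - v \<bullet> q" if "v \<in> V" for v
  proof -
    have "v \<bullet> q - v \<bullet> p \<le> norm v * norm (p - q)"
      using Cauchy_Schwarz_ineq2[of v "q - p"] by (simp add: inner_diff_right norm_minus_commute)
    also have "\<dots> \<le> speed * norm (p - q)" using norm_le_speed[OF that] by (intro mult_right_mono) auto
    finally show ?thesis by (simp add: k_def)
  qed
  have kq: "mu M q < 1 + k"
  proof -
    have "mu M q \<le> 1 + k - (1 + h - mu M p)"
    proof (rule mu_least)
      fix v assume "v \<in> V"
      then show "v \<bullet> q \<le> 1 + k - (1 + h - mu M p)" using shift mu_upper[of v p] by fastforce
    qed
    then show ?thesis using h by simp
  qed
  have "avg (\<lambda>v. 1 / (1 + k - v \<bullet> q)) \<le> avg (\<lambda>v. 1 / (1 + h - v \<bullet> p))"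
  proof (rule avg_mono)
    fix v assume v: "v \<in> V"
    have "0 < 1 + h - v \<bullet> p" using mu_upper[OF v, of p] h by simp
    then show "1 / (1 + k - v \<bullet> q) \<le> 1 / (1 + h - v \<bullet> p)"
      using shift[OF v] by (intro divide_left_mono mult_pos_pos) auto
  qed (use continuous_resolvent kq h in auto)
  then have "hamiltonian M q \<le> k" using hamiltonian_le[OF kq] h by simp
  then show "hamiltonian M q \<le> hamiltonian M p + speed * norm (p - q) + e" by (simp add: k_def h_def)
qed

end

section \<open>The kinetic equation along characteristics\<close>

text \<open>The difference quotients are bounded by \<open>L\<close> and converge almost everywhere to \<open>r\<close>, so dominated
  convergence applies to their integrals. On the other side, with the primitive \<open>K\<close> of \<open>k\<close>, the integral of a
  difference quotient is a difference of two difference quotients of \<open>K\<close>, at \<open>T\<close> and at \<open>0\<close>.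
  The interval of length \<open>T + 1\<close> leaves room for the shift by \<open>1 / Suc n\<close>.\<close>

lemma lipschitz_FTC_AE:
  fixes k r :: "real \<Rightarrow> real"
  assumes T: "0 \<le> T" and L: "0 \<le> L"
    and lip: "\<And>s t. s \<in> {0..T + 1} \<Longrightarrow> t \<in> {0..T + 1} \<Longrightarrow> \<bar>k s - k t\<bar> \<le> L * \<bar>s - t\<bar>"
    and r: "continuous_on {0..T} r"
    and der: "AE s in lborel. s \<in> {0<..T} \<longrightarrow> (k has_real_derivative r s) (at s)"
  shows "k T - k 0 = integral {0..T} r"
proof -
  let ?q = "\<lambda>n s. (k (s + 1 / Suc n) - k s) * Suc n"
  have kc: "continuous_on {0..T + 1} k"
    by (rule lipschitz_on_continuous_on[of L]) (use lip L in \<open>auto simp: lipschitz_on_def dist_real_def\<close>)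
  have kc0: "continuous_on {0..T} k" by (rule continuous_on_subset[OF kc]) auto
  have h1: "1 / real (Suc n) \<le> 1" "0 < 1 / real (Suc n)" for n by simp_all
  have ks: "continuous_on {0..T} (\<lambda>s. k (s + 1 / Suc n))" for n
    by (rule continuous_on_compose2[OF kc]) (use h1[of n] in \<open>auto intro!: continuous_intros\<close>)
  have qc: "continuous_on {0..T} (?q n)" for n
    by (intro continuous_intros ks kc0)
  have lim1: "(\<lambda>n. LINT s:{0..T}|lborel. ?q n s) \<longlonglongrightarrow> (LINT s:{0..T}|lborel. r s)"
    unfolding set_lebesgue_integral_def
  proof (rule integral_dominated_convergence)
    show "(\<lambda>s. indicator {0..T} s *\<^sub>R r s) \<in> borel_measurable lborel"
      using borel_measurable_continuous_on_indicator[OF _ r] by simp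
    show "(\<lambda>s. indicator {0..T} s *\<^sub>R ?q n s) \<in> borel_measurable lborel" for n
      using borel_measurable_continuous_on_indicator[OF _ qc] by simp
    show "integrable lborel (\<lambda>s. indicator {0..T} s * L)"
      using T by (intro integrable_mult_left integrable_real_indicator) auto
    have n0: "AE s in lborel. s \<noteq> (0::real)" by (rule AE_lborel_singleton)
    show "AE s in lborel. (\<lambda>n. indicator {0..T} s *\<^sub>R ?q n s) \<longlonglongrightarrow> indicator {0..T} s *\<^sub>R r s"
      using der n0
    proof eventually_elim
      case (elim s)
      show ?case
      proof (cases "s \<in> {0..T}")
        case True
        then have "(k has_real_derivative r s) (at s)" using elim by auto
        then have "((\<lambda>h. (k (s + h) - k s) / h) \<longlongrightarrow> r s) (at 0)" by (simp add: DERIV_def)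
        moreover have "filterlim (\<lambda>n. 1 / real (Suc n)) (at 0) sequentially"
          unfolding filterlim_at using LIMSEQ_Suc[OF lim_1_over_n] by (auto simp del: of_nat_Suc)
        ultimately have "(\<lambda>n. (k (s + 1 / real (Suc n)) - k s) / (1 / real (Suc n))) \<longlonglongrightarrow> r s"
          by (rule filterlim_compose)
        then show ?thesis using True by simp
      qed simp
    qed
    show "AE s in lborel. norm (indicator {0..T} s *\<^sub>R ?q n s) \<le> indicator {0..T} s * L" for n
    proof (rule AE_I2)
      fix s
      show "norm (indicator {0..T} s *\<^sub>R ?q n s) \<le> indicator {0..T} s * L"
      proof (cases "s \<in> {0..T}")
        case True
        then have "\<bar>k (s + 1 / Suc n) - k s\<bar> \<le> L * \<bar>s + 1 / Suc n - s\<bar>"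
          using h1[of n] T by (intro lip) (simp_all del: of_nat_Suc add: add_mono)
        then have "\<bar>k (s + 1 / Suc n) - k s\<bar> * Suc n \<le> L * (1 / Suc n) * Suc n"
          by (intro mult_right_mono) auto
        then show ?thesis using True by (simp add: abs_mult)
      qed simp
    qed
  qed
  define K where "K x = integral {0..x} k" for x
  have K0: "K 0 = 0" by (simp add: K_def)
  have q_int: "(LINT s:{0..T}|lborel. ?q n s)
      = (K (T + 1 / Suc n) - K T) / (1 / Suc n) - (K (0 + 1 / Suc n) - K 0) / (1 / Suc n)" for n
  proof -
    let ?h = "1 / real (Suc n)"
    have kci: "k integrable_on {0..T + ?h}"
      by (intro integrable_continuous_interval continuous_on_subset[OF kc]) (use h1[of n] in auto)
    have sh: "integral {0..T} (\<lambda>s. k (s + ?h)) = integral {?h..T + ?h} k"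
      using integral_shift[of 0 ?h T k] continuous_on_subset[OF kc, of "{0 + ?h..T + ?h}"] h1[of n]
      by (auto simp: o_def)
    have cb: "K ?h + integral {?h..T + ?h} k = K (T + ?h)"
      unfolding K_def by (rule Henstock_Kurzweil_Integration.integral_combine[OF _ _ kci]) (use T in auto)
    have "(LINT s:{0..T}|lborel. ?q n s) = integral {0..T} (?q n)"
      by (rule set_borel_integral_eq_integral(2)[OF borel_integrable_atLeastAtMost'[OF qc]])
    also have "\<dots> = (integral {0..T} (\<lambda>s. k (s + ?h)) - integral {0..T} k) * Suc n"
      using integrable_continuous_interval[OF ks] integrable_continuous_interval[OF kc0]
      by (simp add: Henstock_Kurzweil_Integration.integral_diff)
    also have "\<dots> = (K (T + ?h) - K ?h - K T) * Suc n" using sh cb by (simp add: K_def)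
    finally show ?thesis using K0 by (simp add: algebra_simps)
  qed
  have Kd: "(\<lambda>n. (K (x + 1 / Suc n) - K x) / (1 / Suc n)) \<longlonglongrightarrow> k x" if x: "x \<in> {0..T}" for x
  proof -
    have "(K has_real_derivative k x) (at x within {0..T + 1})"
      unfolding K_def[abs_def] by (rule integral_has_real_derivative[OF kc]) (use x in auto)
    then have "((\<lambda>y. (K y - K x) / (y - x)) \<longlongrightarrow> k x) (at x within {0..T + 1})"
      by (simp add: has_field_derivative_iff)
    moreover have "filterlim (\<lambda>n. x + 1 / real (Suc n)) (at x within {0..T + 1}) sequentially"
      unfolding filterlim_at
    proof
      show "(\<lambda>n. x + 1 / real (Suc n)) \<longlonglongrightarrow> x"
        using tendsto_add[OF tendsto_const LIMSEQ_Suc[OF lim_1_over_n], of x] by simp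
      show "\<forall>\<^sub>F n in sequentially. x + 1 / real (Suc n) \<in> {0..T + 1} \<and> x + 1 / real (Suc n) \<noteq> x"
        using x h1 by (intro always_eventually) (auto intro: add_mono)
    qed
    ultimately have "(\<lambda>n. (K (x + 1 / Suc n) - K x) / (x + 1 / Suc n - x)) \<longlonglongrightarrow> k x"
      by (rule filterlim_compose)
    then show ?thesis by simp
  qed
  have "(\<lambda>n. LINT s:{0..T}|lborel. ?q n s) \<longlonglongrightarrow> k T - k 0"
    unfolding q_int using T by (intro tendsto_diff Kd) auto
  then have "k T - k 0 = (LINT s:{0..T}|lborel. r s)"
    using lim1 LIMSEQ_unique by blast
  also have "\<dots> = integral {0..T} r"
    by (rule set_borel_integral_eq_integral(2)[OF borel_integrable_atLeastAtMost'[OF r]])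
  finally show ?thesis .
qed

text \<open>Fubini, together with the invariance of the Lebesgue measure under the shear \<open>(t, x, v) \<mapsto> (t, x + t v, v)\<close>.\<close>

lemma AE_along_characteristics:
  fixes P :: "real \<Rightarrow> 'a::euclidean_space \<Rightarrow> 'a \<Rightarrow> bool"
  assumes "AE (t, x, v) in lborel. P t x v"
  shows "AE v in lborel. AE x in lborel. AE t in lborel. P t (x + t *\<^sub>R v) v"
proof -
  obtain N where N: "\<And>t x v. (t, x, v) \<notin> N \<Longrightarrow> P t x v" "emeasure lborel N = 0"
    "N \<in> sets (lborel :: (real \<times> 'a \<times> 'a) measure)"
  proof -
    obtain N where "{z \<in> space lborel. \<not> (case z of (t, x, v) \<Rightarrow> P t x v)} \<subseteq> N"
      and N: "emeasure lborel N = 0" "N \<in> sets (lborel :: (real \<times> 'a \<times> 'a) measure)"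
      using AE_E[OF assms] .
    then have "P t x v" if "(t, x, v) \<notin> N" for t x v using that by (auto simp: subset_eq)
    then show ?thesis using that N by blast
  qed
  have [measurable]: "N \<in> sets (borel \<Otimes>\<^sub>M (borel \<Otimes>\<^sub>M borel))"
    using N(3) by (simp only: borel_prod sets_lborel)
  let ?I = "\<lambda>t x v. indicator N (t, x, v) :: ennreal"
  have shift: "(\<integral>\<^sup>+ x. ?I t (x + t *\<^sub>R v) v \<partial>lborel) = (\<integral>\<^sup>+ x. ?I t x v \<partial>lborel)" for t v
  proof -
    have "(\<integral>\<^sup>+ x. ?I t x v \<partial>lborel) = (\<integral>\<^sup>+ x. ?I t x v \<partial>distr lborel borel ((+) (t *\<^sub>R v)))"
      by (simp add: lborel_distr_plus)
    also have "\<dots> = (\<integral>\<^sup>+ x. ?I t (t *\<^sub>R v + x) v \<partial>lborel)"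
      by (rule nn_integral_distr) measurable
    finally show ?thesis by (simp add: add.commute)
  qed
  have "(\<integral>\<^sup>+ v. \<integral>\<^sup>+ x. \<integral>\<^sup>+ t. ?I t (x + t *\<^sub>R v) v \<partial>lborel \<partial>lborel \<partial>lborel)
      = (\<integral>\<^sup>+ v. \<integral>\<^sup>+ t. \<integral>\<^sup>+ x. ?I t (x + t *\<^sub>R v) v \<partial>lborel \<partial>lborel \<partial>lborel)"
    by (intro nn_integral_cong lborel_pair.Fubini') measurable
  also have "\<dots> = (\<integral>\<^sup>+ v. \<integral>\<^sup>+ t. \<integral>\<^sup>+ x. ?I t x v \<partial>lborel \<partial>lborel \<partial>lborel)"
    by (simp only: shift)
  also have "\<dots> = (\<integral>\<^sup>+ t. \<integral>\<^sup>+ v. \<integral>\<^sup>+ x. ?I t x v \<partial>lborel \<partial>lborel \<partial>lborel)"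
    by (intro lborel_pair.Fubini') measurable
  also have "\<dots> = (\<integral>\<^sup>+ t. \<integral>\<^sup>+ x. \<integral>\<^sup>+ v. ?I t x v \<partial>lborel \<partial>lborel \<partial>lborel)"
    by (intro nn_integral_cong lborel_pair.Fubini') measurable
  also have "\<dots> = (\<integral>\<^sup>+ t. \<integral>\<^sup>+ z. indicator N (t, z) \<partial>(lborel \<Otimes>\<^sub>M lborel) \<partial>lborel)"
    by (intro nn_integral_cong lborel.nn_integral_fst[where f = "\<lambda>z. indicator N (_, z)"]) measurable
  also have "\<dots> = (\<integral>\<^sup>+ z. indicator N z \<partial>(lborel \<Otimes>\<^sub>M lborel))"
    using lborel.nn_integral_fst[of "indicator N :: real \<times> 'a \<times> 'a \<Rightarrow> ennreal" lborel] N(3)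
    by (simp add: lborel_prod)
  also have "\<dots> = 0" using N by (simp add: lborel_prod)
  finally have z: "(\<integral>\<^sup>+ v. \<integral>\<^sup>+ x. \<integral>\<^sup>+ t. ?I t (x + t *\<^sub>R v) v \<partial>lborel \<partial>lborel \<partial>lborel) = 0" .
  have "AE v in lborel. (\<integral>\<^sup>+ x. \<integral>\<^sup>+ t. ?I t (x + t *\<^sub>R v) v \<partial>lborel \<partial>lborel) = 0"
    using z by (subst (asm) nn_integral_0_iff_AE) measurable
  then show ?thesis
  proof eventually_elim
    case (elim v)
    then have "AE x in lborel. (\<integral>\<^sup>+ t. ?I t (x + t *\<^sub>R v) v \<partial>lborel) = 0"
      by (subst (asm) nn_integral_0_iff_AE) measurable
    then show ?case
    proof eventually_elim
      case (elim x)
      then have "AE t in lborel. ?I t (x + t *\<^sub>R v) v = 0"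
        by (subst (asm) nn_integral_0_iff_AE) measurable
      then show ?case by eventually_elim (use N(1) in \<open>auto simp: indicator_eq_0_iff\<close>)
    qed
  qed
qed

context velocity_distribution begin

text \<open>The right-hand side of the kinetic equation, as a functional of the velocity profile at one point.\<close>

definition jump :: "real \<Rightarrow> ('a \<Rightarrow> real) \<Rightarrow> 'a \<Rightarrow> real" where
  "jump \<epsilon> g v = avg (\<lambda>v'. 1 - exp ((g v - g v') / \<epsilon>))"

lemma kinetic_regularity:
  assumes "kinetic_solution M \<epsilon> \<phi>0 \<phi>" "0 < T"
  obtains B L where "0 \<le> L" "\<And>t x v. t \<in> {0..T} \<Longrightarrow> v \<in> V \<Longrightarrow> \<bar>\<phi> t x v\<bar> \<le> B"
    "\<And>t s x y v. t \<in> {0..T} \<Longrightarrow> s \<in> {0..T} \<Longrightarrow> v \<in> V \<Longrightarrow>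
        \<bar>\<phi> t x v - \<phi> s y v\<bar> \<le> L * (\<bar>t - s\<bar> + norm (x - y))"
    "continuous_on ({0..T} \<times> UNIV \<times> V) (\<lambda>(t, x, v). \<phi> t x v)"
proof -
  obtain g where g: "continuous_on UNIV g" "W1inf g"
    "\<forall>z\<in>{0..T} \<times> UNIV \<times> V. (\<lambda>(t, x, v). \<phi> t x v) z = g z"
    using assms unfolding kinetic_solution_def W1inf_on_def by auto
  have eq: "\<phi> t x v = g (t, x, v)" if "t \<in> {0..T}" "v \<in> V" for t x v using g(3) that by auto
  obtain B L where BL: "\<And>z. \<bar>g z\<bar> \<le> B" "0 \<le> L" "\<And>x y. \<bar>g x - g y\<bar> \<le> L * norm (x - y)"
    using W1inf_bounded_lipschitz[OF g(1,2)] by metis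
  show ?thesis
  proof (rule that[of L B])
    show "0 \<le> L" by fact
    show "\<bar>\<phi> t x v\<bar> \<le> B" if "t \<in> {0..T}" "v \<in> V" for t x v using BL eq that by simp
    fix t s x y v assume a: "t \<in> {0..T}" "s \<in> {0..T}" "v \<in> V"
    have "\<bar>\<phi> t x v - \<phi> s y v\<bar> \<le> L * norm ((t, x, v) - (s, y, v))" using BL(3)[of "(t, x, v)" "(s, y, v)"] eq a by simp
    also have "\<dots> \<le> L * (\<bar>t - s\<bar> + norm (x - y))"
      using norm_Pair_le[of "t - s" "(x - y, 0::'a)"] BL(2) by (intro mult_left_mono) (auto simp: norm_Pair)
    finally show "\<bar>\<phi> t x v - \<phi> s y v\<bar> \<le> L * (\<bar>t - s\<bar> + norm (x - y))" .
  next
    show "continuous_on ({0..T} \<times> UNIV \<times> V) (\<lambda>(t, x, v). \<phi> t x v)"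
      by (rule continuous_on_eq[OF continuous_on_subset[OF g(1)]]) (use g(3) in auto)
  qed
qed

lemma kinetic_continuous:
  assumes "kinetic_solution M \<epsilon> \<phi>0 \<phi>"
  shows "continuous_on ({0..} \<times> UNIV \<times> V) (\<lambda>(t, x, v). \<phi> t x v)"
  unfolding continuous_on_eq_continuous_within
proof
  fix z :: "real \<times> 'a \<times> 'a" assume z: "z \<in> {0..} \<times> UNIV \<times> V"
  define T where "T = fst z + 1"
  have T: "0 < T" using z by (auto simp: T_def)
  have "continuous_on ({0..T} \<times> UNIV \<times> V) (\<lambda>(t, x, v). \<phi> t x v)"
    using kinetic_regularity[OF assms T] by metis
  then have "continuous (at z within {0..T} \<times> UNIV \<times> V) (\<lambda>(t, x, v). \<phi> t x v)"
    using z by (auto simp: continuous_on_eq_continuous_within T_def)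
  moreover have "at z within {0..T} \<times> UNIV \<times> V = at z within {0..} \<times> UNIV \<times> V"
    by (rule at_within_nhd[of z "{..<T} \<times> UNIV"]) (use z in \<open>auto simp: T_def open_Times\<close>)
  ultimately show "continuous (at z within {0..} \<times> UNIV \<times> V) (\<lambda>(t, x, v). \<phi> t x v)" by simp
qed

lemma jump_continuous:
  fixes S :: "'z::topological_space set" and \<phi> :: "real \<Rightarrow> 'a \<Rightarrow> 'a \<Rightarrow> real"
  assumes \<phi>: "continuous_on ({0..} \<times> UNIV \<times> V) (\<lambda>(t, x, v). \<phi> t x v)"
    and c: "continuous_on S a" "continuous_on S b" "continuous_on S c"
    and r: "\<And>z. z \<in> S \<Longrightarrow> 0 \<le> a z" "\<And>z. z \<in> S \<Longrightarrow> c z \<in> V"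
  shows "continuous_on S (\<lambda>z. jump \<epsilon> (\<phi> (a z) (b z)) (c z))"
proof -
  have 1: "continuous_on (S \<times> V) (\<lambda>w. \<phi> (a (fst w)) (b (fst w)) (c (fst w)))"
    using continuous_on_compose2[OF \<phi>, of "S \<times> V" "\<lambda>w. (a (fst w), b (fst w), c (fst w))"] r
    by (force intro!: continuous_intros continuous_on_compose2[OF c(1)] continuous_on_compose2[OF c(2)]
        continuous_on_compose2[OF c(3)])
  have 2: "continuous_on (S \<times> V) (\<lambda>w. \<phi> (a (fst w)) (b (fst w)) (snd w))"
    using continuous_on_compose2[OF \<phi>, of "S \<times> V" "\<lambda>w. (a (fst w), b (fst w), snd w)"] r
    by (force intro!: continuous_intros continuous_on_compose2[OF c(1)] continuous_on_compose2[OF c(2)])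
  have "continuous_on (S \<times> V) (\<lambda>w. 1 - exp ((\<phi> (a (fst w)) (b (fst w)) (c (fst w)) - \<phi> (a (fst w)) (b (fst w)) (snd w)) * (1 / \<epsilon>)))"
    by (intro continuous_intros 1 2)
  from continuous_on_avg[OF this] show ?thesis unfolding jump_def by simp
qed

text \<open>For almost every \<open>v\<close> the identity holds for almost every starting point \<open>x\<close>, by
  integration along the characteristic. Its defect \<open>D x v\<close> is continuous, so it vanishes for all \<open>x\<close>, and then for
  all \<open>v\<close> in the support.\<close>

lemma kinetic_mild:
  assumes sol: "kinetic_solution M \<epsilon> \<phi>0 \<phi>" and T: "0 \<le> T" and v: "v \<in> V"
  shows "\<phi> T (x + T *\<^sub>R v) v - \<phi> 0 x v = integral {0..T} (\<lambda>s. jump \<epsilon> (\<phi> s (x + s *\<^sub>R v)) v)"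
proof -
  note cont = kinetic_continuous[OF sol]
  let ?P = "\<lambda>t x v. 0 < t \<and> v \<in> V \<longrightarrow>
     (\<exists>a q. (GDERIV (\<lambda>(s, y). \<phi> s y v) (t, x) :> (a, q)) \<and> a + v \<bullet> q = jump \<epsilon> (\<phi> t x) v)"
  define D where "D x v = \<phi> T (x + T *\<^sub>R v) v - \<phi> 0 x v
      - integral {0..T} (\<lambda>s. jump \<epsilon> (\<phi> s (x + s *\<^sub>R v)) v)" for x v
  have Dc: "continuous_on (UNIV \<times> V) (\<lambda>z. D (fst z) (snd z))"
  proof -
    have c: "continuous_on ((UNIV \<times> V) \<times> cbox 0 T)
        (\<lambda>(z, s). jump \<epsilon> (\<phi> s (fst z + s *\<^sub>R snd z)) (snd z))"
      unfolding case_prod_beta by (rule jump_continuous[OF cont]) (auto intro!: continuous_intros)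
    have "continuous_on (UNIV \<times> V) (\<lambda>z. integral (cbox 0 T) (\<lambda>s. jump \<epsilon> (\<phi> s (fst z + s *\<^sub>R snd z)) (snd z)))"
      by (rule integral_continuous_on_param[OF c])
    moreover have "continuous_on (UNIV \<times> V) (\<lambda>z. \<phi> T (fst z + T *\<^sub>R snd z) (snd z))"
      using continuous_on_compose2[OF cont, of "UNIV \<times> V" "\<lambda>z. (T, fst z + T *\<^sub>R snd z, snd z)"] T
      by (force intro!: continuous_intros)
    moreover have "continuous_on (UNIV \<times> V) (\<lambda>z. \<phi> 0 (fst z) (snd z))"
      using continuous_on_compose2[OF cont, of "UNIV \<times> V" "\<lambda>z. (0, fst z, snd z)"]
      by (force intro!: continuous_intros)
    ultimately show ?thesis unfolding D_def cbox_interval by (intro continuous_on_diff)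
  qed
  have "AE v in lborel. AE x in lborel. AE t in lborel. ?P t (x + t *\<^sub>R v) v"
    by (rule AE_along_characteristics) (use sol in \<open>simp add: kinetic_solution_def jump_def avg_def\<close>)
  then have good: "AE v in lborel. v \<in> V \<longrightarrow> (\<forall>x. D x v = 0)"
  proof eventually_elim
    case (elim v)
    show ?case
    proof
      assume v: "v \<in> V"
      have "AE x in lborel. x \<in> {x. D x v = 0}"
        using elim
      proof eventually_elim
        case (elim x)
        obtain B L where L: "0 \<le> L" "\<And>t s x y v. t \<in> {0..T + 1} \<Longrightarrow> s \<in> {0..T + 1} \<Longrightarrow> v \<in> V \<Longrightarrow>
            \<bar>\<phi> t x v - \<phi> s y v\<bar> \<le> L * (\<bar>t - s\<bar> + norm (x - y))"
          using kinetic_regularity[OF sol, of "T + 1"] T by (metis add_nonneg_pos zero_less_one)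
        have "\<phi> T (x + T *\<^sub>R v) v - \<phi> 0 (x + 0 *\<^sub>R v) v = integral {0..T} (\<lambda>s. jump \<epsilon> (\<phi> s (x + s *\<^sub>R v)) v)"
        proof (rule lipschitz_FTC_AE[OF T])
          show "0 \<le> L * (1 + norm v)" using L by simp
          fix s t assume st: "s \<in> {0..T + 1}" "t \<in> {0..T + 1}"
          have "\<bar>\<phi> s (x + s *\<^sub>R v) v - \<phi> t (x + t *\<^sub>R v) v\<bar> \<le> L * (\<bar>s - t\<bar> + norm ((x + s *\<^sub>R v) - (x + t *\<^sub>R v)))"
            by (rule L(2)[OF st v])
          also have "norm ((x + s *\<^sub>R v) - (x + t *\<^sub>R v)) = \<bar>s - t\<bar> * norm v"
            by (simp flip: scaleR_diff_left)
          finally show "\<bar>\<phi> s (x + s *\<^sub>R v) v - \<phi> t (x + t *\<^sub>R v) v\<bar> \<le> L * (1 + norm v) * \<bar>s - t\<bar>"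
            by (simp add: algebra_simps)
        next
          show "continuous_on {0..T} (\<lambda>s. jump \<epsilon> (\<phi> s (x + s *\<^sub>R v)) v)"
            by (rule jump_continuous[OF cont]) (use v in \<open>auto intro!: continuous_intros\<close>)
          show "AE s in lborel. s \<in> {0<..T} \<longrightarrow>
              ((\<lambda>s. \<phi> s (x + s *\<^sub>R v) v) has_real_derivative jump \<epsilon> (\<phi> s (x + s *\<^sub>R v)) v) (at s)"
            using elim
          proof eventually_elim
            case (elim s)
            show ?case
            proof
              assume "s \<in> {0<..T}"
              then obtain a q where "GDERIV (\<lambda>(s, y). \<phi> s y v) (s, x + s *\<^sub>R v) :> (a, q)"
                and aq: "a + v \<bullet> q = jump \<epsilon> (\<phi> s (x + s *\<^sub>R v)) v" using elim v by auto
              then have d: "((\<lambda>(s, y). \<phi> s y v) has_derivative (\<lambda>h. h \<bullet> (a, q))) (at (s, x + s *\<^sub>R v))"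
                by (simp add: gderiv_def)
              have e: "((\<lambda>s. (s, x + s *\<^sub>R v)) has_derivative (\<lambda>h. (h, h *\<^sub>R v))) (at s)"
                by (auto intro!: derivative_eq_intros)
              have "((\<lambda>s. \<phi> s (x + s *\<^sub>R v) v) has_derivative (\<lambda>h. (h, h *\<^sub>R v) \<bullet> (a, q))) (at s)"
                using diff_chain_at[OF e d] by (simp add: o_def)
              moreover have "(\<lambda>h. (h, h *\<^sub>R v) \<bullet> (a, q)) = (*) (a + v \<bullet> q)"
                by (auto simp: fun_eq_iff algebra_simps)
              ultimately show "((\<lambda>s. \<phi> s (x + s *\<^sub>R v) v) has_real_derivative jump \<epsilon> (\<phi> s (x + s *\<^sub>R v)) v) (at s)"
                using aq by (simp add: has_field_derivative_def)
            qed
          qed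
        qed
        then show ?case by (simp add: D_def)
      qed
      moreover have "closed {x. D x v = 0}"
      proof -
        have "continuous_on UNIV (\<lambda>x. D x v)"
          using continuous_on_compose2[OF Dc, of UNIV "\<lambda>x. (x, v)"] v by (force intro!: continuous_intros)
        then show ?thesis by (intro closed_Collect_eq continuous_intros)
      qed
      ultimately have "{x. D x v = 0} = UNIV" using closed_full_measure_UNIV by blast
      then show "\<forall>x. D x v = 0" by blast
    qed
  qed
  have "D x v = 0"
  proof (rule ccontr)
    assume ne: "D x v \<noteq> 0"
    have "continuous_on V (\<lambda>v. D x v)"
      using continuous_on_compose2[OF Dc, of V "\<lambda>v. (x, v)"] by (force intro!: continuous_intros)
    then obtain e where e: "e > 0" "\<And>w. w \<in> V \<Longrightarrow> dist w v < e \<Longrightarrow> dist (D x w) (D x v) < \<bar>D x v\<bar>"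
      using v ne unfolding continuous_on_iff by (metis zero_less_abs_iff)
    obtain w where "w \<in> V" "dist w v < e" "\<forall>x. D x w = 0"
      using ess_support_meets_full_measure[OF v e(1) good] by blast
    then show False using e(2)[of w] by (simp add: dist_real_def)
  qed
  then show ?thesis by (simp add: D_def)
qed

lemma kinetic_derivative:
  assumes sol: "kinetic_solution M \<epsilon> \<phi>0 \<phi>" and t: "0 < t" and v: "v \<in> V"
  shows "((\<lambda>s. \<phi> s (x + (s - t) *\<^sub>R v) v) has_real_derivative jump \<epsilon> (\<phi> t x) v) (at t)"
proof -
  let ?y = "x - t *\<^sub>R v" and ?J = "\<lambda>s. jump \<epsilon> (\<phi> s (x - t *\<^sub>R v + s *\<^sub>R v)) v"
  have "continuous_on {0..t + 1} ?J"
    by (rule jump_continuous[OF kinetic_continuous[OF sol]]) (use v in \<open>auto intro!: continuous_intros\<close>)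
  then have "((\<lambda>s. integral {0..s} ?J) has_real_derivative ?J t) (at t within {0..t + 1})"
    by (rule integral_has_real_derivative) (use t in auto)
  moreover have "at t within {0..t + 1} = at t"
    by (rule at_within_interior) (use t in auto)
  ultimately have "((\<lambda>s. \<phi> 0 ?y v + integral {0..s} ?J) has_real_derivative ?J t) (at t)"
    by (auto intro!: derivative_eq_intros)
  then have "((\<lambda>s. \<phi> s (x + (s - t) *\<^sub>R v) v) has_real_derivative ?J t) (at t)"
  proof (rule DERIV_cong_ev[THEN iffD1, rotated -1])
    show "\<forall>\<^sub>F s in nhds t. \<phi> 0 ?y v + integral {0..s} ?J = \<phi> s (x + (s - t) *\<^sub>R v) v"
    proof (rule eventually_mono[OF eventually_nhds_in_open[of "{0<..}" t]])
      fix s :: real assume "s \<in> {0<..}"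
      then have "\<phi> s (?y + s *\<^sub>R v) v - \<phi> 0 ?y v = integral {0..s} ?J"
        using kinetic_mild[OF sol _ v, of s ?y] by simp
      moreover have "?y + s *\<^sub>R v = x + (s - t) *\<^sub>R v" by (simp add: algebra_simps)
      ultimately show "\<phi> 0 ?y v + integral {0..s} ?J = \<phi> s (x + (s - t) *\<^sub>R v) v" by simp
    qed (use t in auto)
  qed auto
  then show ?thesis by simp
qed

lemma profile_continuous:
  assumes "continuous_on ({0..} \<times> UNIV \<times> V) (\<lambda>(t, x, v). \<phi> t x v)" "0 \<le> t"
  shows "continuous_on V (\<phi> t x)"
  using continuous_on_compose2[OF assms(1), of V "\<lambda>v. (t, x, v)"] assms(2) by (force intro!: continuous_intros)

lemma jump_integrand_continuous:
  fixes g :: "'a \<Rightarrow> real"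
  assumes "continuous_on V g"
  shows "continuous_on V (\<lambda>v'. 1 - exp ((g v - g v') / \<epsilon>))"
proof -
  have "continuous_on V (\<lambda>v'. 1 - exp ((g v - g v') * (1 / \<epsilon>)))" by (intro continuous_intros assms)
  then show ?thesis by simp
qed

text \<open>The upper bound is immediate: the right-hand side is at most 1, so along a characteristic \<open>\<phi>\<close> grows at most
  at unit rate, and \<open>\<phi>0\<close> changes by at most \<open>L0 * speed * t\<close>. The lower bound is a maximum principle.
  At a minimum point of \<open>\<phi> t x v - \<phi>0 x + \<kappa> t + \<beta> norm x\<close> the profile is minimal in
  \<open>v\<close>, so the right-hand side is nonnegative and \<open>\<phi>\<close> does not increase, to first order, when going back along the
  characteristic, while the sum of the other terms strictly decreases: a contradiction. The term \<open>\<beta> norm x\<close> keeps the minimum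
  at finite distance; letting \<open>\<beta> \<rightarrow> 0\<close> removes it. The constant does not depend on \<open>\<epsilon>\<close>.\<close>

lemma kinetic_bounds:
  assumes sol: "kinetic_solution M \<epsilon> \<phi>0 \<phi>" and \<epsilon>: "0 < \<epsilon>"
    and \<phi>0: "\<And>x. \<bar>\<phi>0 x\<bar> \<le> B0" "\<And>x y. \<bar>\<phi>0 x - \<phi>0 y\<bar> \<le> L0 * norm (x - y)" and L0: "0 \<le> L0"
    and t: "0 \<le> t" and v: "v \<in> V"
  shows "\<bar>\<phi> t x v - \<phi>0 x\<bar> \<le> (1 + L0 * speed) * t"
proof -
  note cont = kinetic_continuous[OF sol]
  have init: "\<phi> 0 x v = \<phi>0 x" if "v \<in> V" for x v using sol that by (simp add: kinetic_solution_def)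
  have J1: "jump \<epsilon> (\<phi> s y) v \<le> 1" if "0 \<le> s" for s y
  proof -
    have "jump \<epsilon> (\<phi> s y) v \<le> avg (\<lambda>_. 1)" unfolding jump_def
      by (rule avg_mono) (use jump_integrand_continuous[OF profile_continuous[OF cont that]] in auto)
    then show ?thesis by (simp add: avg_one)
  qed
  have upper: "\<phi> t x v - \<phi>0 x \<le> (1 + L0 * speed) * t"
  proof -
    let ?y = "x - t *\<^sub>R v"
    have "\<phi> t (?y + t *\<^sub>R v) v - \<phi> 0 ?y v = integral {0..t} (\<lambda>s. jump \<epsilon> (\<phi> s (?y + s *\<^sub>R v)) v)"
      by (rule kinetic_mild[OF sol t v])
    also have "\<dots> \<le> integral {0..t} (\<lambda>s. 1)"
    proof (rule integral_le)
      show "(\<lambda>s. jump \<epsilon> (\<phi> s (?y + s *\<^sub>R v)) v) integrable_on {0..t}"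
        by (intro integrable_continuous_interval jump_continuous[OF cont])
           (use v in \<open>auto intro!: continuous_intros\<close>)
    qed (use J1 in auto)
    finally have "\<phi> t x v \<le> \<phi>0 ?y + t" using t init[OF v] by simp
    also have "\<phi>0 ?y \<le> \<phi>0 x + L0 * norm (?y - x)" using \<phi>0(2)[of ?y x] by linarith
    also have "L0 * norm (?y - x) \<le> L0 * (t * speed)"
      using norm_le_speed[OF v] t L0 by (intro mult_left_mono) (auto intro: mult_left_mono)
    finally show ?thesis by (simp add: algebra_simps)
  qed
  have lower: "\<phi>0 x - \<phi> t x v \<le> L0 * speed * t"
  proof (rule field_le_epsilon)
    fix e :: real assume e: "0 < e"
    \<comment> \<open>Then the penalty at \<open>(t, x)\<close>, with the slope \<open>\<kappa>\<close> below, exceeds \<open>L0 * speed * t\<close> by at most \<open>e\<close>.\<close>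
    define \<beta> where "\<beta> = e / (1 + (speed + 1) * t + norm x)"
    have den: "0 < 1 + (speed + 1) * t + norm x" using speed_nonneg t by (simp add: add_pos_nonneg)
    have \<beta>: "0 < \<beta>" unfolding \<beta>_def using e den by simp
    \<comment> \<open>The first two terms absorb the variation of \<open>\<phi>0\<close> and of \<open>\<beta> norm x\<close> along a characteristic,
      the third makes the decrease strict.\<close>
    define \<kappa> where "\<kappa> = L0 * speed + \<beta> * speed + \<beta>"
    let ?g = "\<lambda>t x v. \<phi> t x v - \<phi>0 x + \<kappa> * t + \<beta> * norm x"
    have "0 \<le> ?g t x v"
    proof (rule ccontr)
      assume neg: "\<not> 0 \<le> ?g t x v"
      obtain B where B: "\<And>s y w. s \<in> {0..t + 1} \<Longrightarrow> w \<in> V \<Longrightarrow> \<bar>\<phi> s y w\<bar> \<le> B"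
        using kinetic_regularity[OF sol, of "t + 1"] t by (metis add_nonneg_pos zero_less_one)
      have \<kappa>0: "0 \<le> \<kappa>" using L0 \<beta> speed_nonneg by (simp add: \<kappa>_def)
      define \<rho> where "\<rho> = max (norm x) ((B + B0) / \<beta>)"
      have far: "0 \<le> ?g s y w" if "s \<in> {0..t + 1}" "w \<in> V" "norm y \<ge> \<rho>" for s y w
      proof -
        have "(B + B0) / \<beta> \<le> norm y" using that by (simp add: \<rho>_def)
        then have "B + B0 \<le> \<beta> * norm y" using \<beta> by (simp add: field_simps)
        moreover have "0 \<le> \<kappa> * s" using \<kappa>0 that by simp
        ultimately show ?thesis using B[OF that(1,2), of y] \<phi>0(1)[of y] by linarith
      qed
      let ?K = "{0..t} \<times> cball (0::'a) \<rho> \<times> V"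
      have \<phi>0c: "continuous_on UNIV \<phi>0"
        by (rule lipschitz_on_continuous_on[of L0]) (use \<phi>0 L0 in \<open>auto simp: lipschitz_on_def dist_norm\<close>)
      have gc: "continuous_on ?K (\<lambda>(t, x, v). ?g t x v)"
        unfolding case_prod_beta
        by (intro continuous_intros continuous_on_compose2[OF \<phi>0c] continuous_on_subset[OF cont[unfolded case_prod_beta]]) auto
      have "compact ?K" by (intro compact_Times compact_support compact_Icc compact_cball)
      moreover have inK: "(t, x, v) \<in> ?K" using t v by (auto simp: \<rho>_def)
      then have "?K \<noteq> {}" by (metis empty_iff)
      ultimately have "\<exists>z1\<in>?K. \<forall>z\<in>?K. (\<lambda>(t, x, v). ?g t x v) z1 \<le> (\<lambda>(t, x, v). ?g t x v) z"
        by (rule continuous_attains_inf[OF _ _ gc])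
      then obtain z1 where z1: "z1 \<in> ?K" "\<And>z. z \<in> ?K \<Longrightarrow> (\<lambda>(t, x, v). ?g t x v) z1 \<le> (\<lambda>(t, x, v). ?g t x v) z"
        by blast
      obtain t1 x1 v1 where z1e: "z1 = (t1, x1, v1)" by (cases z1)
      have K1: "t1 \<in> {0..t}" "norm x1 \<le> \<rho>" "v1 \<in> V" using z1(1) by (auto simp: z1e)
      have min: "?g t1 x1 v1 \<le> ?g s y w" if "s \<in> {0..t}" "norm y \<le> \<rho>" "w \<in> V" for s y w
        using z1(2)[of "(s, y, w)"] that by (simp add: z1e)
      have neg1: "?g t1 x1 v1 < 0" using min[of t x v] neg t v by (auto simp: \<rho>_def)
      have "t1 \<noteq> 0"
      proof
        assume "t1 = 0"
        then show False using neg1 init[OF K1(3)] \<beta> by (simp add: mult_less_0_iff)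
      qed
      then have t1: "0 < t1" using K1 by simp
      have x1: "norm x1 < \<rho>" using far[of t1 v1 x1] neg1 K1 by force
      have J0: "0 \<le> jump \<epsilon> (\<phi> t1 x1) v1"
      proof -
        have "avg (\<lambda>_. 0) \<le> jump \<epsilon> (\<phi> t1 x1) v1" unfolding jump_def
        proof (rule avg_mono)
          fix w assume w: "w \<in> V"
          have "\<phi> t1 x1 v1 \<le> \<phi> t1 x1 w" using min[of t1 x1 w] K1 w by simp
          then show "0 \<le> 1 - exp ((\<phi> t1 x1 v1 - \<phi> t1 x1 w) / \<epsilon>)"
            using \<epsilon> by (simp add: divide_nonpos_pos)
        qed (use jump_integrand_continuous[OF profile_continuous[OF cont]] t1 in auto)
        then show ?thesis by (simp add: avg_const)
      qed
      let ?k = "\<lambda>s. \<phi> s (x1 + (s - t1) *\<^sub>R v1) v1"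
      have "((\<lambda>s. ?k s + \<beta> / 2 * s) has_real_derivative jump \<epsilon> (\<phi> t1 x1) v1 + \<beta> / 2) (at t1)"
        using kinetic_derivative[OF sol t1 K1(3), of x1] by (auto intro!: derivative_eq_intros)
      from DERIV_pos_inc_left[OF this add_nonneg_pos[OF J0 half_gt_zero[OF \<beta>]]]
      obtain d where d: "d > 0" "\<And>h. h > 0 \<Longrightarrow> h < d \<Longrightarrow> ?k (t1 - h) + \<beta> / 2 * (t1 - h) < ?k t1 + \<beta> / 2 * t1"
        by blast
      define h where "h = min (d / 2) (min t1 ((\<rho> - norm x1) / (speed + 1)))"
      have h: "0 < h" "h < d" "h \<le> t1" "h \<le> (\<rho> - norm x1) / (speed + 1)"
        using d t1 x1 speed_nonneg by (auto simp: h_def)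
      let ?y = "x1 - h *\<^sub>R v1"
      have hv: "norm (h *\<^sub>R v1) \<le> h * speed" using norm_le_speed[OF K1(3)] h by simp
      have "h * (speed + 1) \<le> \<rho> - norm x1" using h speed_nonneg by (simp add: field_simps)
      then have "h * speed \<le> \<rho> - norm x1" using h(1) by (simp add: distrib_left)
      then have "norm ?y \<le> \<rho>" using hv norm_triangle_ineq4[of x1 "h *\<^sub>R v1"] by linarith
      then have "?g t1 x1 v1 \<le> ?g (t1 - h) ?y v1" using h K1 by (intro min) auto
      moreover have "\<phi>0 x1 - \<phi>0 ?y \<le> L0 * (h * speed)"
      proof -
        have "\<phi>0 x1 - \<phi>0 ?y \<le> L0 * norm (h *\<^sub>R v1)" using \<phi>0(2)[of x1 ?y] by simp
        also have "\<dots> \<le> L0 * (h * speed)" using hv L0 by (rule mult_left_mono)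
        finally show ?thesis .
      qed
      moreover have "\<beta> * norm ?y - \<beta> * norm x1 \<le> \<beta> * (h * speed)"
      proof -
        have "norm ?y - norm x1 \<le> h * speed" using hv norm_triangle_ineq4[of x1 "h *\<^sub>R v1"] by linarith
        then show ?thesis using \<beta> by (simp flip: right_diff_distrib)
      qed
      moreover have "?k (t1 - h) = \<phi> (t1 - h) ?y v1" "?k t1 = \<phi> t1 x1 v1" by simp_all
      moreover have "\<kappa> * (t1 - h) = \<kappa> * t1 - L0 * (h * speed) - \<beta> * (h * speed) - \<beta> * h"
        by (simp add: \<kappa>_def algebra_simps)
      moreover have "\<beta> / 2 * (t1 - h) = \<beta> / 2 * t1 - \<beta> * h / 2" by (simp add: field_simps)
      moreover have "0 < \<beta> * h" using \<beta> h by simp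
      ultimately show False using d(2)[OF h(1,2)] by linarith
    qed
    moreover have "\<kappa> * t + \<beta> * norm x \<le> L0 * speed * t + e"
    proof -
      have "\<kappa> * t + \<beta> * norm x \<le> L0 * speed * t + \<beta> * (1 + (speed + 1) * t + norm x)"
        using \<beta> by (simp add: \<kappa>_def algebra_simps)
      also have "\<dots> = L0 * speed * t + e" using den by (simp add: \<beta>_def)
      finally show ?thesis .
    qed
    ultimately show "\<phi>0 x - \<phi> t x v \<le> L0 * speed * t + e" by linarith
  qed
  have "L0 * speed * t \<le> (1 + L0 * speed) * t" using t by (simp add: algebra_simps)
  then show ?thesis using upper lower by (simp add: abs_le_iff)
qed

end

section \<open>Relaxed limits and perturbed test functions\<close>

lemma compact_uniform_smallness:
  fixes A :: "'z::metric_space set" and Q :: "real \<Rightarrow> 'z \<Rightarrow> bool"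
  assumes A: "compact A"
    and loc: "\<And>z. z \<in> A \<Longrightarrow> \<exists>\<rho>>0. \<forall>\<epsilon> z'. 0 < \<epsilon> \<and> \<epsilon> < \<rho> \<and> z' \<in> A \<and> dist z' z < \<rho> \<longrightarrow> Q \<epsilon> z'"
  shows "\<exists>\<rho>>0. \<forall>\<epsilon> z'. 0 < \<epsilon> \<and> \<epsilon> < \<rho> \<and> z' \<in> A \<longrightarrow> Q \<epsilon> z'"
proof -
  obtain \<rho> where \<rho>: "\<And>z. z \<in> A \<Longrightarrow> \<rho> z > 0"
    "\<And>z \<epsilon> z'. z \<in> A \<Longrightarrow> 0 < \<epsilon> \<Longrightarrow> \<epsilon> < \<rho> z \<Longrightarrow> z' \<in> A \<Longrightarrow> dist z' z < \<rho> z \<Longrightarrow> Q \<epsilon> z'"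
    using loc by metis
  have "A \<subseteq> (\<Union>z\<in>A. ball z (\<rho> z))" using \<rho>(1) by force
  then obtain C where C: "C \<subseteq> A" "finite C" "A \<subseteq> (\<Union>z\<in>C. ball z (\<rho> z))"
    using compactE_image[OF A, of A "\<lambda>z. ball z (\<rho> z)"] by (metis open_ball)
  define r where "r = Min (insert 1 (\<rho> ` C))"
  have "r > 0" unfolding r_def using C \<rho>(1) by (subst Min_gr_iff) auto
  moreover have "Q \<epsilon> z'" if a: "0 < \<epsilon>" "\<epsilon> < r" "z' \<in> A" for \<epsilon> z'
  proof -
    obtain z where z: "z \<in> C" "dist z' z < \<rho> z" using C(3) a(3) by (auto simp: dist_commute)
    have "r \<le> \<rho> z" unfolding r_def using z C by (intro Min_le) auto
    then show ?thesis using \<rho>(2)[of z \<epsilon> z'] z C a by auto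
  qed
  ultimately show ?thesis by blast
qed

locale relaxed_family =
  fixes S :: "'z::euclidean_space set" and K :: "'v::topological_space set"
    and F :: "real \<Rightarrow> 'z \<Rightarrow> 'v \<Rightarrow> real"
  assumes K_nonempty: "K \<noteq> {}"
    and locally_bounded: "\<And>z. z \<in> S \<Longrightarrow> \<exists>r>0. \<exists>B. \<forall>\<epsilon>>0. \<forall>z'\<in>S. \<forall>v\<in>K. dist z' z < r \<longrightarrow> \<bar>F \<epsilon> z' v\<bar> \<le> B"
begin

text \<open>The relaxed upper limit is defined through its eventual upper bounds. Thereby it is a real number
  without a detour through the extended reals, and both its upper semicontinuity and the existence of
  approximating points are read off from \<open>nearly_le\<close>. The lower limit is the negative of the upper limit
  of the negated family.\<close>

definition nearly_le :: "'z \<Rightarrow> real \<Rightarrow> bool" where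
  "nearly_le z c \<longleftrightarrow> (\<exists>r>0. \<forall>\<epsilon> z' v. 0 < \<epsilon> \<and> \<epsilon> < r \<and> z' \<in> S \<and> dist z' z < r \<and> v \<in> K \<longrightarrow> F \<epsilon> z' v \<le> c)"

definition upper_limit :: "'z \<Rightarrow> real" where
  "upper_limit z = Inf {c. nearly_le z c}"

lemma nearly_le_mono: "nearly_le z c \<Longrightarrow> c \<le> c' \<Longrightarrow> nearly_le z c'"
  unfolding nearly_le_def by (meson order_trans)

lemma nearly_le_bounds:
  assumes "z \<in> S"
  shows "\<exists>c. nearly_le z c" "bdd_below {c. nearly_le z c}"
proof -
  obtain r B where r: "r > 0" "\<And>\<epsilon> z' v. \<epsilon> > 0 \<Longrightarrow> z' \<in> S \<Longrightarrow> v \<in> K \<Longrightarrow> dist z' z < r \<Longrightarrow> \<bar>F \<epsilon> z' v\<bar> \<le> B"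
    using locally_bounded[OF assms] by blast
  have "nearly_le z B" unfolding nearly_le_def using r by (metis abs_le_D1)
  then show "\<exists>c. nearly_le z c" ..
  obtain v where v: "v \<in> K" using K_nonempty by blast
  show "bdd_below {c. nearly_le z c}"
  proof (rule bdd_belowI[of _ "- B"])
    fix c assume "c \<in> {c. nearly_le z c}"
    then obtain r' where r': "r' > 0" "\<And>\<epsilon> z' v. 0 < \<epsilon> \<Longrightarrow> \<epsilon> < r' \<Longrightarrow> z' \<in> S \<Longrightarrow> dist z' z < r' \<Longrightarrow> v \<in> K \<Longrightarrow> F \<epsilon> z' v \<le> c"
      unfolding nearly_le_def by blast
    have "F (r' / 2) z v \<le> c" using r' assms v by simp
    moreover have "\<bar>F (r' / 2) z v\<bar> \<le> B" using r r' assms v by simp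
    ultimately show "- B \<le> c" by linarith
  qed
qed

lemma upper_limit_less: "z \<in> S \<Longrightarrow> upper_limit z < c \<Longrightarrow> nearly_le z c"
  unfolding upper_limit_def
  using cInf_lessD[of "{c. nearly_le z c}" c] nearly_le_bounds(1) nearly_le_mono by fastforce

lemma upper_limit_le: "z \<in> S \<Longrightarrow> nearly_le z c \<Longrightarrow> upper_limit z \<le> c"
  unfolding upper_limit_def by (rule cInf_lower) (auto intro: nearly_le_bounds(2))

lemma upper_limit_approached:
  assumes "z \<in> S" "c < upper_limit z" "r > 0"
  shows "\<exists>\<epsilon> z' v. 0 < \<epsilon> \<and> \<epsilon> < r \<and> z' \<in> S \<and> dist z' z < r \<and> v \<in> K \<and> c < F \<epsilon> z' v"
  using upper_limit_le[OF assms(1), of c] assms(2,3) unfolding nearly_le_def by (meson not_le)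

lemma upper_limit_usc:
  assumes "z \<in> S" "upper_limit z < c"
  shows "\<forall>\<^sub>F z' in at z within S. upper_limit z' < c"
proof -
  obtain c' where c': "upper_limit z < c'" "c' < c" using assms(2) dense by blast
  obtain r where r: "r > 0" "\<And>\<epsilon> z' v. 0 < \<epsilon> \<Longrightarrow> \<epsilon> < r \<Longrightarrow> z' \<in> S \<Longrightarrow> dist z' z < r \<Longrightarrow> v \<in> K \<Longrightarrow> F \<epsilon> z' v \<le> c'"
    using upper_limit_less[OF assms(1) c'(1)] unfolding nearly_le_def by blast
  have "upper_limit z' < c" if z': "z' \<in> S" "dist z' z < r / 2" for z'
  proof -
    have "F \<epsilon> w v \<le> c'" if "0 < \<epsilon>" "\<epsilon> < r / 2" "w \<in> S" "dist w z' < r / 2" "v \<in> K" for \<epsilon> w v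
      using r(2)[of \<epsilon> w v] that z' dist_triangle[of w z z'] r(1) by simp
    then have "nearly_le z' c'" unfolding nearly_le_def using r(1) by (metis half_gt_zero)
    then show ?thesis using upper_limit_le[OF z'(1)] c'(2) by force
  qed
  then show ?thesis unfolding eventually_at using r(1) by (metis half_gt_zero)
qed

text \<open>Subtracting \<open>(dist z z0)\<^sup>2\<close> makes the contact of \<open>\<theta>\<close> with the upper limit strict: on the annulus
  \<open>d \<le> dist z z0 \<le> r0\<close> the functions stay, for small \<open>\<epsilon>\<close>, below the contact value by about \<open>d\<^sup>2 / 2\<close>, while
  near \<open>z0\<close> they come closer to it than \<open>d\<^sup>2 / 4\<close>. The perturbation \<open>\<epsilon> \<eta> v\<close> is negligible, so
  the maximum is attained in the inner ball.\<close>

lemma perturbed_maximum: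
  assumes K: "compact K" and cont: "\<And>\<epsilon>. 0 < \<epsilon> \<Longrightarrow> continuous_on (S \<times> K) (\<lambda>(z, v). F \<epsilon> z v)"
    and B: "cball z0 r0 \<subseteq> S"
    and \<theta>: "continuous_on (cball z0 r0) \<theta>" and \<eta>: "continuous_on K \<eta>"
    and max: "\<And>z. z \<in> cball z0 r0 \<Longrightarrow> upper_limit z - \<theta> z \<le> upper_limit z0 - \<theta> z0"
    and d: "0 < d" "d < r0"
  obtains \<epsilon> z v where "0 < \<epsilon>" "\<epsilon> < d" "dist z z0 < d" "v \<in> K"
    "\<And>z' v'. z' \<in> cball z0 r0 \<Longrightarrow> v' \<in> K \<Longrightarrow>
       F \<epsilon> z' v' - \<theta> z' - (dist z' z0)\<^sup>2 - \<epsilon> * \<eta> v' \<le> F \<epsilon> z v - \<theta> z - (dist z z0)\<^sup>2 - \<epsilon> * \<eta> v"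
proof -
  define h where "h z = \<theta> z + (dist z z0)\<^sup>2" for z
  have hc: "continuous_on (cball z0 r0) h" unfolding h_def by (intro continuous_intros \<theta>)
  have z0: "z0 \<in> S" "z0 \<in> cball z0 r0" using B d by auto
  define m where "m = upper_limit z0 - \<theta> z0"
  define q where "q = d\<^sup>2"
  have q: "q > 0" using d by (simp add: q_def)
  let ?A = "cball z0 r0 - ball z0 d"
  have "compact ?A" by (intro compact_diff) auto
  then have "\<exists>\<rho>>0. \<forall>\<epsilon> z'. 0 < \<epsilon> \<and> \<epsilon> < \<rho> \<and> z' \<in> ?A \<longrightarrow> (\<forall>v\<in>K. F \<epsilon> z' v - h z' \<le> m - q / 2)"
  proof (rule compact_uniform_smallness)
    fix z assume z: "z \<in> ?A"
    then have zS: "z \<in> S" using B by auto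
    have "upper_limit z < upper_limit z + q / 6" using q by simp
    then obtain r where r: "r > 0" "\<And>\<epsilon> z' v. 0 < \<epsilon> \<Longrightarrow> \<epsilon> < r \<Longrightarrow> z' \<in> S \<Longrightarrow> dist z' z < r \<Longrightarrow> v \<in> K \<Longrightarrow>
        F \<epsilon> z' v \<le> upper_limit z + q / 6"
      using upper_limit_less[OF zS] unfolding nearly_le_def by blast
    have "\<forall>e>0. \<exists>d>0. \<forall>x'\<in>cball z0 r0. dist x' z < d \<longrightarrow> dist (h x') (h z) < e"
      using hc z unfolding continuous_on_iff by blast
    then obtain r' where r': "r' > 0" "\<And>z'. z' \<in> cball z0 r0 \<Longrightarrow> dist z' z < r' \<Longrightarrow> dist (h z') (h z) < q / 6"
      using q by (metis divide_pos_pos zero_less_numeral)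
    have "q \<le> (dist z z0)\<^sup>2" unfolding q_def using z d by (intro power_mono) (auto simp: dist_commute)
    then have hz: "upper_limit z - h z \<le> m - q" using max[of z] z by (simp add: h_def m_def)
    have "F \<epsilon> z' v - h z' \<le> m - q / 2" if "0 < \<epsilon>" "\<epsilon> < min r r'" "z' \<in> ?A" "dist z' z < min r r'" "v \<in> K" for \<epsilon> z' v
    proof -
      have "z' \<in> S" using that(3) B by blast
      then have "F \<epsilon> z' v \<le> upper_limit z + q / 6" using r(2)[of \<epsilon> z' v] that by simp
      moreover have "\<bar>h z' - h z\<bar> < q / 6" using r'(2)[of z'] that by (simp add: dist_real_def)
      ultimately show ?thesis using hz q by linarith
    qed
    then show "\<exists>\<rho>>0. \<forall>\<epsilon> z'. 0 < \<epsilon> \<and> \<epsilon> < \<rho> \<and> z' \<in> ?A \<and> dist z' z < \<rho> \<longrightarrow> (\<forall>v\<in>K. F \<epsilon> z' v - h z' \<le> m - q / 2)"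
      using r(1) r'(1) by (intro exI[of _ "min r r'"]) auto
  qed
  then obtain \<rho> where \<rho>: "\<rho> > 0"
    "\<And>\<epsilon> z' v. 0 < \<epsilon> \<Longrightarrow> \<epsilon> < \<rho> \<Longrightarrow> z' \<in> ?A \<Longrightarrow> v \<in> K \<Longrightarrow> F \<epsilon> z' v - h z' \<le> m - q / 2"
    by blast
  obtain C where C: "\<And>v. v \<in> K \<Longrightarrow> \<bar>\<eta> v\<bar> \<le> C" "0 \<le> C"
  proof -
    obtain C where "\<forall>y\<in>\<eta> ` K. norm y \<le> C"
      using compact_imp_bounded[OF compact_continuous_image[OF \<eta> K]] unfolding bounded_iff by auto
    then show ?thesis using that[of "max 0 C"] by fastforce
  qed
  have "\<forall>e>0. \<exists>d>0. \<forall>x'\<in>cball z0 r0. dist x' z0 < d \<longrightarrow> dist (h x') (h z0) < e"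
    using hc z0 unfolding continuous_on_iff by blast
  then obtain r1 where r1: "r1 > 0" "\<And>z'. z' \<in> cball z0 r0 \<Longrightarrow> dist z' z0 < r1 \<Longrightarrow> dist (h z') (h z0) < q / 8"
    using q by (metis divide_pos_pos zero_less_numeral)
  define r where "r = min (min \<rho> d) (min r1 (q / (16 * (C + 1))))"
  have r: "r > 0" using \<rho> d r1 q C by (simp add: r_def)
  obtain \<epsilon> z1 v1 where e: "0 < \<epsilon>" "\<epsilon> < r" "z1 \<in> S" "dist z1 z0 < r" "v1 \<in> K" "upper_limit z0 - q / 8 < F \<epsilon> z1 v1"
    using upper_limit_approached[OF z0(1), of "upper_limit z0 - q / 8" r] r q by auto
  have e\<eta>: "\<bar>\<epsilon> * \<eta> v\<bar> \<le> q / 16" if "v \<in> K" for v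
  proof -
    have "\<bar>\<epsilon> * \<eta> v\<bar> \<le> \<epsilon> * (C + 1)" using C(1)[OF that] e by (simp add: abs_mult)
    also have "\<dots> \<le> q / (16 * (C + 1)) * (C + 1)" using e C by (intro mult_right_mono) (auto simp: r_def)
    also have "\<dots> = q / 16" using C by (simp add: field_simps)
    finally show ?thesis .
  qed
  let ?\<Phi> = "\<lambda>(z, v). F \<epsilon> z v - h z - \<epsilon> * \<eta> v"
  have z1: "z1 \<in> cball z0 r0" using e d by (auto simp: r_def dist_commute)
  have h1: "\<bar>h z1 - h z0\<bar> < q / 8" using r1(2)[OF z1] e by (simp add: r_def dist_real_def)
  have val1: "?\<Phi> (z1, v1) > m - 5 * q / 16"
    using e(6) h1 e\<eta>[OF e(5)] unfolding m_def h_def[of z0] abs_le_iff abs_less_iff by simp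
  have "continuous_on (cball z0 r0 \<times> K) ?\<Phi>"
  proof -
    have "continuous_on (cball z0 r0 \<times> K) (\<lambda>(z, v). F \<epsilon> z v)"
      by (rule continuous_on_subset[OF cont[OF e(1)]]) (use B in auto)
    then show ?thesis unfolding case_prod_beta
      by (intro continuous_intros continuous_on_compose2[OF hc] continuous_on_compose2[OF \<eta>]) auto
  qed
  moreover have "compact (cball z0 r0 \<times> K)" by (intro compact_Times K) auto
  moreover have "cball z0 r0 \<times> K \<noteq> {}" using z0 e by blast
  ultimately have "\<exists>w\<in>cball z0 r0 \<times> K. \<forall>w'\<in>cball z0 r0 \<times> K. ?\<Phi> w' \<le> ?\<Phi> w"
    by (intro continuous_attains_sup)
  then obtain z v where zv: "z \<in> cball z0 r0" "v \<in> K"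
    "\<And>z' v'. z' \<in> cball z0 r0 \<Longrightarrow> v' \<in> K \<Longrightarrow> ?\<Phi> (z', v') \<le> ?\<Phi> (z, v)"
    by fastforce
  have "z \<in> ball z0 d"
  proof (rule ccontr)
    assume "z \<notin> ball z0 d"
    then have "F \<epsilon> z v - h z \<le> m - q / 2" using \<rho>(2)[of \<epsilon> z v] zv e by (auto simp: r_def)
    then have "?\<Phi> (z, v) \<le> m - 7 * q / 16" using e\<eta>[OF zv(2)] unfolding abs_le_iff by simp
    moreover have "?\<Phi> (z1, v1) \<le> ?\<Phi> (z, v)" by (rule zv(3)[OF z1 e(5)])
    ultimately show False using val1 q by linarith
  qed
  then show ?thesis
    using that[of \<epsilon> z v] e zv by (simp add: r_def h_def dist_commute diff_diff_eq)
qed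

end

lemma relaxed_family_uminus:
  assumes "relaxed_family S K F"
  shows "relaxed_family S K (\<lambda>\<epsilon> z v. - F \<epsilon> z v)"
  using assms unfolding relaxed_family_def by simp

text \<open>The first-order condition at an interior maximum, taken in the one direction in which the kinetic equation
  provides a derivative.\<close>

lemma characteristic_maximum:
  fixes f :: "real \<times> 'a::euclidean_space \<Rightarrow> real"
  assumes f: "((\<lambda>\<tau>. f (\<tau>, y + (\<tau> - s) *\<^sub>R v)) has_real_derivative j) (at s)"
    and \<theta>: "GDERIV \<theta> (s, y) :> D" and e: "0 < e"
    and max: "\<And>z. dist z (s, y) < e \<Longrightarrow> f z - \<theta> z - (dist z z0)\<^sup>2 \<le> f (s, y) - \<theta> (s, y) - (dist (s, y) z0)\<^sup>2"
  shows "j = (D + 2 *\<^sub>R ((s, y) - z0)) \<bullet> (1, v)"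
proof -
  let ?\<gamma> = "\<lambda>\<tau>. (\<tau>, y + (\<tau> - s) *\<^sub>R v)"
  let ?w = "(1::real, v)"
  have \<gamma>: "(?\<gamma> has_derivative (\<lambda>h. h *\<^sub>R ?w)) (at s)"
    by (auto intro!: derivative_eq_intros)
  have \<gamma>s: "?\<gamma> s = (s, y)" by simp
  have \<theta>d: "(\<theta> has_derivative (\<lambda>h. h \<bullet> D)) (at (?\<gamma> s))" using \<theta> by (simp add: gderiv_def)
  have "((\<lambda>\<tau>. \<theta> (?\<gamma> \<tau>)) has_derivative (\<lambda>h. (h *\<^sub>R ?w) \<bullet> D)) (at s)"
    using diff_chain_at[OF \<gamma> \<theta>d] by (simp add: o_def)
  then have 1: "((\<lambda>\<tau>. \<theta> (?\<gamma> \<tau>)) has_real_derivative D \<bullet> ?w) (at s)"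
    unfolding has_field_derivative_def
    by (rule has_derivative_eq_rhs) (simp only: fun_eq_iff inner_scaleR_left inner_commute[of ?w] mult.commute, simp)
  have "((\<lambda>\<tau>. (?\<gamma> \<tau> - z0) \<bullet> (?\<gamma> \<tau> - z0)) has_derivative (\<lambda>h. 2 * ((h *\<^sub>R ?w) \<bullet> (?\<gamma> s - z0)))) (at s)"
    by (rule has_derivative_eq_rhs, rule derivative_intros) (rule derivative_intros \<gamma> | simp add: inner_commute)+
  then have 2: "((\<lambda>\<tau>. (dist (?\<gamma> \<tau>) z0)\<^sup>2) has_real_derivative 2 * (((s, y) - z0) \<bullet> ?w)) (at s)"
    unfolding has_field_derivative_def dist_norm power2_norm_eq_inner \<gamma>s
    by (rule has_derivative_eq_rhs) (simp only: fun_eq_iff inner_scaleR_left inner_commute[of ?w], simp)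
  have der: "((\<lambda>\<tau>. f (?\<gamma> \<tau>) - \<theta> (?\<gamma> \<tau>) - (dist (?\<gamma> \<tau>) z0)\<^sup>2) has_real_derivative
      j - D \<bullet> ?w - 2 * (((s, y) - z0) \<bullet> ?w)) (at s)"
    by (intro derivative_intros f 1 2)
  have "continuous (at s) ?\<gamma>" using \<gamma> by (rule has_derivative_continuous)
  then obtain d where d: "d > 0" "\<And>\<tau>. dist \<tau> s < d \<Longrightarrow> dist (?\<gamma> \<tau>) (?\<gamma> s) < e"
    using e unfolding continuous_at_eps_delta by blast
  have "j - D \<bullet> ?w - 2 * (((s, y) - z0) \<bullet> ?w) = 0"
  proof (rule DERIV_local_max[OF der d(1)], intro allI impI)
    fix \<tau> assume "\<bar>s - \<tau>\<bar> < d"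
    then have "dist (?\<gamma> \<tau>) (s, y) < e" using d(2)[of \<tau>] by (simp add: dist_real_def abs_minus_commute)
    from max[OF this] show "f (?\<gamma> \<tau>) - \<theta> (?\<gamma> \<tau>) - (dist (?\<gamma> \<tau>) z0)\<^sup>2
        \<le> f (?\<gamma> s) - \<theta> (?\<gamma> s) - (dist (?\<gamma> s) z0)\<^sup>2" by simp
  qed
  then show ?thesis by (simp only: inner_add_left inner_scaleR_left)
qed

section \<open>Comparison for Hamilton-Jacobi equations\<close>

lemma upper_semicontinuous_attains_max:
  fixes f :: "'z::metric_space \<Rightarrow> real"
  assumes K: "compact K" "K \<noteq> {}"
    and usc: "\<And>z c. z \<in> K \<Longrightarrow> f z < c \<Longrightarrow> \<exists>r>0. \<forall>z'\<in>K. dist z' z < r \<longrightarrow> f z' < c"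
  shows "\<exists>z\<in>K. \<forall>z'\<in>K. f z' \<le> f z"
proof (rule ccontr)
  assume "\<not> ?thesis"
  then have "\<forall>z\<in>K. \<exists>w. w \<in> K \<and> f z < f w" by (auto simp: not_le)
  then obtain w where w: "\<And>z. z \<in> K \<Longrightarrow> w z \<in> K" "\<And>z. z \<in> K \<Longrightarrow> f z < f (w z)" by metis
  then have "\<forall>z\<in>K. \<exists>r>0. \<forall>z'\<in>K. dist z' z < r \<longrightarrow> f z' < f (w z)" using usc by blast
  then obtain r where r: "\<And>z. z \<in> K \<Longrightarrow> r z > 0"
    "\<And>z z'. z \<in> K \<Longrightarrow> z' \<in> K \<Longrightarrow> dist z' z < r z \<Longrightarrow> f z' < f (w z)" by metis
  have "K \<subseteq> (\<Union>z\<in>K. ball z (r z))" using r(1) by force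
  then obtain C where C: "C \<subseteq> K" "finite C" "K \<subseteq> (\<Union>z\<in>C. ball z (r z))"
    using compactE_image[OF K(1), of K "\<lambda>z. ball z (r z)"] by (metis open_ball)
  have "C \<noteq> {}" using C(3) K(2) by auto
  then have "Max ((\<lambda>z. f (w z)) ` C) \<in> (\<lambda>z. f (w z)) ` C" using C(2) by (intro Max_in) auto
  then obtain z where z: "z \<in> C" "Max ((\<lambda>z. f (w z)) ` C) = f (w z)" by auto
  then have wz: "w z \<in> K" using w C by auto
  then obtain c where c: "c \<in> C" "dist (w z) c < r c" using C(3) by (auto simp: dist_commute)
  then have "f (w z) < f (w c)" using r(2)[of c "w z"] C wz by auto
  moreover have "f (w c) \<le> f (w z)" unfolding z(2)[symmetric] using C c by (intro Max_ge) auto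
  ultimately show False by simp
qed

lemma GDERIV_dist_square: "GDERIV (\<lambda>z. N * (dist z c)\<^sup>2) z :> (2 * N) *\<^sub>R (z - c)"
  unfolding dist_norm power2_norm_eq_inner gderiv_def
  by (auto intro!: derivative_eq_intros simp: inner_commute algebra_simps)

lemma GDERIV_cmult: "GDERIV f x :> d \<Longrightarrow> GDERIV (\<lambda>x. c * f x) x :> c *\<^sub>R d"
  unfolding gderiv_def inner_scaleR_right by (rule has_derivative_mult_right)

text \<open>The three terms respectively make the inequality between sub- and supersolution strict, keep maximum points at
  finite distance by means of a gradient of norm at most \<open>b\<close>, and keep them away from the final time \<open>T + 1\<close>. The last one vanishes up to time \<open>T\<close> and is nondecreasing and
  continuously differentiable on the whole time axis, as a test function has to be.\<close>

definition penalty :: "real \<Rightarrow> real \<Rightarrow> real \<Rightarrow> real \<Rightarrow> real \<times> 'a::euclidean_space \<Rightarrow> real" where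
  "penalty k b A T z = k * fst z + b * sqrt (1 + snd z \<bullet> snd z) + A * (max 0 (fst z - T))\<^sup>2"

lemma GDERIV_penalty:
  "GDERIV (penalty k b A T) z :>
    (k + 2 * A * max 0 (fst z - T), (b / sqrt (1 + snd z \<bullet> snd z)) *\<^sub>R snd z)"
proof -
  have p: "1 + snd z \<bullet> snd z > 0" by (simp add: add_pos_nonneg)
  have 1: "GDERIV (\<lambda>z. k * fst z) z :> (k, 0)"
    unfolding gderiv_def by (auto intro!: derivative_eq_intros simp: inner_prod_def)
  have 2: "GDERIV (\<lambda>z. fst z - T) z :> (1, 0)"
    unfolding gderiv_def by (auto intro!: derivative_eq_intros simp: inner_prod_def)
  have 3: "GDERIV (\<lambda>z. (max 0 (fst z - T))\<^sup>2) z :> (2 * max 0 (fst z - T)) *\<^sub>R (1, 0)"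
    by (rule GDERIV_DERIV_compose[OF 2 DERIV_positive_part_square])
  have 4: "GDERIV (\<lambda>z. A * (max 0 (fst z - T))\<^sup>2) z :> (2 * A * max 0 (fst z - T), 0)"
    by (rule GDERIV_subst[OF GDERIV_cmult[OF 3]]) simp
  have 5: "GDERIV (\<lambda>z. 1 + snd z \<bullet> snd z) z :> (0, 2 *\<^sub>R snd z)"
    unfolding gderiv_def by (auto intro!: derivative_eq_intros simp: inner_prod_def inner_commute)
  have s: "(sqrt has_real_derivative inverse (sqrt (1 + snd z \<bullet> snd z)) / 2) (at (1 + snd z \<bullet> snd z))"
    using p by (rule DERIV_real_sqrt)
  have 6: "GDERIV (\<lambda>z. b * sqrt (1 + snd z \<bullet> snd z)) z :> (0, (b / sqrt (1 + snd z \<bullet> snd z)) *\<^sub>R snd z)"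
    by (rule GDERIV_subst[OF GDERIV_cmult[OF GDERIV_DERIV_compose[OF 5 s]]]) (simp add: inverse_eq_divide)
  show ?thesis unfolding penalty_def
    by (rule GDERIV_subst[OF GDERIV_add[OF GDERIV_add[OF 1 6] 4]]) simp
qed

text \<open>Doubling of variables: \<open>U z - W z' - n (dist z z')\<^sup>2 - \<theta> z\<close> is maximised over a compact set. For fixed penalty
  \<open>\<theta>\<close> the maximum points cluster, as \<open>n \<rightarrow> \<infinity>\<close>, at a diagonal point \<open>(z, z)\<close> with \<open>U z - W z - \<theta> z > 0\<close>. The initial
  condition and the size of \<open>\<theta>\<close> force this point into the interior, so for some large \<open>n\<close> both viscosity
  inequalities are available. The Hamiltonian is evaluated at momenta that may be unbounded in \<open>n\<close> but differ by at most \<open>b\<close>;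
  the global Lipschitz bound makes their difference at most \<open>R b\<close>, which the time slope
  \<open>k = (R + 1) b\<close> of the penalty exceeds. Since \<open>b\<close> is fixed while \<open>n\<close> grows, the maximum points
  stay in a compact set, and semicontinuity suffices to pass to the limit.\<close>

theorem HJ_comparison:
  fixes H :: "'a::euclidean_space \<Rightarrow> real" and u w :: "real \<Rightarrow> 'a \<Rightarrow> real"
  assumes H: "\<And>p q. H q \<le> H p + R * norm (p - q)" and R: "0 \<le> R"
    and sub: "viscosity_subsolution H u" and super: "viscosity_supersolution H w"
    and usc: "\<And>z c. z \<in> {0..} \<times> UNIV \<Longrightarrow> (\<lambda>(t, x). u t x) z < c \<Longrightarrow>
       \<forall>\<^sub>F z' in at z within {0..} \<times> UNIV. (\<lambda>(t, x). u t x) z' < c"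
    and lsc: "\<And>z c. z \<in> {0..} \<times> UNIV \<Longrightarrow> c < (\<lambda>(t, x). w t x) z \<Longrightarrow>
       \<forall>\<^sub>F z' in at z within {0..} \<times> UNIV. c < (\<lambda>(t, x). w t x) z'"
    and bdd: "\<And>T. 0 < T \<Longrightarrow> \<exists>B. \<forall>t\<in>{0..T}. \<forall>x. u t x \<le> B \<and> - B \<le> w t x"
    and init: "\<And>x. u 0 x \<le> w 0 x"
    and T: "0 \<le> T"
  shows "u T x\<^sub>0 \<le> w T x\<^sub>0"
proof (rule ccontr)
  assume contra: "\<not> u T x\<^sub>0 \<le> w T x\<^sub>0"
  define U where "U = (\<lambda>(t, x). u t x)"
  define W where "W = (\<lambda>(t, x). w t x)"
  let ?S = "{0::real..} \<times> (UNIV :: 'a set)"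
  have Uusc: "\<exists>r>0. \<forall>z'\<in>?S. dist z' z < r \<longrightarrow> U z' < c" if "z \<in> ?S" "U z < c" for z c
    using usc[of z c] that unfolding eventually_at U_def by (metis zero_less_dist_iff dist_eq_0_iff)
  have Wlsc: "\<exists>r>0. \<forall>z'\<in>?S. dist z' z < r \<longrightarrow> c < W z'" if "z \<in> ?S" "c < W z" for z c
    using lsc[of z c] that unfolding eventually_at W_def by (metis zero_less_dist_iff dist_eq_0_iff)
  obtain B0 where B0: "\<And>t x. t \<in> {0..T + 1} \<Longrightarrow> u t x \<le> B0 \<and> - B0 \<le> w t x"
    using bdd[of "T + 1"] T by (meson add_nonneg_pos zero_less_one)
  define B where "B = max 1 B0"
  have B1: "1 \<le> B" by (simp add: B_def)
  have UB: "U z \<le> B" "- B \<le> W z" if "fst z \<in> {0..T + 1}" for z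
    using B0[OF that, of "snd z"] by (auto simp: U_def W_def B_def case_prod_beta)
  define \<sigma> where "\<sigma> = U (T, x\<^sub>0) - W (T, x\<^sub>0)"
  have \<sigma>: "\<sigma> > 0" using contra by (simp add: \<sigma>_def U_def W_def)
  define E where "E = (R + 1) * T + sqrt (1 + x\<^sub>0 \<bullet> x\<^sub>0)"
  \<comment> \<open>Chosen so that the penalty takes exactly half of the gap at \<open>(T, x\<^sub>0)\<close>.\<close>
  define b where "b = \<sigma> / (2 * E)"
  have den: "E > 0"
    unfolding E_def using R T by (intro add_nonneg_pos mult_nonneg_nonneg) (auto simp: add_pos_nonneg)
  have b: "b > 0" unfolding b_def using \<sigma> den by simp
  define k where "k = (R + 1) * b"
  define A where "A = 2 * B + 1"
  define \<theta> :: "real \<times> 'a \<Rightarrow> real" where "\<theta> = penalty k b A T"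
  have k0: "k \<ge> 0" and A0: "A \<ge> 0" using R b B1 by (auto simp: k_def A_def)
  have \<theta>c: "continuous_on X \<theta>" for X
    unfolding \<theta>_def penalty_def[abs_def] by (intro continuous_intros)
  have sqrt_ge: "norm x \<le> sqrt (1 + x \<bullet> x)" for x :: 'a
    by (simp add: norm_eq_sqrt_inner)
  have \<theta>_ge: "0 \<le> \<theta> z" "b * norm (snd z) \<le> \<theta> z" "A * (max 0 (fst z - T))\<^sup>2 \<le> \<theta> z" if "0 \<le> fst z" for z
  proof -
    have "0 \<le> k * fst z" "0 \<le> A * (max 0 (fst z - T))\<^sup>2" "0 \<le> b * norm (snd z)"
      "b * norm (snd z) \<le> b * sqrt (1 + snd z \<bullet> snd z)"
      using k0 A0 b that sqrt_ge[of "snd z"] by auto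
    then show "0 \<le> \<theta> z" "b * norm (snd z) \<le> \<theta> z" "A * (max 0 (fst z - T))\<^sup>2 \<le> \<theta> z"
      unfolding \<theta>_def penalty_def by linarith+
  qed
  define z0 where "z0 = (T, x\<^sub>0)"
  have start: "U z0 - W z0 - \<theta> z0 = \<sigma> / 2"
  proof -
    have "\<theta> z0 = b * E"
      by (simp add: E_def \<theta>_def penalty_def z0_def k_def algebra_simps)
    also have "\<dots> = \<sigma> / 2" using den by (simp add: b_def)
    finally show ?thesis by (simp add: \<sigma>_def z0_def)
  qed
  define \<rho> where "\<rho> = norm x\<^sub>0 + (2 * B + 1) / b"
  have \<rho>: "2 * B < b * \<rho>"
  proof -
    have "b * \<rho> = b * norm x\<^sub>0 + (2 * B + 1)" using b by (simp add: \<rho>_def field_simps)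
    moreover have "0 \<le> b * norm x\<^sub>0" using b by simp
    ultimately show ?thesis by linarith
  qed
  define Q where "Q = {0..T + 1} \<times> cball (0::'a) \<rho>"
  have Qc: "compact Q" unfolding Q_def by (intro compact_Times) auto
  have QS: "Q \<subseteq> ?S" by (auto simp: Q_def)
  have z0Q: "z0 \<in> Q" using T b B1 by (simp add: z0_def Q_def \<rho>_def)
  define \<Phi> where "\<Phi> n q = U (fst q) - W (snd q) - real n * (dist (fst q) (snd q))\<^sup>2 - \<theta> (fst q)" for n q
  have "\<exists>q\<in>Q \<times> Q. \<forall>q'\<in>Q \<times> Q. \<Phi> n q' \<le> \<Phi> n q" for n
  proof (rule upper_semicontinuous_attains_max)
    show "compact (Q \<times> Q)" using Qc by (intro compact_Times)
    show "Q \<times> Q \<noteq> {}" using z0Q by blast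
    fix q c assume q: "q \<in> Q \<times> Q" and c: "\<Phi> n q < c"
    define e where "e = (c - \<Phi> n q) / 3"
    have e: "e > 0" using c by (simp add: e_def)
    have fS: "fst q \<in> ?S" "snd q \<in> ?S" using q QS by auto
    obtain r1 where r1: "r1 > 0" "\<And>z'. z' \<in> ?S \<Longrightarrow> dist z' (fst q) < r1 \<Longrightarrow> U z' < U (fst q) + e"
      using Uusc[OF fS(1), of "U (fst q) + e"] e by auto
    obtain r2 where r2: "r2 > 0" "\<And>z'. z' \<in> ?S \<Longrightarrow> dist z' (snd q) < r2 \<Longrightarrow> W (snd q) - e < W z'"
      using Wlsc[OF fS(2), of "W (snd q) - e"] e by auto
    let ?g = "\<lambda>q. real n * (dist (fst q) (snd q))\<^sup>2 + \<theta> (fst q)"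
    have "continuous_on UNIV ?g"
      by (intro continuous_intros continuous_on_compose2[OF \<theta>c[of UNIV]]) auto
    then obtain r3 where r3: "r3 > 0" "\<And>q'. dist q' q < r3 \<Longrightarrow> dist (?g q') (?g q) < e"
      using e unfolding continuous_on_iff by blast
    have "\<Phi> n q' < c" if q': "q' \<in> Q \<times> Q" "dist q' q < min r1 (min r2 r3)" for q'
    proof -
      have "dist (fst q') (fst q) \<le> dist q' q" "dist (snd q') (snd q) \<le> dist q' q"
        by (auto simp: dist_fst_le dist_snd_le)
      then have "U (fst q') < U (fst q) + e" "W (snd q) - e < W (snd q')"
        using r1(2)[of "fst q'"] r2(2)[of "snd q'"] q' QS by auto
      moreover have "\<bar>?g q' - ?g q\<bar> < e" using r3(2)[of q'] q' by (simp add: dist_real_def)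
      moreover have "3 * e = c - \<Phi> n q" by (simp add: e_def)
      ultimately show ?thesis unfolding \<Phi>_def by linarith
    qed
    then show "\<exists>r>0. \<forall>q'\<in>Q \<times> Q. dist q' q < r \<longrightarrow> \<Phi> n q' < c"
      using r1(1) r2(1) r3(1) by (intro exI[of _ "min r1 (min r2 r3)"]) auto
  qed
  then obtain p where p: "\<And>n. p n \<in> Q \<times> Q" "\<And>n q'. q' \<in> Q \<times> Q \<Longrightarrow> \<Phi> n q' \<le> \<Phi> n (p n)"
    by metis
  have val: "\<sigma> / 2 \<le> \<Phi> n (p n)" for n
    using p(2)[of "(z0, z0)" n] z0Q start by (simp add: \<Phi>_def)
  have close: "real n * (dist (fst (p n)) (snd (p n)))\<^sup>2 \<le> 2 * B" for n
  proof -
    have "fst (fst (p n)) \<in> {0..T + 1}" "fst (snd (p n)) \<in> {0..T + 1}" using p(1)[of n] by (auto simp: Q_def)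
    then show ?thesis
      using val[of n] UB(1)[of "fst (p n)"] UB(2)[of "snd (p n)"] \<theta>_ge(1)[of "fst (p n)"] \<sigma>
      unfolding \<Phi>_def by fastforce
  qed
  have "seq_compact (Q \<times> Q)" using Qc by (simp add: compact_Times compact_imp_seq_compact)
  then obtain l r where l: "l \<in> Q \<times> Q" "strict_mono r" "(p \<circ> r) \<longlonglongrightarrow> l"
    using p(1) unfolding seq_compact_def by metis
  have l1: "(\<lambda>n. fst (p (r n))) \<longlonglongrightarrow> fst l" and l2: "(\<lambda>n. snd (p (r n))) \<longlonglongrightarrow> snd l"
    using tendsto_fst[OF l(3)] tendsto_snd[OF l(3)] by (auto simp: o_def)
  have leq: "fst l = snd l"
  proof -
    have "(\<lambda>n. (dist (fst (p (r n))) (snd (p (r n))))\<^sup>2) \<longlonglongrightarrow> (dist (fst l) (snd l))\<^sup>2"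
      by (intro tendsto_intros l1 l2)
    moreover have "(\<lambda>n. (dist (fst (p (r n))) (snd (p (r n))))\<^sup>2) \<longlonglongrightarrow> 0"
    proof (rule Lim_null_comparison)
      have "(\<lambda>n. 2 * B * inverse (real n)) \<longlonglongrightarrow> 2 * B * 0"
        by (intro tendsto_intros lim_inverse_n)
      then show "(\<lambda>n. 2 * B * inverse (real n)) \<longlonglongrightarrow> 0" by simp
      show "\<forall>\<^sub>F n in sequentially. norm ((dist (fst (p (r n))) (snd (p (r n))))\<^sup>2) \<le> 2 * B * inverse (real n)"
      proof (rule eventually_mono[OF eventually_gt_at_top[of 0]])
        fix n :: nat assume n: "0 < n"
        have "n \<le> r n" by (rule seq_suble[OF l(2)])
        then have "real n * (dist (fst (p (r n))) (snd (p (r n))))\<^sup>2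
            \<le> real (r n) * (dist (fst (p (r n))) (snd (p (r n))))\<^sup>2" by (intro mult_right_mono) auto
        also have "\<dots> \<le> 2 * B" by (rule close)
        finally show "norm ((dist (fst (p (r n))) (snd (p (r n))))\<^sup>2) \<le> 2 * B * inverse (real n)"
          using n by (simp add: field_simps)
      qed
    qed
    ultimately have "(dist (fst l) (snd l))\<^sup>2 = 0" by (rule LIMSEQ_unique)
    then show ?thesis by simp
  qed
  let ?z = "fst l"
  have zQ: "?z \<in> Q" using l(1) by auto
  then have zS: "?z \<in> ?S" using QS by blast
  have limit: "\<sigma> / 2 \<le> U ?z - W ?z - \<theta> ?z"
  proof (rule field_le_epsilon)
    fix e' :: real assume "0 < e'"
    define e where "e = e' / 3"
    have e: "0 < e" using \<open>0 < e'\<close> by (simp add: e_def)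
    obtain r1 where r1: "r1 > 0" "\<And>z'. z' \<in> ?S \<Longrightarrow> dist z' ?z < r1 \<Longrightarrow> U z' < U ?z + e"
      using Uusc[OF zS, of "U ?z + e"] e by auto
    obtain r2 where r2: "r2 > 0" "\<And>z'. z' \<in> ?S \<Longrightarrow> dist z' ?z < r2 \<Longrightarrow> W ?z - e < W z'"
      using Wlsc[OF zS, of "W ?z - e"] e by auto
    have "(\<lambda>n. \<theta> (fst (p (r n)))) \<longlonglongrightarrow> \<theta> ?z"
      by (rule continuous_on_tendsto_compose[OF \<theta>c[of UNIV] l1]) auto
    then have 3: "\<forall>\<^sub>F n in sequentially. dist (\<theta> (fst (p (r n)))) (\<theta> ?z) < e" using e by (rule tendstoD)
    have 1: "\<forall>\<^sub>F n in sequentially. dist (fst (p (r n))) ?z < r1" using l1 r1(1) by (rule tendstoD)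
    have 2: "\<forall>\<^sub>F n in sequentially. dist (snd (p (r n))) ?z < r2" using l2 r2(1) unfolding leq by (rule tendstoD)
    obtain n where n: "dist (\<theta> (fst (p (r n)))) (\<theta> ?z) < e" "dist (fst (p (r n))) ?z < r1" "dist (snd (p (r n))) ?z < r2"
      using eventually_happens'[OF sequentially_bot eventually_conj[OF 3 eventually_conj[OF 1 2]]] by blast
    have inS: "fst (p (r n)) \<in> ?S" "snd (p (r n)) \<in> ?S" using p(1)[of "r n"] QS by auto
    have "U (fst (p (r n))) < U ?z + e" "W ?z - e < W (snd (p (r n)))"
      using r1(2)[OF inS(1)] r2(2)[OF inS(2)] n by auto
    moreover have "\<bar>\<theta> (fst (p (r n))) - \<theta> ?z\<bar> < e" using n(1) by (simp add: dist_real_def)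
    moreover have "0 \<le> real (r n) * (dist (fst (p (r n))) (snd (p (r n))))\<^sup>2" by simp
    moreover have "e' = 3 * e" by (simp add: e_def)
    ultimately show "\<sigma> / 2 \<le> U ?z - W ?z - \<theta> ?z + e'" using val[of "r n"] unfolding \<Phi>_def by linarith
  qed
  have t0: "0 \<le> fst ?z" "fst ?z \<le> T + 1" "norm (snd ?z) \<le> \<rho>" using zQ by (auto simp: Q_def)
  have UW: "U ?z - W ?z \<le> 2 * B" using UB[of ?z] t0 by simp
  have "fst ?z \<noteq> 0"
  proof
    assume "fst ?z = 0"
    then have "U ?z \<le> W ?z" using init[of "snd ?z"] by (simp add: U_def W_def case_prod_beta)
    then show False using limit \<theta>_ge(1)[OF t0(1)] \<sigma> by linarith
  qed
  moreover have "fst ?z \<noteq> T + 1"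
  proof
    assume "fst ?z = T + 1"
    then have "A \<le> \<theta> ?z" using \<theta>_ge(3)[OF t0(1)] by simp
    then show False using limit UW \<sigma> by (simp add: A_def)
  qed
  moreover have "norm (snd ?z) \<noteq> \<rho>"
  proof
    assume "norm (snd ?z) = \<rho>"
    then have "2 * B < \<theta> ?z" using \<theta>_ge(2)[OF t0(1)] \<rho> by simp
    then show False using limit UW \<sigma> by simp
  qed
  define O' where "O' = {0<..<T + 1} \<times> ball (0::'a) \<rho>"
  have O'o: "open O'" unfolding O'_def by (intro open_Times) auto
  have O'Q: "O' \<subseteq> Q" by (auto simp: O'_def Q_def)
  have zO: "?z \<in> O'"
    using t0 calculation \<open>norm (snd ?z) \<noteq> \<rho>\<close> by (auto simp: O'_def mem_Times_iff)
  have "\<forall>\<^sub>F n in sequentially. fst (p (r n)) \<in> O' \<and> snd (p (r n)) \<in> O'"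
    using topological_tendstoD[OF l1 O'o zO] topological_tendstoD[OF l2 O'o] zO leq
    by (auto intro: eventually_conj)
  then obtain n where n: "fst (p (r n)) \<in> O'" "snd (p (r n)) \<in> O'"
    using eventually_happens'[OF sequentially_bot] by blast
  define N where "N = real (r n)"
  obtain t x s y where ptx: "p (r n) = ((t, x), (s, y))" by (metis surj_pair)
  have zO1: "(t, x) \<in> O'" and zO2: "(s, y) \<in> O'" using n ptx by auto
  have max: "U \<zeta> - W \<zeta>' - N * (dist \<zeta> \<zeta>')\<^sup>2 - \<theta> \<zeta> \<le> U (t, x) - W (s, y) - N * (dist (t, x) (s, y))\<^sup>2 - \<theta> (t, x)"
    if "\<zeta> \<in> O'" "\<zeta>' \<in> O'" for \<zeta> \<zeta>'
    using p(2)[of "(\<zeta>, \<zeta>')" "r n"] that O'Q ptx by (auto simp: \<Phi>_def N_def)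
  define D\<theta> where "D\<theta> z = (k + 2 * A * max 0 (fst z - T), (b / sqrt (1 + snd z \<bullet> snd z)) *\<^sub>R snd z)" for z :: "real \<times> 'a"
  have pos: "0 < t" "0 < s" using zO1 zO2 by (auto simp: O'_def)
  have sub': "fst ((2 * N) *\<^sub>R ((t, x) - (s, y)) + D\<theta> (t, x)) + H (snd ((2 * N) *\<^sub>R ((t, x) - (s, y)) + D\<theta> (t, x))) \<le> 0"
  proof (rule sub[unfolded viscosity_subsolution_def, rule_format, of "\<lambda>z. N * (dist z (s, y))\<^sup>2 + \<theta> z" "\<lambda>z. (2 * N) *\<^sub>R (z - (s, y)) + D\<theta> z"], intro conjI)
    have pen: "GDERIV (penalty k b A T) z :> D\<theta> z" for z
      unfolding D\<theta>_def by (rule GDERIV_penalty)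
    have cD: "continuous_on ({0<..} \<times> UNIV) D\<theta>" unfolding D\<theta>_def
      by (intro continuous_intros) (auto simp: add_nonneg_eq_0_iff)
    show "C1_on ({0<..} \<times> UNIV) (\<lambda>z. N * (dist z (s, y))\<^sup>2 + \<theta> z) (\<lambda>z. (2 * N) *\<^sub>R (z - (s, y)) + D\<theta> z)"
      unfolding C1_on_def \<theta>_def
      by (intro conjI ballI GDERIV_add[OF GDERIV_dist_square pen] continuous_intros cD)
    show "0 < t" by fact
    show "\<forall>\<^sub>F (s', y') in nhds (t, x). u s' y' - (N * (dist (s', y') (s, y))\<^sup>2 + \<theta> (s', y'))
        \<le> u t x - (N * (dist (t, x) (s, y))\<^sup>2 + \<theta> (t, x))"
      using eventually_nhds_in_open[OF O'o zO1]
    proof (rule eventually_mono)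
      fix \<zeta> assume "\<zeta> \<in> O'"
      from max[OF this zO2] show "case \<zeta> of (s', y') \<Rightarrow> u s' y' - (N * (dist (s', y') (s, y))\<^sup>2 + \<theta> (s', y'))
        \<le> u t x - (N * (dist (t, x) (s, y))\<^sup>2 + \<theta> (t, x))"
        by (cases \<zeta>) (simp add: U_def W_def)
    qed
  qed
  have super': "0 \<le> fst ((- 2 * N) *\<^sub>R ((s, y) - (t, x))) + H (snd ((- 2 * N) *\<^sub>R ((s, y) - (t, x))))"
  proof (rule super[unfolded viscosity_supersolution_def, rule_format, of "\<lambda>z. - N * (dist z (t, x))\<^sup>2" "\<lambda>z. (- 2 * N) *\<^sub>R (z - (t, x))"], intro conjI)
    show "C1_on ({0<..} \<times> UNIV) (\<lambda>z. - N * (dist z (t, x))\<^sup>2) (\<lambda>z. (- 2 * N) *\<^sub>R (z - (t, x)))"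
      using GDERIV_dist_square[of "- N" "(t, x)"] unfolding C1_on_def
      by (auto intro!: continuous_intros)
    show "0 < s" by fact
    show "\<forall>\<^sub>F (s', y') in nhds (s, y). w s y - - N * (dist (s, y) (t, x))\<^sup>2 \<le> w s' y' - - N * (dist (s', y') (t, x))\<^sup>2"
      using eventually_nhds_in_open[OF O'o zO2]
    proof (rule eventually_mono)
      fix \<zeta> assume "\<zeta> \<in> O'"
      from max[OF zO1 this] show "case \<zeta> of (s', y') \<Rightarrow>
          w s y - - N * (dist (s, y) (t, x))\<^sup>2 \<le> w s' y' - - N * (dist (s', y') (t, x))\<^sup>2"
        by (cases \<zeta>) (simp add: U_def W_def dist_commute)
    qed
  qed
  define v where "v = (b / sqrt (1 + x \<bullet> x)) *\<^sub>R x"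
  have vb: "norm v \<le> b"
  proof -
    have "norm v = b * (norm x / sqrt (1 + x \<bullet> x))" using b by (simp add: v_def)
    also have "\<dots> \<le> b * 1" using sqrt_ge[of x] b by (intro mult_left_mono) (auto simp: divide_le_eq_1 add_pos_nonneg)
    finally show ?thesis by simp
  qed
  let ?q = "(2 * N) *\<^sub>R (x - y)"
  have "2 * N * (t - s) + k + 2 * A * max 0 (t - T) + H (?q + v) \<le> 0"
    using sub' by (simp add: D\<theta>_def v_def)
  moreover have "0 \<le> 2 * N * (t - s) + H ?q"
    using super' by (simp add: algebra_simps)
  moreover have "H ?q \<le> H (?q + v) + R * b"
    using H[of ?q "?q + v"] mult_left_mono[OF vb R] by simp
  moreover have "0 \<le> 2 * A * max 0 (t - T)" using A0 by simp
  moreover have "k = R * b + b" by (simp add: k_def algebra_simps)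
  ultimately show False using b by linarith
qed

section \<open>Relaxed limits of the kinetic solutions\<close>

context velocity_distribution begin

lemma kinetic_relaxed_family:
  fixes \<phi> :: "real \<Rightarrow> real \<Rightarrow> 'a \<Rightarrow> 'a \<Rightarrow> real"
  assumes bound: "\<And>\<epsilon> t x v. 0 < \<epsilon> \<Longrightarrow> 0 \<le> t \<Longrightarrow> v \<in> V \<Longrightarrow> \<bar>\<phi> \<epsilon> t x v - \<phi>0 x\<bar> \<le> C * t"
    and B0: "\<And>x. \<bar>\<phi>0 x\<bar> \<le> B0" and C: "0 \<le> C"
  shows "relaxed_family ({0..} \<times> UNIV) V (\<lambda>\<epsilon> z v. \<phi> \<epsilon> (fst z) (snd z) v)"
proof
  show "V \<noteq> {}" by (rule V_nonempty)
  fix z :: "real \<times> 'a" assume "z \<in> {0..} \<times> UNIV"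
  have "\<bar>\<phi> \<epsilon> (fst z') (snd z') v\<bar> \<le> B0 + C * (fst z + 1)"
    if "0 < \<epsilon>" "z' \<in> {0..} \<times> UNIV" "v \<in> V" "dist z' z < 1" for \<epsilon> z' v
  proof -
    have "\<bar>fst z' - fst z\<bar> < 1" using dist_fst_le[of z' z] that(4) by (simp add: dist_real_def)
    then have "C * fst z' \<le> C * (fst z + 1)" using C by (intro mult_left_mono) auto
    moreover have "\<bar>\<phi> \<epsilon> (fst z') (snd z') v - \<phi>0 (snd z')\<bar> \<le> C * fst z'"
      using bound[of \<epsilon> "fst z'" v "snd z'"] that by auto
    ultimately show ?thesis using B0[of "snd z'"] by linarith
  qed
  then show "\<exists>r>0. \<exists>B. \<forall>\<epsilon>>0. \<forall>z'\<in>{0..} \<times> UNIV. \<forall>v\<in>V. dist z' z < r \<longrightarrow> \<bar>\<phi> \<epsilon> (fst z') (snd z') v\<bar> \<le> B"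
    by (meson zero_less_one)
qed

end

text \<open>The kinetic equation enters the limit only through its form along characteristics.\<close>

locale kinetic_family = velocity_distribution M for M :: "'a::euclidean_space \<Rightarrow> real" +
  fixes \<phi> :: "real \<Rightarrow> real \<Rightarrow> 'a \<Rightarrow> 'a \<Rightarrow> real"
  assumes continuous: "\<And>\<epsilon>. 0 < \<epsilon> \<Longrightarrow> continuous_on ({0..} \<times> UNIV \<times> V) (\<lambda>(t, x, v). \<phi> \<epsilon> t x v)"
    and transport: "\<And>\<epsilon> t x v. 0 < \<epsilon> \<Longrightarrow> 0 < t \<Longrightarrow> v \<in> V \<Longrightarrow>
      ((\<lambda>s. \<phi> \<epsilon> s (x + (s - t) *\<^sub>R v) v) has_real_derivative jump \<epsilon> (\<phi> \<epsilon> t x) v) (at t)"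
    and relaxed: "relaxed_family ({0..} \<times> UNIV) V (\<lambda>\<epsilon> z v. \<phi> \<epsilon> (fst z) (snd z) v)"
begin

sublocale up: relaxed_family "{0..} \<times> UNIV" V "\<lambda>\<epsilon> z v. \<phi> \<epsilon> (fst z) (snd z) v"
  by (rule relaxed)

sublocale down: relaxed_family "{0..} \<times> UNIV" V "\<lambda>\<epsilon> z v. - \<phi> \<epsilon> (fst z) (snd z) v"
  by (rule relaxed_family_uminus[OF relaxed])

lemma continuous_pair: "0 < \<epsilon> \<Longrightarrow> continuous_on (({0..} \<times> UNIV) \<times> V) (\<lambda>(z, v). \<phi> \<epsilon> (fst z) (snd z) v)"
  unfolding case_prod_beta
  using continuous_on_compose2[OF continuous, of \<epsilon> "({0..} \<times> UNIV) \<times> V" "\<lambda>w. (fst (fst w), snd (fst w), snd w)"]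
  by (force intro!: continuous_intros)

text \<open>At a maximum of the profile \<open>g - \<epsilon> ln E\<close> over the velocities, the exponential in the jump term is bounded below
  by \<open>E v / E v'\<close>. The next lemma is the counterpart at a minimum.\<close>

lemma jump_le:
  assumes \<epsilon>: "0 < \<epsilon>" and g: "continuous_on V g" and E: "continuous_on V E" "\<And>v. v \<in> V \<Longrightarrow> 0 < E v"
    and max: "\<And>v'. v' \<in> V \<Longrightarrow> g v' - \<epsilon> * ln (E v') \<le> g v - \<epsilon> * ln (E v)" and v: "v \<in> V"
  shows "jump \<epsilon> g v \<le> 1 - E v * avg (\<lambda>v'. 1 / E v')"
proof -
  have "\<forall>v'\<in>V. E v' \<noteq> 0" using E(2) by (metis less_irrefl)
  then have c: "continuous_on V (\<lambda>v'. 1 / E v')" using E(1) by (intro continuous_intros)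
  have "jump \<epsilon> g v \<le> avg (\<lambda>v'. 1 - E v * (1 / E v'))" unfolding jump_def
  proof (rule avg_mono[OF jump_integrand_continuous[OF g]])
    fix v' assume v': "v' \<in> V"
    have "ln (E v) - ln (E v') \<le> (g v - g v') / \<epsilon>"
      using max[OF v'] \<epsilon> by (simp add: field_simps)
    then have "exp (ln (E v) - ln (E v')) \<le> exp ((g v - g v') / \<epsilon>)" by simp
    then show "1 - exp ((g v - g v') / \<epsilon>) \<le> 1 - E v * (1 / E v')"
      using E(2)[OF v] E(2)[OF v'] by (simp add: exp_diff)
  qed (intro continuous_intros c)
  also have "\<dots> = 1 - E v * avg (\<lambda>v'. 1 / E v')"
    using avg_diff[of "\<lambda>_. 1" "\<lambda>v'. E v * (1 / E v')"] continuous_on_mult_left[OF c, of "E v"]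
    by (simp only: avg_cmult avg_one continuous_on_const)
  finally show ?thesis .
qed

lemma jump_ge:
  assumes \<epsilon>: "0 < \<epsilon>" and g: "continuous_on V g" and E: "continuous_on V E" "\<And>v. v \<in> V \<Longrightarrow> 0 < E v"
    and min: "\<And>v'. v' \<in> V \<Longrightarrow> g v - \<epsilon> * ln (E v) \<le> g v' - \<epsilon> * ln (E v')" and v: "v \<in> V"
  shows "1 - E v * avg (\<lambda>v'. 1 / E v') \<le> jump \<epsilon> g v"
proof -
  have "\<forall>v'\<in>V. E v' \<noteq> 0" using E(2) by (metis less_irrefl)
  then have c: "continuous_on V (\<lambda>v'. 1 / E v')" using E(1) by (intro continuous_intros)
  have "1 - E v * avg (\<lambda>v'. 1 / E v') = avg (\<lambda>v'. 1 - E v * (1 / E v'))"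
    using avg_diff[of "\<lambda>_. 1" "\<lambda>v'. E v * (1 / E v')"] continuous_on_mult_left[OF c, of "E v"]
    by (simp only: avg_cmult avg_one continuous_on_const)
  also have "\<dots> \<le> jump \<epsilon> g v" unfolding jump_def
  proof (rule avg_mono[OF _ jump_integrand_continuous[OF g]])
    fix v' assume v': "v' \<in> V"
    have "(g v - g v') / \<epsilon> \<le> ln (E v) - ln (E v')"
      using min[OF v'] \<epsilon> by (simp add: field_simps)
    then have "exp ((g v - g v') / \<epsilon>) \<le> exp (ln (E v) - ln (E v'))" by simp
    then show "1 - E v * (1 / E v') \<le> 1 - exp ((g v - g v') / \<epsilon>)"
      using E(2)[OF v] E(2)[OF v'] by (simp add: exp_diff)
  qed (intro continuous_intros c)
  finally show ?thesis .
qed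

lemma norm_direction_le: "v \<in> V \<Longrightarrow> norm (1::real, v) \<le> 1 + speed"
  using norm_Pair_le[of "1::real" v] norm_le_speed[of v] by simp

text \<open>Shared by the two relaxed limits: on the ball of radius \<open>r\<close> the touching condition holds, and on the smaller one of
  radius \<open>d\<close> the errors made by replacing the derivative of the perturbed test function by that of \<open>\<psi>\<close> at the
  contact point are at most \<open>c\<close>, for all velocities at once.\<close>

lemma test_neighbourhood:
  fixes \<psi> :: "real \<times> 'a \<Rightarrow> real"
  assumes C1: "C1_on ({0<..} \<times> UNIV) \<psi> D" and t: "0 < t" and c: "0 < c"
    and ev: "\<forall>\<^sub>F z in nhds (t, x). P z"
  shows "\<exists>d r. 0 < d \<and> d < r \<and> cball (t, x) r \<subseteq> {0<..} \<times> UNIV \<and> continuous_on (cball (t, x) r) \<psi> \<and>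
    (\<forall>z\<in>cball (t, x) r. P z) \<and>
    (\<forall>z. \<forall>v\<in>V. dist z (t, x) < d \<longrightarrow>
        \<bar>(D z - D (t, x)) \<bullet> (1, v)\<bar> + 2 * \<bar>(z - (t, x)) \<bullet> (1, v)\<bar> \<le> c)"
proof -
  let ?O = "{0<..} \<times> UNIV :: (real \<times> 'a) set"
  have O: "open ?O" "(t, x) \<in> ?O" using t by (auto intro: open_Times)
  obtain r1 where r1: "r1 > 0" "cball (t, x) r1 \<subseteq> ?O" using O open_contains_cball by blast
  obtain r2 where r2: "r2 > 0" "\<And>z. dist z (t, x) < r2 \<Longrightarrow> P z" using ev unfolding eventually_nhds_metric by blast
  define r where "r = min r1 (r2 / 2)"
  have r: "r > 0" "cball (t, x) r \<subseteq> ?O" using r1 r2 by (auto simp: r_def)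
  define k where "k = 2 * (1 + speed)"
  define e where "e = c / k"
  have k: "k > 0" using speed_nonneg by (simp add: k_def)
  have e: "e > 0" using c k by (simp add: e_def)
  have "\<forall>x\<in>?O. \<forall>e>0. \<exists>d>0. \<forall>x'\<in>?O. dist x' x < d \<longrightarrow> dist (D x') (D x) < e"
    using C1 unfolding C1_on_def continuous_on_iff by blast
  from this[rule_format, OF O(2) e]
  obtain r3 where r3: "r3 > 0" "\<And>z. z \<in> ?O \<Longrightarrow> dist z (t, x) < r3 \<Longrightarrow> dist (D z) (D (t, x)) < e"
    by blast
  define d where "d = min (r / 2) (min r3 (e / 2))"
  have d: "0 < d" using r(1) r3(1) e unfolding d_def by (simp only: min_less_iff_conj half_gt_zero simp_thms)
  have dr: "d < r" using r(1) unfolding d_def by (intro min.strict_coboundedI1) simp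
  show ?thesis
  proof (intro exI conjI ballI allI impI)
    show "0 < d" "d < r" "cball (t, x) r \<subseteq> ?O" by fact+
    show "continuous_on (cball (t, x) r) \<psi>"
      by (rule continuous_at_imp_continuous_on)
         (use C1 r in \<open>auto simp: C1_on_def gderiv_def subset_eq intro!: has_derivative_continuous\<close>)
    show "P z" if "z \<in> cball (t, x) r" for z
      using that r2 by (intro r2(2)) (auto simp: r_def dist_commute)
    fix z v assume v: "v \<in> V" and z: "dist z (t, x) < d"
    have "z \<in> ?O" using z dr r(2) by (auto simp: dist_commute subset_eq)
    then have 1: "norm (D z - D (t, x)) \<le> e" using r3(2)[of z] z by (simp add: d_def dist_norm)
    have 2: "2 * norm (z - (t, x)) \<le> e" using z by (simp add: d_def dist_norm)
    have "\<bar>(D z - D (t, x)) \<bullet> (1, v)\<bar> + 2 * \<bar>(z - (t, x)) \<bullet> (1, v)\<bar>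
        \<le> norm (D z - D (t, x)) * norm (1::real, v) + 2 * (norm (z - (t, x)) * norm (1::real, v))"
      by (intro add_mono mult_left_mono Cauchy_Schwarz_ineq2) auto
    also have "\<dots> = (norm (D z - D (t, x)) + 2 * norm (z - (t, x))) * norm (1::real, v)"
      by (simp add: algebra_simps)
    also have "\<dots> \<le> (e + e) * (1 + speed)"
      using 1 2 norm_direction_le[OF v] e by (intro mult_mono add_mono) auto
    also have "\<dots> = e * k" by (simp add: k_def algebra_simps)
    also have "\<dots> = c" using k by (simp add: e_def)
    finally show "\<bar>(D z - D (t, x)) \<bullet> (1, v)\<bar> + 2 * \<bar>(z - (t, x)) \<bullet> (1, v)\<bar> \<le> c" .
  qed
qed

text \<open>It suffices to prove \<open>a + h \<le> 0\<close> for the time derivative \<open>a\<close>, the momentum \<open>p\<close> and every \<open>h < H p\<close>. The profile of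
  \<open>below_hamiltonian\<close> serves as the corrector: with \<open>E = 1 / Q\<close>, the jump term at the maximum point is
  at most \<open>1 - E v * avg (1 / E) \<le> 1 - E v \<le> v \<bullet> p - h\<close>, and it equals \<open>a + v \<bullet> p\<close> up to a small error.\<close>

lemma upper_limit_subsolution: "viscosity_subsolution (hamiltonian M) (\<lambda>t x. up.upper_limit (t, x))"
  unfolding viscosity_subsolution_def
proof (intro allI impI, elim conjE)
  fix \<psi> D t x
  assume C1: "C1_on ({0<..} \<times> UNIV) \<psi> D" and t: "0 < t"
    and ev: "\<forall>\<^sub>F (s, y) in nhds (t, x). up.upper_limit (s, y) - \<psi> (s, y) \<le> up.upper_limit (t, x) - \<psi> (t, x)"
  have ev': "\<forall>\<^sub>F z in nhds (t, x). up.upper_limit z - \<psi> z \<le> up.upper_limit (t, x) - \<psi> (t, x)"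
    using ev by eventually_elim auto
  define a p where "a = fst (D (t, x))" and "p = snd (D (t, x))"
  have Dtx: "D (t, x) = (a, p)" by (simp add: a_def p_def)
  have key: "a + h \<le> c" if h: "h < hamiltonian M p" and c: "0 < c" for h c
  proof -
    obtain \<delta> where \<delta>: "\<delta> > 0" "1 \<le> avg (\<lambda>v. 1 / max (1 + h - v \<bullet> p) \<delta>)" using below_hamiltonian[OF h] by blast
    define E where "E v = max (1 + h - v \<bullet> p) \<delta>" for v
    have E: "continuous_on V E" "\<And>v. v \<in> V \<Longrightarrow> 0 < E v" using \<delta> by (auto simp: E_def less_max_iff_disj intro!: continuous_intros)
    have \<eta>: "continuous_on V (\<lambda>v. ln (E v))" using E by (intro continuous_on_ln) (metis less_irrefl)+
    obtain d r where rd: "0 < d" "d < r" "cball (t, x) r \<subseteq> {0<..} \<times> UNIV" "continuous_on (cball (t, x) r) \<psi>"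
      "\<forall>z\<in>cball (t, x) r. up.upper_limit z - \<psi> z \<le> up.upper_limit (t, x) - \<psi> (t, x)"
      "\<forall>z. \<forall>v\<in>V. dist z (t, x) < d \<longrightarrow>
          \<bar>(D z - D (t, x)) \<bullet> (1, v)\<bar> + 2 * \<bar>(z - (t, x)) \<bullet> (1, v)\<bar> \<le> c"
      using test_neighbourhood[OF C1 t c ev'] by (elim exE conjE)
    have rS: "cball (t, x) r \<subseteq> {0..} \<times> UNIV" using rd(3) by force
    obtain \<epsilon> z v where z: "0 < \<epsilon>" "dist z (t, x) < d" "v \<in> V"
      and max: "\<And>z' v'. z' \<in> cball (t, x) r \<Longrightarrow> v' \<in> V \<Longrightarrow>
        \<phi> \<epsilon> (fst z') (snd z') v' - \<psi> z' - (dist z' (t, x))\<^sup>2 - \<epsilon> * ln (E v')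
          \<le> \<phi> \<epsilon> (fst z) (snd z) v - \<psi> z - (dist z (t, x))\<^sup>2 - \<epsilon> * ln (E v)"
      using up.perturbed_maximum[OF compact_support continuous_pair rS rd(4) \<eta> rd(5)[rule_format] rd(1,2)] by metis
    obtain s y where sy: "z = (s, y)" by (cases z)
    have zin: "z \<in> cball (t, x) r" using z rd by (simp add: dist_commute)
    then have s: "0 < s" using rd(3) by (auto simp: sy)
    have "jump \<epsilon> (\<phi> \<epsilon> s y) v = (D (s, y) + 2 *\<^sub>R ((s, y) - (t, x))) \<bullet> (1, v)"
    proof (rule characteristic_maximum[where f = "\<lambda>z. \<phi> \<epsilon> (fst z) (snd z) v" and \<theta> = \<psi> and e = "r - dist (s, y) (t, x)"])
      show "((\<lambda>\<tau>. \<phi> \<epsilon> (fst (\<tau>, y + (\<tau> - s) *\<^sub>R v)) (snd (\<tau>, y + (\<tau> - s) *\<^sub>R v)) v) has_real_derivative jump \<epsilon> (\<phi> \<epsilon> s y) v) (at s)"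
        using transport[OF z(1) s z(3)] by simp
      show "GDERIV \<psi> (s, y) :> D (s, y)" using C1 s by (auto simp: C1_on_def)
      show "0 < r - dist (s, y) (t, x)" using z rd by (simp add: sy)
      fix z' assume "dist z' (s, y) < r - dist (s, y) (t, x)"
      then have "z' \<in> cball (t, x) r" using dist_triangle[of z' "(t, x)" "(s, y)"] by (simp add: dist_commute)
      from max[OF this z(3)]
      show "\<phi> \<epsilon> (fst z') (snd z') v - \<psi> z' - (dist z' (t, x))\<^sup>2
          \<le> \<phi> \<epsilon> (fst (s, y)) (snd (s, y)) v - \<psi> (s, y) - (dist (s, y) (t, x))\<^sup>2" by (simp add: sy)
    qed
    moreover have "jump \<epsilon> (\<phi> \<epsilon> s y) v \<le> 1 - E v * avg (\<lambda>v'. 1 / E v')"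
    proof (rule jump_le[OF z(1) profile_continuous[OF continuous[OF z(1)]] E _ z(3)])
      fix v' assume "v' \<in> V"
      from max[OF zin this] show "\<phi> \<epsilon> s y v' - \<epsilon> * ln (E v') \<le> \<phi> \<epsilon> s y v - \<epsilon> * ln (E v)" by (simp add: sy)
    qed (use s in auto)
    moreover have "E v * 1 \<le> E v * avg (\<lambda>v'. 1 / E v')"
      using \<delta>(2) E(2)[OF z(3)] unfolding E_def by (intro mult_left_mono) auto
    moreover have "1 + h - v \<bullet> p \<le> E v" by (simp add: E_def)
    moreover have "D (t, x) \<bullet> (1, v) = a + v \<bullet> p" by (simp add: Dtx inner_commute)
    moreover have "(D (s, y) + 2 *\<^sub>R ((s, y) - (t, x))) \<bullet> (1, v)
        = (D z - D (t, x)) \<bullet> (1, v) + 2 * ((z - (t, x)) \<bullet> (1, v)) + D (t, x) \<bullet> (1, v)"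
      unfolding sy by (simp only: inner_add_left inner_diff_left inner_scaleR_left)
    moreover have "- c \<le> (D z - D (t, x)) \<bullet> (1, v) + 2 * ((z - (t, x)) \<bullet> (1, v))"
      using rd(6)[rule_format, OF z(3,2)] by linarith
    ultimately show "a + h \<le> c" by linarith
  qed
  show "fst (D (t, x)) + hamiltonian M (snd (D (t, x))) \<le> 0"
  proof (rule field_le_epsilon)
    fix e :: real assume "0 < e"
    then show "fst (D (t, x)) + hamiltonian M (snd (D (t, x))) \<le> 0 + e"
      using key[of "hamiltonian M p - e / 2" "e / 2"] by (simp add: a_def p_def)
  qed
qed

text \<open>Here \<open>h > H p\<close>, and the exact profile of \<open>above_hamiltonian\<close> yields
  \<open>1 - E v * avg (1 / E) \<ge> 1 - E v = v \<bullet> p - h\<close> at a minimum point.\<close>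

lemma lower_limit_supersolution: "viscosity_supersolution (hamiltonian M) (\<lambda>t x. - down.upper_limit (t, x))"
  unfolding viscosity_supersolution_def
proof (intro allI impI, elim conjE)
  fix \<psi> D t x
  assume C1: "C1_on ({0<..} \<times> UNIV) \<psi> D" and t: "0 < t"
    and ev: "\<forall>\<^sub>F (s, y) in nhds (t, x). - down.upper_limit (t, x) - \<psi> (t, x) \<le> - down.upper_limit (s, y) - \<psi> (s, y)"
  have ev': "\<forall>\<^sub>F z in nhds (t, x). down.upper_limit z - (- \<psi> z) \<le> down.upper_limit (t, x) - (- \<psi> (t, x))"
    using ev by eventually_elim auto
  define a p where "a = fst (D (t, x))" and "p = snd (D (t, x))"
  have Dtx: "D (t, x) = (a, p)" by (simp add: a_def p_def)
  have key: "- c \<le> a + h" if h: "hamiltonian M p < h" and c: "0 < c" for h c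
  proof -
    define E where "E v = 1 + h - v \<bullet> p" for v
    have avgE: "avg (\<lambda>v. 1 / E v) \<le> 1" using above_hamiltonian(2)[OF h] by (simp add: E_def)
    have E: "continuous_on V E" "\<And>v. v \<in> V \<Longrightarrow> 0 < E v"
      using above_hamiltonian(1)[OF h] mu_upper[of _ p] by (force simp: E_def intro!: continuous_intros)+
    have \<eta>: "continuous_on V (\<lambda>v. - ln (E v))" using E by (intro continuous_on_minus continuous_on_ln) (metis less_irrefl)+
    obtain d r where rd: "0 < d" "d < r" "cball (t, x) r \<subseteq> {0<..} \<times> UNIV" "continuous_on (cball (t, x) r) \<psi>"
      "\<forall>z\<in>cball (t, x) r. down.upper_limit z - (- \<psi> z) \<le> down.upper_limit (t, x) - (- \<psi> (t, x))"
      "\<forall>z. \<forall>v\<in>V. dist z (t, x) < d \<longrightarrow>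
          \<bar>(D z - D (t, x)) \<bullet> (1, v)\<bar> + 2 * \<bar>(z - (t, x)) \<bullet> (1, v)\<bar> \<le> c"
      using test_neighbourhood[OF C1 t c ev'] by (elim exE conjE)
    have rS: "cball (t, x) r \<subseteq> {0..} \<times> UNIV" using rd(3) by force
    have cont_m: "continuous_on (({0..} \<times> UNIV) \<times> V) (\<lambda>(z, v). - \<phi> \<epsilon> (fst z) (snd z) v)" if "0 < \<epsilon>" for \<epsilon>
      using continuous_on_minus[OF continuous_pair[OF that]] by (simp add: case_prod_beta)
    obtain \<epsilon> z v where z: "0 < \<epsilon>" "dist z (t, x) < d" "v \<in> V"
      and max: "\<And>z' v'. z' \<in> cball (t, x) r \<Longrightarrow> v' \<in> V \<Longrightarrow>
        - \<phi> \<epsilon> (fst z') (snd z') v' - (- \<psi> z') - (dist z' (t, x))\<^sup>2 - \<epsilon> * - ln (E v')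
          \<le> - \<phi> \<epsilon> (fst z) (snd z) v - (- \<psi> z) - (dist z (t, x))\<^sup>2 - \<epsilon> * - ln (E v)"
      using down.perturbed_maximum[OF compact_support cont_m rS continuous_on_minus[OF rd(4)] \<eta> rd(5)[rule_format] rd(1,2)] by metis
    obtain s y where sy: "z = (s, y)" by (cases z)
    have zin: "z \<in> cball (t, x) r" using z rd by (simp add: dist_commute)
    then have s: "0 < s" using rd(3) by (auto simp: sy)
    have "- jump \<epsilon> (\<phi> \<epsilon> s y) v = (- D (s, y) + 2 *\<^sub>R ((s, y) - (t, x))) \<bullet> (1, v)"
    proof (rule characteristic_maximum[where f = "\<lambda>z. - \<phi> \<epsilon> (fst z) (snd z) v" and \<theta> = "\<lambda>z. - \<psi> z" and e = "r - dist (s, y) (t, x)"])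
      show "((\<lambda>\<tau>. - \<phi> \<epsilon> (fst (\<tau>, y + (\<tau> - s) *\<^sub>R v)) (snd (\<tau>, y + (\<tau> - s) *\<^sub>R v)) v) has_real_derivative - jump \<epsilon> (\<phi> \<epsilon> s y) v) (at s)"
        using DERIV_minus[OF transport[OF z(1) s z(3)]] by simp
      show "GDERIV (\<lambda>z. - \<psi> z) (s, y) :> - D (s, y)" using C1 s by (auto simp: C1_on_def intro!: GDERIV_minus)
      show "0 < r - dist (s, y) (t, x)" using z rd by (simp add: sy)
      fix z' assume "dist z' (s, y) < r - dist (s, y) (t, x)"
      then have "z' \<in> cball (t, x) r" using dist_triangle[of z' "(t, x)" "(s, y)"] by (simp add: dist_commute)
      from max[OF this z(3)]
      show "- \<phi> \<epsilon> (fst z') (snd z') v - - \<psi> z' - (dist z' (t, x))\<^sup>2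
          \<le> - \<phi> \<epsilon> (fst (s, y)) (snd (s, y)) v - - \<psi> (s, y) - (dist (s, y) (t, x))\<^sup>2" by (simp add: sy)
    qed
    moreover have "1 - E v * avg (\<lambda>v'. 1 / E v') \<le> jump \<epsilon> (\<phi> \<epsilon> s y) v"
    proof (rule jump_ge[OF z(1) profile_continuous[OF continuous[OF z(1)]] E _ z(3)])
      fix v' assume "v' \<in> V"
      from max[OF zin this] show "\<phi> \<epsilon> s y v - \<epsilon> * ln (E v) \<le> \<phi> \<epsilon> s y v' - \<epsilon> * ln (E v')" by (simp add: sy)
    qed (use s in auto)
    moreover have "E v * avg (\<lambda>v'. 1 / E v') \<le> E v * 1"
      using avgE E(2)[OF z(3)] by (intro mult_left_mono) auto
    moreover have "E v = 1 + h - v \<bullet> p" by (simp add: E_def)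
    moreover have "D (t, x) \<bullet> (1, v) = a + v \<bullet> p" by (simp add: Dtx inner_commute)
    moreover have "(- D (s, y) + 2 *\<^sub>R ((s, y) - (t, x))) \<bullet> (1, v)
        = - ((D z - D (t, x)) \<bullet> (1, v)) + 2 * ((z - (t, x)) \<bullet> (1, v)) - D (t, x) \<bullet> (1, v)"
      unfolding sy by (simp only: inner_add_left inner_diff_left inner_minus_left inner_scaleR_left)
    moreover have "- c \<le> - ((D z - D (t, x)) \<bullet> (1, v)) + 2 * ((z - (t, x)) \<bullet> (1, v))"
      "- ((D z - D (t, x)) \<bullet> (1, v)) + 2 * ((z - (t, x)) \<bullet> (1, v)) \<le> c"
      using rd(6)[rule_format, OF z(3,2)] by linarith+
    ultimately show "- c \<le> a + h" by linarith
  qed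
  show "0 \<le> fst (D (t, x)) + hamiltonian M (snd (D (t, x)))"
  proof (rule field_le_epsilon)
    fix e :: real assume "0 < e"
    then show "0 \<le> fst (D (t, x)) + hamiltonian M (snd (D (t, x))) + e"
      using key[of "hamiltonian M p + e / 2" "e / 2"] by (simp add: a_def p_def)
  qed
qed

lemma lower_le_upper:
  assumes "0 \<le> t"
  shows "- down.upper_limit (t, x) \<le> up.upper_limit (t, x)"
proof (rule field_le_epsilon)
  fix e :: real assume e: "0 < e"
  have S: "(t, x) \<in> {0..} \<times> UNIV" using assms by simp
  have "up.nearly_le (t, x) (up.upper_limit (t, x) + e / 2)"
    using up.upper_limit_less[OF S] e by simp
  then obtain r1 where r1: "r1 > 0" "\<And>\<epsilon> z v. 0 < \<epsilon> \<Longrightarrow> \<epsilon> < r1 \<Longrightarrow> z \<in> {0..} \<times> UNIV \<Longrightarrow>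
      dist z (t, x) < r1 \<Longrightarrow> v \<in> V \<Longrightarrow> \<phi> \<epsilon> (fst z) (snd z) v \<le> up.upper_limit (t, x) + e / 2"
    unfolding up.nearly_le_def by blast
  have "down.nearly_le (t, x) (down.upper_limit (t, x) + e / 2)"
    using down.upper_limit_less[OF S] e by simp
  then obtain r2 where r2: "r2 > 0" "\<And>\<epsilon> z v. 0 < \<epsilon> \<Longrightarrow> \<epsilon> < r2 \<Longrightarrow> z \<in> {0..} \<times> UNIV \<Longrightarrow>
      dist z (t, x) < r2 \<Longrightarrow> v \<in> V \<Longrightarrow> - \<phi> \<epsilon> (fst z) (snd z) v \<le> down.upper_limit (t, x) + e / 2"
    unfolding down.nearly_le_def by blast
  obtain v where v: "v \<in> V" using V_nonempty by blast
  have "\<phi> (min r1 r2 / 2) t x v \<le> up.upper_limit (t, x) + e / 2"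
    "- \<phi> (min r1 r2 / 2) t x v \<le> down.upper_limit (t, x) + e / 2"
    using r1(1) r2(1) r1(2)[of "min r1 r2 / 2" "(t, x)" v] r2(2)[of "min r1 r2 / 2" "(t, x)" v] S v by auto
  then show "- down.upper_limit (t, x) \<le> up.upper_limit (t, x) + e" by linarith
qed

text \<open>If the relaxed limits agree, their common value is both upper and lower semicontinuous, and near each point
  the functions are eventually squeezed between two values close to it; compactness makes this uniform.\<close>

lemma locally_uniform_limit:
  assumes eq: "\<And>t x. 0 \<le> t \<Longrightarrow> up.upper_limit (t, x) = - down.upper_limit (t, x)"
  shows "continuous_on ({0..} \<times> UNIV) (\<lambda>(t, x). up.upper_limit (t, x))"
    and "compact K \<Longrightarrow> K \<subseteq> {0..} \<times> UNIV \<times> V \<Longrightarrow>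
       uniform_limit K (\<lambda>\<epsilon> (t, x, v). \<phi> \<epsilon> t x v) (\<lambda>(t, x, v). up.upper_limit (t, x)) (at_right 0)"
proof -
  let ?S = "{0..} \<times> UNIV :: (real \<times> 'a) set"
  let ?u = up.upper_limit
  have eq': "down.upper_limit z = - ?u z" if "z \<in> ?S" for z using eq[of "fst z" "snd z"] that by auto
  have cont: "continuous_on ?S ?u"
    unfolding continuous_on_def order_tendsto_iff
  proof (intro ballI conjI allI impI)
    fix z c assume z: "z \<in> ?S"
    show "\<forall>\<^sub>F z' in at z within ?S. ?u z' < c" if "?u z < c"
      by (rule up.upper_limit_usc[OF z that])
    assume c: "c < ?u z"
    have "\<forall>\<^sub>F z' in at z within ?S. down.upper_limit z' < - c"
      by (rule down.upper_limit_usc[OF z]) (use c eq'[OF z] in simp)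
    moreover have "\<forall>\<^sub>F z' in at z within ?S. z' \<in> ?S" by (simp add: eventually_at_filter)
    ultimately show "\<forall>\<^sub>F z' in at z within ?S. c < ?u z'"
      by eventually_elim (use eq' in fastforce)
  qed
  then show "continuous_on ?S (\<lambda>(t, x). ?u (t, x))" by simp
  assume K: "compact K" "K \<subseteq> {0..} \<times> UNIV \<times> V"
  define A where "A = (\<lambda>k. (fst k, fst (snd k))) ` K"
  have A: "compact A" unfolding A_def by (intro compact_continuous_image K continuous_intros)
  have AS: "A \<subseteq> ?S" using K by (auto simp: A_def)
  show "uniform_limit K (\<lambda>\<epsilon> (t, x, v). \<phi> \<epsilon> t x v) (\<lambda>(t, x, v). ?u (t, x)) (at_right 0)"
  proof (rule uniform_limitI)
    fix e :: real assume e: "0 < e"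
    have "\<exists>\<rho>>0. \<forall>\<epsilon> z'. 0 < \<epsilon> \<and> \<epsilon> < \<rho> \<and> z' \<in> A \<longrightarrow> (\<forall>v\<in>V. \<bar>\<phi> \<epsilon> (fst z') (snd z') v - ?u z'\<bar> < e)"
    proof (rule compact_uniform_smallness[OF A])
      fix z assume "z \<in> A"
      then have z: "z \<in> ?S" using AS by blast
      obtain r1 where r1: "r1 > 0" "\<And>\<epsilon> z' v. 0 < \<epsilon> \<Longrightarrow> \<epsilon> < r1 \<Longrightarrow> z' \<in> ?S \<Longrightarrow> dist z' z < r1 \<Longrightarrow> v \<in> V \<Longrightarrow>
          \<phi> \<epsilon> (fst z') (snd z') v \<le> ?u z + e / 3"
        using up.upper_limit_less[OF z, of "?u z + e / 3"] e unfolding up.nearly_le_def by auto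
      obtain r2 where r2: "r2 > 0" "\<And>\<epsilon> z' v. 0 < \<epsilon> \<Longrightarrow> \<epsilon> < r2 \<Longrightarrow> z' \<in> ?S \<Longrightarrow> dist z' z < r2 \<Longrightarrow> v \<in> V \<Longrightarrow>
          - \<phi> \<epsilon> (fst z') (snd z') v \<le> - ?u z + e / 3"
        using down.upper_limit_less[OF z, of "- ?u z + e / 3"] e eq'[OF z] unfolding down.nearly_le_def by auto
      have e3: "0 < e / 3" using e by simp
      have "\<forall>x\<in>?S. \<forall>e>0. \<exists>d>0. \<forall>x'\<in>?S. dist x' x < d \<longrightarrow> dist (?u x') (?u x) < e"
        using cont unfolding continuous_on_iff .
      then obtain r3 where r3: "r3 > 0" "\<And>z'. z' \<in> ?S \<Longrightarrow> dist z' z < r3 \<Longrightarrow> dist (?u z') (?u z) < e / 3"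
        using z e3 by blast
      have "\<bar>\<phi> \<epsilon> (fst z') (snd z') v - ?u z'\<bar> < e"
        if a: "0 < \<epsilon>" "\<epsilon> < min r1 (min r2 r3)" "z' \<in> A" "dist z' z < min r1 (min r2 r3)" "v \<in> V" for \<epsilon> z' v
      proof -
        have z': "z' \<in> ?S" using a(3) AS by blast
        have "\<phi> \<epsilon> (fst z') (snd z') v \<le> ?u z + e / 3" using r1(2)[OF _ _ z'] a by simp
        moreover have "- \<phi> \<epsilon> (fst z') (snd z') v \<le> - ?u z + e / 3" using r2(2)[OF _ _ z'] a by simp
        moreover have "\<bar>?u z' - ?u z\<bar> < e / 3" using r3(2)[OF z'] a by (simp add: dist_real_def)
        ultimately show ?thesis by linarith
      qed
      then show "\<exists>\<rho>>0. \<forall>\<epsilon> z'. 0 < \<epsilon> \<and> \<epsilon> < \<rho> \<and> z' \<in> A \<and> dist z' z < \<rho> \<longrightarrow> (\<forall>v\<in>V. \<bar>\<phi> \<epsilon> (fst z') (snd z') v - ?u z'\<bar> < e)"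
        using r1(1) r2(1) r3(1) by (intro exI[of _ "min r1 (min r2 r3)"]) auto
    qed
    then obtain \<rho> where \<rho>: "\<rho> > 0"
      "\<And>\<epsilon> z' v. 0 < \<epsilon> \<Longrightarrow> \<epsilon> < \<rho> \<Longrightarrow> z' \<in> A \<Longrightarrow> v \<in> V \<Longrightarrow> \<bar>\<phi> \<epsilon> (fst z') (snd z') v - ?u z'\<bar> < e"
      by blast
    have "\<forall>\<^sub>F \<epsilon> in at_right 0. 0 < \<epsilon> \<and> \<epsilon> < \<rho>"
      using \<rho>(1) eventually_at_right_real by fastforce
    then show "\<forall>\<^sub>F \<epsilon> in at_right 0. \<forall>k\<in>K. dist (case k of (t, x, v) \<Rightarrow> \<phi> \<epsilon> t x v) (case k of (t, x, v) \<Rightarrow> ?u (t, x)) < e"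
    proof eventually_elim
      case (elim \<epsilon>)
      show ?case
      proof
        fix k assume k: "k \<in> K"
        obtain t x v where kk: "k = (t, x, v)" by (cases k)
        have "(t, x) \<in> A" "v \<in> V" using k K by (force simp: A_def kk)+
        then show "dist (case k of (t, x, v) \<Rightarrow> \<phi> \<epsilon> t x v) (case k of (t, x, v) \<Rightarrow> ?u (t, x)) < e"
          using \<rho>(2)[of \<epsilon> "(t, x)" v] elim by (simp add: kk dist_real_def)
      qed
    qed
  qed
qed

end

section \<open>Convergence to the viscosity solution\<close>

theorem theorem1p1:
  fixes M :: "'a::euclidean_space \<Rightarrow> real"
    and \<phi>0 :: "'a \<Rightarrow> real"
    and \<phi>eps :: "real \<Rightarrow> real \<Rightarrow> 'a \<Rightarrow> 'a \<Rightarrow> real"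
  assumes M: "prob_density M"
    and V_compact: "compact (ess_support M)"
    and zero_interior: "0 \<in> interior (convex hull (ess_support M))"
    and \<phi>0: "W1inf_on UNIV \<phi>0"
    and \<phi>eps: "\<And>\<epsilon>. \<epsilon> > 0 \<Longrightarrow> kinetic_solution M \<epsilon> \<phi>0 (\<phi>eps \<epsilon>)"
  shows "(\<forall>p. p \<notin> Sing M \<longrightarrow>
            (\<exists>!h. h \<ge> mu M p - 1 \<and> resolvent_integral M p (1 + h) = 1)) \<and>
         (\<exists>\<phi> :: real \<Rightarrow> 'a \<Rightarrow> real.
            (\<forall>K. compact K \<and> K \<subseteq> {0..} \<times> UNIV \<times> ess_support M \<longrightarrow>
               uniform_limit K (\<lambda>\<epsilon> (t, x, v). \<phi>eps \<epsilon> t x v) (\<lambda>(t, x, v). \<phi> t x) (at_right 0)) \<and>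
            viscosity_solution (hamiltonian M) \<phi>0 \<phi> \<and>
            (\<forall>w. viscosity_solution (hamiltonian M) \<phi>0 w \<longrightarrow> (\<forall>t\<ge>0. \<forall>x. w t x = \<phi> t x)))"
proof -
  interpret velocity_distribution M using M V_compact by unfold_locales
  obtain g where g: "continuous_on UNIV g" "W1inf g" "\<forall>z\<in>UNIV. \<phi>0 z = g z"
    using \<phi>0 unfolding W1inf_on_def by blast
  then have "\<phi>0 = g" by auto
  then obtain B0 L0 where BL: "\<And>x. \<bar>\<phi>0 x\<bar> \<le> B0" "0 \<le> L0" "\<And>x y. \<bar>\<phi>0 x - \<phi>0 y\<bar> \<le> L0 * norm (x - y)"
    using W1inf_bounded_lipschitz[OF g(1,2)] by metis
  define C where "C = 1 + L0 * speed"
  have C: "0 \<le> C" using BL(2) speed_nonneg by (simp add: C_def)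
  have bound: "\<bar>\<phi>eps \<epsilon> t x v - \<phi>0 x\<bar> \<le> C * t" if "0 < \<epsilon>" "0 \<le> t" "v \<in> V" for \<epsilon> t x v
    unfolding C_def by (rule kinetic_bounds[OF \<phi>eps[OF that(1)] that(1) BL(1,3,2) that(2,3)])
  interpret kinetic_family M \<phi>eps
  proof (intro kinetic_family.intro kinetic_family_axioms.intro)
    show "velocity_distribution M" by (rule velocity_distribution_axioms)
    show "continuous_on ({0..} \<times> UNIV \<times> V) (\<lambda>(t, x, v). \<phi>eps \<epsilon> t x v)" if "0 < \<epsilon>" for \<epsilon>
      by (rule kinetic_continuous[OF \<phi>eps[OF that]])
    show "((\<lambda>s. \<phi>eps \<epsilon> s (x + (s - t) *\<^sub>R v) v) has_real_derivative jump \<epsilon> (\<phi>eps \<epsilon> t x) v) (at t)"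
      if "0 < \<epsilon>" "0 < t" "v \<in> V" for \<epsilon> t x v
      by (rule kinetic_derivative[OF \<phi>eps[OF that(1)] that(2,3)])
    show "relaxed_family ({0..} \<times> UNIV) V (\<lambda>\<epsilon> z v. \<phi>eps \<epsilon> (fst z) (snd z) v)"
      by (rule kinetic_relaxed_family[OF bound BL(1) C])
  qed
  let ?u = "\<lambda>t x. up.upper_limit (t, x)" and ?l = "\<lambda>t x. - down.upper_limit (t, x)"
  let ?S = "{0..} \<times> UNIV :: (real \<times> 'a) set"
  \<comment> \<open>The bound by \<open>C t\<close> passes to both relaxed limits; the Lipschitz constants of \<open>\<phi>0\<close> and of \<open>C t\<close> account for
    the change of base point.\<close>
  have near: "\<exists>r>0. \<forall>z'\<in>?S. \<forall>\<epsilon>>0. \<forall>v\<in>V. dist z' (t, x) < r \<longrightarrow> \<bar>\<phi>eps \<epsilon> (fst z') (snd z') v - \<phi>0 x\<bar> \<le> C * t + e"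
    if "0 \<le> t" "0 < e" for t x e
  proof -
    define r where "r = e / (C + L0 + 1)"
    have den: "C + L0 + 1 > 0" using C BL by simp
    have r: "r > 0" using that den by (simp add: r_def)
    have "\<bar>\<phi>eps \<epsilon> (fst z') (snd z') v - \<phi>0 x\<bar> \<le> C * t + e"
      if z': "z' \<in> ?S" "0 < \<epsilon>" "v \<in> V" "dist z' (t, x) < r" for z' \<epsilon> v
    proof -
      have "\<bar>\<phi>eps \<epsilon> (fst z') (snd z') v - \<phi>0 (snd z')\<bar> \<le> C * fst z'"
        using bound[of \<epsilon> "fst z'" v "snd z'"] z' by auto
      moreover have "\<bar>\<phi>0 (snd z') - \<phi>0 x\<bar> \<le> L0 * r"
      proof -
        have "norm (snd z' - x) \<le> r" using dist_snd_le[of z' "(t, x)"] z' by (simp add: dist_norm)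
        then show ?thesis using BL(3)[of "snd z'" x] mult_left_mono[OF _ BL(2)] order_trans by blast
      qed
      moreover have "C * fst z' \<le> C * (t + r)"
      proof (rule mult_left_mono[OF _ C])
        have "\<bar>fst z' - t\<bar> < r" using dist_fst_le[of z' "(t, x)"] z' by (simp add: dist_real_def)
        then show "fst z' \<le> t + r" by linarith
      qed
      ultimately have "\<bar>\<phi>eps \<epsilon> (fst z') (snd z') v - \<phi>0 x\<bar> \<le> C * (t + r) + L0 * r" by linarith
      also have "\<dots> = C * t + (C + L0 + 1) * r - r" by (simp add: algebra_simps)
      also have "(C + L0 + 1) * r = e" using den by (simp add: r_def)
      finally show ?thesis using r by simp
    qed
    then show ?thesis using r by blast
  qed
  have u_le: "?u t x \<le> \<phi>0 x + C * t" if t: "0 \<le> t" for t x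
  proof (rule field_le_epsilon)
    fix e :: real assume "0 < e"
    from near[OF t this, of x] obtain r where r: "r > 0"
      "\<And>z' \<epsilon> v. z' \<in> ?S \<Longrightarrow> 0 < \<epsilon> \<Longrightarrow> v \<in> V \<Longrightarrow> dist z' (t, x) < r \<Longrightarrow> \<bar>\<phi>eps \<epsilon> (fst z') (snd z') v - \<phi>0 x\<bar> \<le> C * t + e" by blast
    have "up.nearly_le (t, x) (\<phi>0 x + C * t + e)" unfolding up.nearly_le_def
      using r by (intro exI[of _ r]) (fastforce simp: abs_le_iff)
    then show "?u t x \<le> \<phi>0 x + C * t + e" using up.upper_limit_le t by auto
  qed
  have l_ge: "\<phi>0 x - C * t \<le> ?l t x" if t: "0 \<le> t" for t x
  proof (rule field_le_epsilon)
    fix e :: real assume "0 < e"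
    from near[OF t this, of x] obtain r where r: "r > 0"
      "\<And>z' \<epsilon> v. z' \<in> ?S \<Longrightarrow> 0 < \<epsilon> \<Longrightarrow> v \<in> V \<Longrightarrow> dist z' (t, x) < r \<Longrightarrow> \<bar>\<phi>eps \<epsilon> (fst z') (snd z') v - \<phi>0 x\<bar> \<le> C * t + e" by blast
    have "down.nearly_le (t, x) (- \<phi>0 x + C * t + e)" unfolding down.nearly_le_def
      using r by (intro exI[of _ r]) (fastforce simp: abs_le_iff)
    then have "down.upper_limit (t, x) \<le> - \<phi>0 x + C * t + e" using down.upper_limit_le t by auto
    then show "\<phi>0 x - C * t \<le> ?l t x + e" by simp
  qed
  note H = hamiltonian_lipschitz and R = speed_nonneg
  have u_usc: "\<forall>\<^sub>F z' in at z within ?S. (\<lambda>(t, x). ?u t x) z' < c"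
    if "z \<in> ?S" "(\<lambda>(t, x). ?u t x) z < c" for z c
    using up.upper_limit_usc[of z c] that by simp
  have l_lsc: "\<forall>\<^sub>F z' in at z within ?S. c < (\<lambda>(t, x). ?l t x) z'"
    if "z \<in> ?S" "c < (\<lambda>(t, x). ?l t x) z" for z c
  proof -
    have "\<forall>\<^sub>F z' in at z within ?S. down.upper_limit z' < - c"
      using that by (intro down.upper_limit_usc) auto
    then show ?thesis by eventually_elim auto
  qed
  have strip: "\<exists>B. \<forall>t\<in>{0..T}. \<forall>x. ?u t x \<le> B \<and> - B \<le> ?l t x \<and> - B \<le> ?u t x" if "0 < T" for T
  proof (intro exI[of _ "B0 + C * T"] ballI allI)
    fix t x assume t: "t \<in> {0..T}"
    then have "C * t \<le> C * T" using C by (intro mult_left_mono) auto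
    then show "?u t x \<le> B0 + C * T \<and> - (B0 + C * T) \<le> ?l t x \<and> - (B0 + C * T) \<le> ?u t x"
      using u_le[of t x] l_ge[of t x] lower_le_upper[of t x] BL(1)[of x] t by auto
  qed
  have eq: "?u t x = ?l t x" if t: "0 \<le> t" for t x
  proof (rule antisym)
    show "?l t x \<le> ?u t x" by (rule lower_le_upper[OF t])
    show "?u t x \<le> ?l t x"
    proof (rule HJ_comparison[OF H R upper_limit_subsolution lower_limit_supersolution u_usc l_lsc _ _ t])
      show "\<exists>B. \<forall>t\<in>{0..T}. \<forall>x. ?u t x \<le> B \<and> - B \<le> ?l t x" if "0 < T" for T using strip[OF that] by blast
      show "?u 0 x \<le> ?l 0 x" for x using u_le[of 0 x] l_ge[of 0 x] by simp
    qed
  qed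
  note conv = locally_uniform_limit[OF eq]
  have u0: "?u 0 x = \<phi>0 x" for x using u_le[of 0 x] l_ge[of 0 x] eq[of 0 x] by simp
  have visc: "viscosity_solution (hamiltonian M) \<phi>0 ?u"
    unfolding viscosity_solution_def
  proof (intro conjI allI impI)
    show "continuous_on ?S (\<lambda>(t, x). ?u t x)" by (rule conv(1))
    show "bounded ((\<lambda>(t, x). ?u t x) ` ({0..T} \<times> UNIV))" if "0 < T" for T
    proof -
      obtain B where "\<forall>t\<in>{0..T}. \<forall>x. ?u t x \<le> B \<and> - B \<le> ?u t x" using strip[OF \<open>0 < T\<close>] by blast
      then show ?thesis unfolding bounded_iff by (intro exI[of _ B]) (auto simp: abs_le_iff minus_le_iff)
    qed
    show "viscosity_subsolution (hamiltonian M) ?u" by (rule upper_limit_subsolution)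
    show "viscosity_supersolution (hamiltonian M) ?u"
      unfolding viscosity_supersolution_def
    proof (intro allI impI, elim conjE)
      fix \<psi> D t x
      assume a: "C1_on ({0<..} \<times> UNIV) \<psi> D" "0 < t" and
        ev: "\<forall>\<^sub>F (s, y) in nhds (t, x). ?u t x - \<psi> (t, x) \<le> ?u s y - \<psi> (s, y)"
      have "\<forall>\<^sub>F z in nhds (t, x). z \<in> {0<..} \<times> UNIV"
        using a by (intro eventually_nhds_in_open open_Times) auto
      with ev have "\<forall>\<^sub>F (s, y) in nhds (t, x). ?l t x - \<psi> (t, x) \<le> ?l s y - \<psi> (s, y)"
        by eventually_elim (use eq a in force)
      then show "0 \<le> fst (D (t, x)) + hamiltonian M (snd (D (t, x)))"
        using lower_limit_supersolution a unfolding viscosity_supersolution_def by blast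
    qed
    show "?u 0 x = \<phi>0 x" for x by (rule u0)
  qed
  have unique: "w t x = ?u t x" if w: "viscosity_solution (hamiltonian M) \<phi>0 w" and t: "0 \<le> t" for w t x
  proof -
    have cont: "continuous_on ?S (\<lambda>(t, x). w t x)" and sub: "viscosity_subsolution (hamiltonian M) w"
      and super: "viscosity_supersolution (hamiltonian M) w" and w0: "\<And>x. w 0 x = \<phi>0 x"
      and bd: "\<And>T. 0 < T \<Longrightarrow> bounded ((\<lambda>(t, x). w t x) ` ({0..T} \<times> UNIV))"
      using w unfolding viscosity_solution_def by auto
    have semi: "\<forall>\<^sub>F z' in at z within ?S. (\<lambda>(t, x). w t x) z' < c" "\<forall>\<^sub>F z' in at z within ?S. c' < (\<lambda>(t, x). w t x) z'"
      if "z \<in> ?S" "(\<lambda>(t, x). w t x) z < c" "c' < (\<lambda>(t, x). w t x) z" for z c c'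
      using cont that unfolding continuous_on_def order_tendsto_iff by blast+
    have bds: "\<exists>B. \<forall>t\<in>{0..T}. \<forall>x. w t x \<le> B \<and> - B \<le> w t x" if T: "0 < T" for T
    proof -
      obtain B where "\<forall>y\<in>(\<lambda>(t, x). w t x) ` ({0..T} \<times> UNIV). norm y \<le> B" using bd[OF T] unfolding bounded_iff by blast
      then have "\<bar>w t x\<bar> \<le> B" if "t \<in> {0..T}" for t x using that by force
      then show ?thesis by (intro exI[of _ B]) (auto simp: abs_le_iff minus_le_iff)
    qed
    show ?thesis
    proof (rule antisym)
      have "w t x \<le> ?l t x"
      proof (rule HJ_comparison[OF H R sub lower_limit_supersolution _ l_lsc _ _ t])
        show "\<forall>\<^sub>F z' in at z within ?S. (\<lambda>(t, x). w t x) z' < c" if "z \<in> ?S" "(\<lambda>(t, x). w t x) z < c" for z c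
          using semi(1)[OF that, of "(\<lambda>(t, x). w t x) z - 1"] by simp
        show "\<exists>B. \<forall>t\<in>{0..T}. \<forall>x. w t x \<le> B \<and> - B \<le> ?l t x" if T: "0 < T" for T
        proof -
          obtain B1 where "\<forall>t\<in>{0..T}. \<forall>x. w t x \<le> B1" using bds[OF T] by blast
          moreover obtain B2 where "\<forall>t\<in>{0..T}. \<forall>x. - B2 \<le> ?l t x" using strip[OF T] by blast
          ultimately show ?thesis by (intro exI[of _ "max B1 B2"]) (fastforce simp: le_max_iff_disj min_le_iff_disj minus_max_eq_min)
        qed
        show "w 0 x \<le> ?l 0 x" for x using w0[of x] u0[of x] eq[of 0 x] by simp
      qed
      then show "w t x \<le> ?u t x" using eq[OF t] by simp
      show "?u t x \<le> w t x"
      proof (rule HJ_comparison[OF H R upper_limit_subsolution super u_usc _ _ _ t])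
        show "\<forall>\<^sub>F z' in at z within ?S. c < (\<lambda>(t, x). w t x) z'" if "z \<in> ?S" "c < (\<lambda>(t, x). w t x) z" for z c
          using semi(2)[OF that(1) _ that(2), of "(\<lambda>(t, x). w t x) z + 1"] by simp
        show "\<exists>B. \<forall>t\<in>{0..T}. \<forall>x. ?u t x \<le> B \<and> - B \<le> w t x" if T: "0 < T" for T
        proof -
          obtain B1 where "\<forall>t\<in>{0..T}. \<forall>x. ?u t x \<le> B1" using strip[OF T] by blast
          moreover obtain B2 where "\<forall>t\<in>{0..T}. \<forall>x. - B2 \<le> w t x" using bds[OF T] by blast
          ultimately show ?thesis by (intro exI[of _ "max B1 B2"]) (fastforce simp: le_max_iff_disj min_le_iff_disj minus_max_eq_min)
        qed
        show "?u 0 x \<le> w 0 x" for x using w0[of x] u0[of x] by simp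
      qed
    qed
  qed
  show ?thesis
    using resolvent_root conv(2) visc unique by (intro conjI exI[of _ ?u]) auto
qed

end
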